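(* Let $G>0$, $\delta\in(0,G/2)$, $L\ge2G$, $\mathcal{T}_L:=\{(x,y)\in(0,L)^2\colon y<x\}$ and $\mathcal{P}_L:=\mathcal{T}_L\times(0,L)$. Let $\Omega\in\{\mathcal{T}_L,\mathcal{P}_L\}$, with $d=2$ if $\Omega=\mathcal{T}_L$ and $d=3$ if $\Omega=\mathcal{P}_L$. Let $\bullet\in\{D,N\}$, let $V\in L^\infty(\Omega)$ be real-valued, let $S\subset\mathbb{R}^d$ be $(G,\delta)$-equidistributed, and let $\omega=\Omega\cap S$. Then the system $$\partial_tu(t)+(-\Delta^\bullet_\Omega+V)u(t)=\chi_\omega v(t)\quad(0<t<T),\qquad u(0)=u_0\in L^2(\Omega),$$ is null-controllable in any time $T>0$ with control cost $$C_T\le\left(\frac{\delta}{2G}\right)^{-R\cdot(1+(2G)^{4/3}\|V\|_\infty^{2/3})}\frac{R}{\sqrt T}\exp\left(\frac{R(2G)^2\ln^2(\delta/(2G))}{2T}+\|V_-\|_\infty T\right),$$ where $V_-=\max\{-V,0\}$ and $R=\max\{D(2),D(3)\}$ with the constants $D(d)$ described in the context.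
   Context: Equidistributed sets: let $G>0$, $\delta\in(0,G/2)$. A measurable set $S\subset\mathbb{R}^d$ is $(G,\delta)$-equidistributed if $S\supset\bigcup_{j\in\mathbb{Z}^d}B(z_j,\delta)$ for some $(z_j)_{j\in\mathbb{Z}^d}\subset\mathbb{R}^d$ with $B(z_j,\delta)\subset Gj+(0,G)^d$ for all $j\in\mathbb{Z}^d$, where $B(z,\delta)$ is the open Euclidean ball of radius $\delta$ around $z$. The superscript $\bullet\in\{D,N\}$ stands for Dirichlet or Neumann boundary conditions: $-\Delta_\Omega^\bullet+V$ is the lower semibounded self-adjoint operator on $L^2(\Omega)$ associated with the form $\int_\Omega\langle\nabla f,\nabla g\rangle_{\mathbb{C}^d}\,dx+\langle Vf,g\rangle_{L^2(\Omega)}$ with form domain $H_0^1(\Omega)$ (Dirichlet) or $H^1(\Omega)$ (Neumann). With $H=-\Delta_\Omega^\bullet+V$, the system $\partial_tu+Hu=\chi_\omega v$, $u(0)=u_0$, is null-controllable in time $T>0$ if for every $u_0\in L^2(\Omega)$ there is $v\in L^2((0,T),L^2(\Omega))$ with $(\ast)$ $e^{-TH}u_0+\int_0^Te^{-(T-s)H}\chi_\omega v(s)\,ds=0$. Its control cost is $C_T=\sup_{\|u_0\|_{L^2(\Omega)}=1}\inf\{\|v\|_{L^2((0,T),L^2(\omega))}\colon v\text{ satisfies }(\ast)\}$. The constants $D(d)$: for each $d\in\mathbb{N}$, $D(d)>0$ is a constant depending only on $d$ with the following property (such constants are known to exist from earlier work). For all $G>0$, $\delta\in(0,G/2)$, every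 domain $\tilde\Omega=\prod_{j=1}^d(\alpha_j,\beta_j)$ with $\alpha_j,\beta_j\in\mathbb{R}\cup\{\pm\infty\}$, $\alpha_j<\beta_j$, and $(0,G)^d\subset\tilde\Omega$, every real-valued $V\in L^\infty(\tilde\Omega)$, either boundary condition, and every $(G,\delta)$-equidistributed set $S\subset\mathbb{R}^d$, the system $\partial_tu+(-\Delta^\bullet_{\tilde\Omega}+V)u=\chi_{\tilde\Omega\cap S}v$ is null-controllable in any time $T>0$ with control cost (with $D=D(d)$) $$C_T\le\left(\frac{\delta}{G}\right)^{-D\cdot(1+G^{4/3}\|V\|_\infty^{2/3})}\frac{D}{\sqrt T}\exp\left(\frac{DG^2\ln^2(\delta/G)}{2T}+\|V_-\|_\infty T\right).$$ *)

theory Defs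
  imports "HOL-Probability.Essential_Supremum"
begin

section \<open>The Hilbert space of square-integrable complex functions\<close>

definition square_integrable :: "('a::euclidean_space \<Rightarrow> complex) \<Rightarrow> bool" where
  "square_integrable f \<longleftrightarrow>
     f \<in> borel_measurable lebesgue \<and> integrable lebesgue (\<lambda>x. (norm (f x))\<^sup>2)"

definition l2_rel :: "('a::euclidean_space \<Rightarrow> complex) \<Rightarrow> ('a \<Rightarrow> complex) \<Rightarrow> bool" where
  "l2_rel f g \<longleftrightarrow>
     square_integrable f \<and> square_integrable g \<and> (AE x in lebesgue. f x = g x)"

lemma square_integrable_add:
  assumes "square_integrable f" "square_integrable g"
  shows "square_integrable (\<lambda>x. f x + g x)"
proof -
  have [measurable]: "f \<in> borel_measurable lebesgue" "g \<in> borel_measurable lebesgue"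
    using assms by (auto simp: square_integrable_def)
  have "integrable lebesgue (\<lambda>x. (norm (f x + g x))\<^sup>2)"
  proof (rule Bochner_Integration.integrable_bound)
    show "integrable lebesgue (\<lambda>x. 2 * (norm (f x))\<^sup>2 + 2 * (norm (g x))\<^sup>2)"
      using assms by (auto simp: square_integrable_def)
    show "AE x in lebesgue. norm ((norm (f x + g x))\<^sup>2)
            \<le> norm (2 * (norm (f x))\<^sup>2 + 2 * (norm (g x))\<^sup>2)"
    proof (rule AE_I2)
      fix x
      have "(norm (f x + g x))\<^sup>2 \<le> (norm (f x) + norm (g x))\<^sup>2"
        by (intro power_mono norm_triangle_ineq) auto
      also have "\<dots> \<le> 2 * (norm (f x))\<^sup>2 + 2 * (norm (g x))\<^sup>2"
        using zero_le_power2[of "norm (f x) - norm (g x)"]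
        by (simp add: power2_eq_square algebra_simps)
      finally show "norm ((norm (f x + g x))\<^sup>2)
            \<le> norm (2 * (norm (f x))\<^sup>2 + 2 * (norm (g x))\<^sup>2)" by simp
    qed
  qed measurable
  then show ?thesis by (simp add: square_integrable_def)
qed

lemma square_integrable_mult:
  assumes "square_integrable f"
  shows "square_integrable (\<lambda>x. c * f x)"
proof -
  have [measurable]: "f \<in> borel_measurable lebesgue"
    using assms by (auto simp: square_integrable_def)
  show ?thesis
    using assms by (auto simp: square_integrable_def norm_mult power_mult_distrib)
qed

lemma square_integrable_zero: "square_integrable (\<lambda>x. 0)"
  by (simp add: square_integrable_def)

lemma integrable_mult_cnj:
  assumes "square_integrable f" "square_integrable g"
  shows "integrable lebesgue (\<lambda>x. f x * cnj (g x))"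
proof -
  have [measurable]: "f \<in> borel_measurable lebesgue" "g \<in> borel_measurable lebesgue"
    using assms by (auto simp: square_integrable_def)
  have [measurable]: "(\<lambda>x. cnj (g x)) \<in> borel_measurable lebesgue"
    by (rule measurable_compose[of g lebesgue borel cnj borel])
       (auto intro!: borel_measurable_continuous_onI continuous_intros)
  show ?thesis
  proof (rule Bochner_Integration.integrable_bound)
    show "integrable lebesgue (\<lambda>x. (norm (f x))\<^sup>2 + (norm (g x))\<^sup>2)"
      using assms by (auto simp: square_integrable_def)
    show "AE x in lebesgue. norm (f x * cnj (g x)) \<le> norm ((norm (f x))\<^sup>2 + (norm (g x))\<^sup>2)"
    proof (rule AE_I2)
      fix x
      have "2 * (norm (f x) * norm (g x)) \<le> (norm (f x))\<^sup>2 + (norm (g x))\<^sup>2"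
        using sum_squares_bound[of "norm (f x)" "norm (g x)"] by (simp add: mult.assoc)
      moreover have "0 \<le> norm (f x) * norm (g x)" by simp
      ultimately have "norm (f x) * norm (g x) \<le> (norm (f x))\<^sup>2 + (norm (g x))\<^sup>2"
        by linarith
      then show "norm (f x * cnj (g x)) \<le> norm ((norm (f x))\<^sup>2 + (norm (g x))\<^sup>2)"
        by (simp add: norm_mult)
    qed
  qed measurable
qed

quotient_type (overloaded) 'a L2 = "'a::euclidean_space \<Rightarrow> complex" / partial: l2_rel
proof (rule part_equivpI)
  show "\<exists>f. l2_rel f (f :: 'a \<Rightarrow> complex)"
    by (rule exI[of _ "\<lambda>_. 0"]) (simp add: l2_rel_def square_integrable_zero)
  show "symp (l2_rel :: ('a \<Rightarrow> complex) \<Rightarrow> _)"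
    by (rule sympI) (auto simp: l2_rel_def)
  show "transp (l2_rel :: ('a \<Rightarrow> complex) \<Rightarrow> _)"
    by (rule transpI) (auto simp: l2_rel_def)
qed

lift_definition scaleC :: "complex \<Rightarrow> 'a::euclidean_space L2 \<Rightarrow> 'a L2" (infixr "*\<^sub>C" 75)
  is "\<lambda>c f x. c * f x"
  by (auto simp: l2_rel_def square_integrable_mult)

lift_definition cinner :: "'a::euclidean_space L2 \<Rightarrow> 'a L2 \<Rightarrow> complex"
  is "\<lambda>f g. \<integral>x. f x * cnj (g x) \<partial>lebesgue"
proof -
  fix f f' g g' :: "'a \<Rightarrow> complex"
  assume "l2_rel f f'" "l2_rel g g'"
  then have i: "integrable lebesgue (\<lambda>x. f x * cnj (g x))"
      "integrable lebesgue (\<lambda>x. f' x * cnj (g' x))"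
    and ae: "AE x in lebesgue. f x = f' x" "AE x in lebesgue. g x = g' x"
    by (auto simp: l2_rel_def intro!: integrable_mult_cnj)
  show "(\<integral>x. f x * cnj (g x) \<partial>lebesgue) = (\<integral>x. f' x * cnj (g' x) \<partial>lebesgue)"
    by (rule integral_cong_AE) (use i ae in \<open>auto\<close>)
qed

instantiation L2 :: (euclidean_space) real_inner
begin

lift_definition zero_L2 :: "'a L2" is "\<lambda>_. 0"
  by (simp add: l2_rel_def square_integrable_zero)

lift_definition plus_L2 :: "'a L2 \<Rightarrow> 'a L2 \<Rightarrow> 'a L2" is "\<lambda>f g x. f x + g x"
  by (auto simp: l2_rel_def square_integrable_add)

definition uminus_L2 :: "'a L2 \<Rightarrow> 'a L2" where "- f = (-1) *\<^sub>C f"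
definition minus_L2 :: "'a L2 \<Rightarrow> 'a L2 \<Rightarrow> 'a L2" where "f - g = f + (-1) *\<^sub>C g"
definition scaleR_L2 :: "real \<Rightarrow> 'a L2 \<Rightarrow> 'a L2" where "r *\<^sub>R f = complex_of_real r *\<^sub>C f"
definition inner_L2 :: "'a L2 \<Rightarrow> 'a L2 \<Rightarrow> real" where "inner_L2 f g = Re (cinner f g)"
definition norm_L2 :: "'a L2 \<Rightarrow> real" where "norm_L2 f = sqrt (inner f f)"
definition sgn_L2 :: "'a L2 \<Rightarrow> 'a L2" where "sgn_L2 f = inverse (norm f) *\<^sub>R f"
definition dist_L2 :: "'a L2 \<Rightarrow> 'a L2 \<Rightarrow> real" where "dist_L2 f g = norm (f - g)"
definition uniformity_L2 :: "('a L2 \<times> 'a L2) filter" where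
  "uniformity_L2 = (INF e\<in>{0 <..}. principal {(x, y). dist x y < e})"
definition open_L2 :: "'a L2 set \<Rightarrow> bool" where
  "open_L2 U = (\<forall>x\<in>U. eventually (\<lambda>(x', y). x' = x \<longrightarrow> y \<in> U) uniformity)"

lemma cinner_add_left: "cinner (f + g) h = cinner f h + cinner (g::'a L2) h"
  by transfer (auto simp: l2_rel_def algebra_simps integrable_mult_cnj
      intro!: Bochner_Integration.integral_add[symmetric] trans[OF _ Bochner_Integration.integral_add])

lemma cinner_scaleC_left: "cinner (c *\<^sub>C f) h = c * cinner (f::'a L2) h"
  by transfer (simp add: mult.assoc)

lemma cinner_commute: "cinner f g = cnj (cinner g (f::'a L2))"
proof transfer
  fix f g :: "'a \<Rightarrow> complex"
  have "(\<integral>x. cnj (g x * cnj (f x)) \<partial>lebesgue) = cnj (\<integral>x. g x * cnj (f x) \<partial>lebesgue)"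
    by (rule Bochner_Integration.integral_cnj)
  then show "(\<integral>x. f x * cnj (g x) \<partial>lebesgue) = cnj (\<integral>x. g x * cnj (f x) \<partial>lebesgue)"
    by (simp add: mult.commute del: Bochner_Integration.integral_cnj)
qed

lemma cinner_self: "cinner f (f::'a L2) = of_real (Re (cinner f f))" "0 \<le> Re (cinner f f)"
   "Re (cinner f f) = 0 \<longleftrightarrow> f = 0"
proof -
  have *: "(\<integral>x. f x * cnj (f x) \<partial>lebesgue) = of_real (\<integral>x. (norm (f x))\<^sup>2 \<partial>lebesgue)"
    for f :: "'a \<Rightarrow> complex"
    by (simp only: integral_complex_of_real[symmetric] complex_norm_square)
  show "cinner f f = of_real (Re (cinner f f))"
    by transfer (simp add: *)
  show "0 \<le> Re (cinner f f)"
    by transfer (simp add: *)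
  show "Re (cinner f f) = 0 \<longleftrightarrow> f = 0"
  proof (transfer)
    fix f :: "'a \<Rightarrow> complex" assume "l2_rel f f"
    then have s: "square_integrable f" by (simp add: l2_rel_def)
    then have "integrable lebesgue (\<lambda>x. (norm (f x))\<^sup>2)" by (simp add: square_integrable_def)
    from integral_nonneg_eq_0_iff_AE[OF this]
    show "(Re (\<integral>x. f x * cnj (f x) \<partial>lebesgue) = 0) = l2_rel f (\<lambda>_. 0)"
      by (simp add: * l2_rel_def s square_integrable_zero)
  qed
qed

instance
proof
  fix f g h :: "'a L2" and r s :: real
  show "f + g + h = f + (g + h)"
    by transfer (auto simp: l2_rel_def add.assoc square_integrable_add)
  show "f + g = g + f"
    by transfer (auto simp: l2_rel_def add.commute square_integrable_add)
  show "0 + f = f"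
    by transfer (auto simp: l2_rel_def)
  show "- f + f = 0" unfolding uminus_L2_def
    by transfer (auto simp: l2_rel_def square_integrable_zero)
  show "f - g = f + - g" by (simp add: minus_L2_def uminus_L2_def)
  show "r *\<^sub>R (f + g) = r *\<^sub>R f + r *\<^sub>R g" unfolding scaleR_L2_def
    by transfer (auto simp: l2_rel_def distrib_left square_integrable_add square_integrable_mult)
  show "(r + s) *\<^sub>R f = r *\<^sub>R f + s *\<^sub>R f" unfolding scaleR_L2_def
    by transfer (auto simp: l2_rel_def distrib_right square_integrable_add square_integrable_mult)
  show "r *\<^sub>R s *\<^sub>R f = (r * s) *\<^sub>R f" unfolding scaleR_L2_def
    by transfer (auto simp: l2_rel_def mult.assoc square_integrable_mult)
  show "1 *\<^sub>R f = f" unfolding scaleR_L2_def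
    by transfer (auto simp: l2_rel_def)
  show "dist f g = norm (f - g)" by (simp add: dist_L2_def)
  show "sgn f = inverse (norm f) *\<^sub>R f" by (simp add: sgn_L2_def)
  show "(uniformity :: ('a L2 \<times> 'a L2) filter) = (INF e\<in>{0 <..}. principal {(x, y). dist x y < e})"
    by (simp add: uniformity_L2_def)
  show "open U \<longleftrightarrow> (\<forall>x\<in>U. \<forall>\<^sub>F (x', y) in uniformity. x' = x \<longrightarrow> y \<in> U)" for U :: "'a L2 set"
    by (simp add: open_L2_def)
  show "inner f g = inner g f"
    unfolding inner_L2_def by (subst cinner_commute) simp
  show "inner (f + g) h = inner f h + inner g h"
    by (simp add: inner_L2_def cinner_add_left)
  show "inner (r *\<^sub>R f) g = r * inner f g"
    by (simp add: inner_L2_def scaleR_L2_def cinner_scaleC_left)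
  show "0 \<le> inner f f" by (simp add: inner_L2_def cinner_self(2))
  show "inner f f = 0 \<longleftrightarrow> f = 0" by (simp add: inner_L2_def cinner_self(3))
  show "norm f = sqrt (inner f f)" by (simp add: norm_L2_def)
qed

end


text \<open>Separability is needed because the Bochner integral of the library takes its values in
  second countable spaces.\<close>

lemma norm_abs_L2:
  assumes "square_integrable f"
  shows "(norm (abs_L2 f))\<^sup>2 = (\<integral>x. (norm (f x))\<^sup>2 \<partial>lebesgue)"
proof -
  have r: "l2_rel f f" using assms by (simp add: l2_rel_def)
  have "(norm (abs_L2 f))\<^sup>2 = Re (cinner (abs_L2 f) (abs_L2 f))"
    by (simp add: norm_L2_def inner_L2_def cinner_self(2))
  also have "cinner (abs_L2 f) (abs_L2 f) = (\<integral>x. f x * cnj (f x) \<partial>lebesgue)"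
    by (rule cinner.abs_eq[OF r r])
  also have "\<dots> = of_real (\<integral>x. (norm (f x))\<^sup>2 \<partial>lebesgue)"
    by (simp only: integral_complex_of_real[symmetric] complex_norm_square)
  finally show ?thesis by simp
qed

lemma abs_L2_diff:
  assumes "square_integrable f" "square_integrable g"
  shows "abs_L2 f - abs_L2 g = abs_L2 (\<lambda>x. f x - g x)"
proof -
  have r: "l2_rel f f" "l2_rel g g" "l2_rel (\<lambda>x. - 1 * g x) (\<lambda>x. - 1 * g x)"
    using assms square_integrable_mult[OF assms(2), of "-1"] by (auto simp: l2_rel_def)
  show ?thesis
    unfolding minus_L2_def scaleC.abs_eq[OF r(2)] plus_L2.abs_eq[OF r(1) r(3)] by simp
qed

lemma square_integrable_bound:
  assumes "square_integrable f" "g \<in> borel_measurable lebesgue"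
    and "\<And>x. norm (g x) \<le> C * norm (f x)"
  shows "square_integrable g"
  unfolding square_integrable_def
proof
  show "integrable lebesgue (\<lambda>x. (norm (g x))\<^sup>2)"
  proof (rule Bochner_Integration.integrable_bound)
    show "integrable lebesgue (\<lambda>x. C\<^sup>2 * (norm (f x))\<^sup>2)"
      using assms by (auto simp: square_integrable_def)
    show "AE x in lebesgue. norm ((norm (g x))\<^sup>2) \<le> norm (C\<^sup>2 * (norm (f x))\<^sup>2)"
    proof (rule AE_I2)
      fix x
      have "(norm (g x))\<^sup>2 \<le> (C * norm (f x))\<^sup>2"
        by (intro power_mono assms(3)) auto
      then show "norm ((norm (g x))\<^sup>2) \<le> norm (C\<^sup>2 * (norm (f x))\<^sup>2)"
        by (simp add: power_mult_distrib)
    qed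
  qed (use assms(2) in measurable)
qed (rule assms(2))

lemma abs_L2_dominated_convergence:
  assumes f: "square_integrable f"
    and s: "\<And>n. s n \<in> borel_measurable lebesgue" "\<And>n x. norm (s n x) \<le> 2 * norm (f x)"
    and lim: "\<And>x. (\<lambda>n. s n x) \<longlonglongrightarrow> f x"
  shows "(\<lambda>n. abs_L2 (s n)) \<longlonglongrightarrow> abs_L2 f"
proof -
  have sq: "square_integrable (s n)" for n
    by (rule square_integrable_bound[OF f s])
  have fm [measurable]: "f \<in> borel_measurable lebesgue"
    using f by (simp add: square_integrable_def)
  note s(1)[measurable]
  have sqd: "square_integrable (\<lambda>x. s n x - f x)" for n
    using square_integrable_add[OF sq[of n] square_integrable_mult[OF f, of "-1"]] by simp
  have "(\<lambda>n. \<integral>x. (norm (s n x - f x))\<^sup>2 \<partial>lebesgue) \<longlonglongrightarrow> (\<integral>x. 0 \<partial>(lebesgue :: 'a measure))"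
  proof (rule integral_dominated_convergence[where w="\<lambda>x. 9 * (norm (f x))\<^sup>2"])
    show "integrable lebesgue (\<lambda>x. 9 * (norm (f x))\<^sup>2)"
      using f by (auto simp: square_integrable_def)
    show "AE x in lebesgue. (\<lambda>n. (norm (s n x - f x))\<^sup>2) \<longlonglongrightarrow> 0"
    proof (rule AE_I2)
      fix x
      have "(\<lambda>n. (norm (s n x - f x))\<^sup>2) \<longlonglongrightarrow> (norm (f x - f x))\<^sup>2"
        by (intro tendsto_intros lim)
      then show "(\<lambda>n. (norm (s n x - f x))\<^sup>2) \<longlonglongrightarrow> 0" by simp
    qed
    show "AE x in lebesgue. norm ((norm (s n x - f x))\<^sup>2) \<le> 9 * (norm (f x))\<^sup>2" for n
    proof (rule AE_I2)
      fix x
      have "norm (s n x - f x) \<le> 3 * norm (f x)"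
        using norm_triangle_ineq4[of "s n x" "f x"] s(2)[of n x] by simp
      then have "(norm (s n x - f x))\<^sup>2 \<le> (3 * norm (f x))\<^sup>2"
        by (intro power_mono) auto
      then show "norm ((norm (s n x - f x))\<^sup>2) \<le> 9 * (norm (f x))\<^sup>2"
        by (simp add: power_mult_distrib)
    qed
  qed measurable
  then have "(\<lambda>n. (norm (abs_L2 (s n) - abs_L2 f))\<^sup>2) \<longlonglongrightarrow> 0"
    by (simp add: abs_L2_diff[OF sq f] norm_abs_L2[OF sqd])
  then have "(\<lambda>n. sqrt ((norm (abs_L2 (s n) - abs_L2 f))\<^sup>2)) \<longlonglongrightarrow> sqrt 0"
    by (rule tendsto_real_sqrt)
  then have "(\<lambda>n. norm (abs_L2 (s n) - abs_L2 f)) \<longlonglongrightarrow> 0" by simp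
  then show ?thesis
    using Lim_null tendsto_norm_zero_iff by blast
qed

lemma square_integrable_indicator:
  assumes "A \<in> sets lebesgue" "emeasure lebesgue A < \<infinity>"
  shows "square_integrable (\<lambda>x. c * indicator A x)"
proof (rule square_integrable_mult)
  have "(norm (indicator A x :: complex))\<^sup>2 = indicator A x" for x :: 'a
    by (auto simp: indicator_def)
  moreover have "integrable lebesgue (indicator A :: 'a \<Rightarrow> real)"
    using assms by (auto simp: integrable_indicator_iff)
  moreover have "(indicator A :: 'a \<Rightarrow> complex) \<in> borel_measurable lebesgue"
    using assms by (intro borel_measurable_indicator)
  ultimately show "square_integrable (indicator A :: 'a \<Rightarrow> complex)"
    by (simp add: square_integrable_def)
qed

lemma closed_subset_L2_eq_UNIV:
  fixes K :: "'a::euclidean_space L2 set" and B :: "'a set set"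
  assumes K: "closed K" "0 \<in> K" "\<And>f g. f \<in> K \<Longrightarrow> g \<in> K \<Longrightarrow> f + g \<in> K"
    and B: "countable B" "topological_basis B"
    and gen: "\<And>c F. finite F \<Longrightarrow> F \<subseteq> B \<Longrightarrow> emeasure lebesgue (\<Union>F) < \<infinity>
                \<Longrightarrow> abs_L2 (\<lambda>x. c * indicator (\<Union>F) x) \<in> K"
  shows "K = UNIV"
proof -
  have zero: "abs_L2 (\<lambda>x. 0) \<in> K" using K(2) by (simp add: zero_L2_def)
  have opn: "abs_L2 (\<lambda>x. c * indicator T x) \<in> K"
    if T: "open T" "emeasure lebesgue T < \<infinity>" for c T
  proof -
    obtain U where U: "U \<subseteq> B" "T = \<Union>U"
      using topological_basisE[OF B(2)] B(2) T(1) by (metis topological_basis_def)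
    show ?thesis
    proof (cases "U = {}")
      case True then show ?thesis using U zero by simp
    next
      case False
      define u where "u = from_nat_into U"
      have u: "range u = U"
        unfolding u_def using False U(1) B(1)
        by (meson countable_subset range_from_nat_into)
      define S where "S n = \<Union>(u ` {..<n})" for n :: nat
      have ST: "S n \<subseteq> T" for n using u U unfolding S_def by auto
      have Sop: "open (S n)" for n
        unfolding S_def using u U(1) topological_basis_open[OF B(2)] by blast
      have "(\<lambda>n. abs_L2 (\<lambda>x. c * indicator (S n) x)) \<longlonglongrightarrow> abs_L2 (\<lambda>x. c * indicator T x)"
      proof (rule abs_L2_dominated_convergence)
        show "square_integrable (\<lambda>x. c * indicator T x)"
          using T by (intro square_integrable_indicator) auto
        show "(\<lambda>x. c * indicator (S n) x) \<in> borel_measurable lebesgue" for n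
          using Sop[of n]
          by (intro borel_measurable_times borel_measurable_indicator borel_measurable_const) auto
        show "norm (c * indicator (S n) x) \<le> 2 * norm (c * indicator T x)" for n x
          using ST[of n] by (auto simp: indicator_def norm_mult)
        show "(\<lambda>n. c * indicator (S n) x) \<longlonglongrightarrow> c * indicator T x" for x
        proof (cases "x \<in> T")
          case True
          then obtain m where "x \<in> u m" using u U by auto
          then have "eventually (\<lambda>n. c * indicator (S n) x = c * indicator T x) sequentially"
            using True unfolding S_def
            by (intro eventually_sequentiallyI[of "Suc m"]) (auto simp: indicator_def)
          then show ?thesis by (rule tendsto_eventually)
        next
          case False
          then have "x \<notin> S n" for n using ST by auto
          then show ?thesis using False by simp
        qed
      qed
      moreover have "abs_L2 (\<lambda>x. c * indicator (S n) x) \<in> K" for n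
        unfolding S_def
      proof (rule gen)
        show "u ` {..<n} \<subseteq> B" using u U by auto
        have "emeasure lebesgue (S n) \<le> emeasure lebesgue T"
          using ST T by (intro emeasure_mono) auto
        then show "emeasure lebesgue (\<Union> (u ` {..<n})) < \<infinity>"
          using T unfolding S_def by auto
      qed auto
      ultimately show ?thesis
        by (rule closed_sequentially[OF K(1), rotated])
    qed
  qed
  have meas: "abs_L2 (\<lambda>x. c * indicator A x) \<in> K"
    if A: "A \<in> sets lebesgue" "emeasure lebesgue A < \<infinity>" for c A
  proof -
    have "\<exists>T. open T \<and> A \<subseteq> T \<and> T - A \<in> lmeasurable
            \<and> emeasure lebesgue (T - A) < ennreal (inverse (Suc n))" for n
      by (rule sets_lebesgue_outer_open[OF A(1), of "inverse (Suc n)"]) auto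
    then obtain T where T: "\<And>n. open (T n)" "\<And>n. A \<subseteq> T n" "\<And>n. T n - A \<in> lmeasurable"
       "\<And>n. emeasure lebesgue (T n - A) < ennreal (inverse (Suc n))"
      by metis
    have Tfin: "emeasure lebesgue (T n) < \<infinity>" for n
    proof -
      have "emeasure lebesgue (T n) \<le> emeasure lebesgue A + emeasure lebesgue (T n - A)"
        using A(1) T[of n] emeasure_subadditive[of A lebesgue "T n - A"]
        by (auto simp: Un_absorb1 fmeasurableD)
      also have "\<dots> < \<infinity>" using A(2) T(3)[of n] by (auto simp: fmeasurable_def)
      finally show ?thesis .
    qed
    have Ts: "T n \<in> sets lebesgue" for n using T(1) by auto
    have n2: "(norm (abs_L2 (\<lambda>x. c * indicator (T n) x) - abs_L2 (\<lambda>x. c * indicator A x)))\<^sup>2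
        = (norm c)\<^sup>2 * measure lebesgue (T n - A)" for n
    proof -
      have "abs_L2 (\<lambda>x. c * indicator (T n) x) - abs_L2 (\<lambda>x. c * indicator A x)
          = abs_L2 (\<lambda>x. c * indicator (T n) x - c * indicator A x)"
        by (intro abs_L2_diff square_integrable_indicator Ts Tfin A)
      also have "(\<lambda>x. c * indicator (T n) x - c * indicator A x) = (\<lambda>x. c * indicator (T n - A) x)"
        using T(2)[of n] by (auto simp: indicator_def fun_eq_iff)
      also have "(norm (abs_L2 (\<lambda>x. c * indicator (T n - A) x)))\<^sup>2
          = (\<integral>x. (norm (c * indicator (T n - A) x))\<^sup>2 \<partial>lebesgue)"
        using T(3)[of n]
        by (intro norm_abs_L2 square_integrable_indicator) (auto simp: fmeasurable_def)
      also have "\<dots> = (\<integral>x. (norm c)\<^sup>2 * indicator (T n - A) x \<partial>lebesgue)"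
        by (intro Bochner_Integration.integral_cong) (auto simp: indicator_def)
      also have "\<dots> = (norm c)\<^sup>2 * measure lebesgue (T n - A)" by simp
      finally show ?thesis .
    qed
    have "(\<lambda>n. (norm c)\<^sup>2 * measure lebesgue (T n - A)) \<longlonglongrightarrow> (norm c)\<^sup>2 * 0"
    proof (intro tendsto_intros tendsto_sandwich[OF _ _ tendsto_const LIMSEQ_inverse_real_of_nat])
      show "\<forall>\<^sub>F n in sequentially. measure lebesgue (T n - A) \<le> inverse (real (Suc n))"
      proof (rule always_eventually, rule allI)
        fix n show "measure lebesgue (T n - A) \<le> inverse (real (Suc n))"
          using T(3)[of n] T(4)[of n]
          by (metis emeasure_eq_measure2 ennreal_leI ennreal_less_iff less_imp_le measure_nonneg)
      qed
    qed auto
    then have "(\<lambda>n. sqrt ((norm (abs_L2 (\<lambda>x. c * indicator (T n) x) - abs_L2 (\<lambda>x. c * indicator A x)))\<^sup>2))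
        \<longlonglongrightarrow> sqrt 0"
      unfolding n2 by (intro tendsto_real_sqrt) simp
    then have "(\<lambda>n. norm (abs_L2 (\<lambda>x. c * indicator (T n) x) - abs_L2 (\<lambda>x. c * indicator A x))) \<longlonglongrightarrow> 0"
      by simp
    then have "(\<lambda>n. abs_L2 (\<lambda>x. c * indicator (T n) x)) \<longlonglongrightarrow> abs_L2 (\<lambda>x. c * indicator A x)"
      using Lim_null tendsto_norm_zero_iff by blast
    with opn[OF T(1) Tfin] show ?thesis
      by (rule closed_sequentially[OF K(1)])
  qed
  have simple: "abs_L2 s \<in> K" if s: "simple_function lebesgue s" "square_integrable s" for s
  proof -
    have fin: "finite (range s)" using simple_functionD(1)[OF s(1)] by simp
    have lev: "s -` {y} \<in> sets lebesgue" for y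
      using simple_functionD(2)[OF s(1), of "{y}"] by simp
    have levfin: "emeasure lebesgue (s -` {y}) < \<infinity>" if "y \<noteq> 0" for y
    proof -
      have "integrable lebesgue (\<lambda>x. (norm y)\<^sup>2 * indicator (s -` {y}) x)"
      proof (rule Bochner_Integration.integrable_bound)
        show "integrable lebesgue (\<lambda>x. (norm (s x))\<^sup>2)"
          using s by (simp add: square_integrable_def)
        show "(\<lambda>x. (norm y)\<^sup>2 * indicator (s -` {y}) x) \<in> borel_measurable lebesgue"
          using lev by (intro borel_measurable_times borel_measurable_indicator) auto
      qed (auto simp: indicator_def)
      then have "integrable lebesgue (indicator (s -` {y}) :: 'a \<Rightarrow> real)"
        using that by simp
      then show ?thesis by (simp add: integrable_indicator_iff del: emeasure_completion)
    qed
    have part: "square_integrable (\<lambda>x. \<Sum>y\<in>Y. y * indicator (s -` {y}) x) \<and>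
        abs_L2 (\<lambda>x. \<Sum>y\<in>Y. y * indicator (s -` {y}) x) \<in> K" if "finite Y" for Y
      using that
    proof (induction Y)
      case empty then show ?case by (simp add: zero square_integrable_zero)
    next
      case (insert y Y)
      have 1: "square_integrable (\<lambda>x. y * indicator (s -` {y}) x)
          \<and> abs_L2 (\<lambda>x. y * indicator (s -` {y}) x) \<in> K"
      proof (cases "y = 0")
        case True then show ?thesis by (simp add: zero square_integrable_zero)
      next
        case False
        show ?thesis
          using square_integrable_indicator[OF lev levfin[OF False]] meas[OF lev levfin[OF False]]
          by blast
      qed
      have eq: "abs_L2 (\<lambda>x. y * indicator (s -` {y}) x + (\<Sum>y\<in>Y. y * indicator (s -` {y}) x))
         = abs_L2 (\<lambda>x. y * indicator (s -` {y}) x) + abs_L2 (\<lambda>x. \<Sum>y\<in>Y. y * indicator (s -` {y}) x)"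
        using 1 insert by (intro plus_L2.abs_eq[symmetric]) (auto simp: l2_rel_def)
      show ?case
        unfolding sum.insert[OF insert.hyps] eq
        by (intro conjI square_integrable_add K(3)) (use insert.IH 1 in \<open>blast+\<close>)
    qed
    have "s = (\<lambda>x. \<Sum>y\<in>range s. y * indicator (s -` {y}) x)"
    proof
      fix x
      have "(\<Sum>y\<in>range s. y * indicator (s -` {y}) x) = (\<Sum>y\<in>range s. if y = s x then s x else 0)"
        by (intro sum.cong) (auto simp: indicator_def)
      also have "\<dots> = s x" using fin by (simp add: sum.delta)
      finally show "s x = (\<Sum>y\<in>range s. y * indicator (s -` {y}) x)" by simp
    qed
    then show ?thesis using part[OF fin] by metis
  qed
  have "h \<in> K" for h
  proof (induction h rule: L2.abs_induct)
    fix f :: "'a \<Rightarrow> complex" assume "l2_rel f f"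
    then have f: "square_integrable f" by (simp add: l2_rel_def)
    then have "f \<in> borel_measurable lebesgue" by (simp add: square_integrable_def)
    from borel_measurable_implies_sequence_metric[OF this, of 0]
    obtain s where s: "\<And>i. simple_function lebesgue (s i)" "\<And>x. (\<lambda>i. s i x) \<longlonglongrightarrow> f x"
      "\<And>i x. norm (s i x) \<le> 2 * norm (f x)"
      by (auto simp: dist_norm)
    have sm: "s i \<in> borel_measurable lebesgue" for i
      using s(1) by (rule borel_measurable_simple_function)
    have "(\<lambda>i. abs_L2 (s i)) \<longlonglongrightarrow> abs_L2 f"
      by (rule abs_L2_dominated_convergence[OF f sm s(3) s(2)])
    moreover have "abs_L2 (s i) \<in> K" for i
      by (intro simple s(1) square_integrable_bound[OF f sm s(3)])
    ultimately show "abs_L2 f \<in> K"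
      by (rule closed_sequentially[OF K(1), rotated])
  qed
  then show ?thesis by auto
qed

lemma countable_dense_L2: "\<exists>D :: 'a::euclidean_space L2 set. countable D \<and> closure D = UNIV"
proof -
  obtain B :: "'a set set" where B: "countable B" "topological_basis B"
    using ex_countable_basis by auto
  obtain Q :: "complex set" where Q: "countable Q" "\<And>X. open X \<Longrightarrow> X \<noteq> {} \<Longrightarrow> \<exists>q\<in>Q. q \<in> X"
    using countable_dense_exists by metis
  have Qc: "closure Q = UNIV"
  proof -
    have "\<exists>q\<in>Q. dist q c < e" if "e > 0" for c e
      using Q(2)[of "ball c e"] that by (auto simp: dist_commute)
    then show ?thesis by (auto simp: closure_approachable)
  qed
  define g where "g = (\<lambda>(q::complex, F). abs_L2 (\<lambda>x::'a. q * indicator (\<Union>F) x))"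
  define C where "C = g ` (Q \<times> {F. F \<subseteq> B \<and> finite F})"
  define D where "D = sum_list ` lists C"
  have "countable {F. F \<subseteq> B \<and> finite F}"
    using countable_Collect_finite_subset[OF B(1)] by (simp add: conj_commute)
  then have "countable D" unfolding D_def C_def using Q(1) by auto
  have Dadd: "f + h \<in> D" if fh: "f \<in> D" "h \<in> D" for f h
  proof -
    from fh obtain l m where "l \<in> lists C" "m \<in> lists C" "f = sum_list l" "h = sum_list m"
      by (auto simp: D_def)
    then show ?thesis unfolding D_def by (intro image_eqI[of _ _ "l @ m"]) auto
  qed
  have "closure D = UNIV"
  proof (rule closed_subset_L2_eq_UNIV[OF _ _ _ B])
    have "0 \<in> D" unfolding D_def by (intro image_eqI[of _ _ "[]"]) auto
    then show "0 \<in> closure D" using closure_subset by blast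
    show "f + h \<in> closure D" if fh: "f \<in> closure D" "h \<in> closure D" for f h
    proof -
      from fh obtain a b where "\<And>n. a n \<in> D" "a \<longlonglongrightarrow> f" "\<And>n. b n \<in> D" "b \<longlonglongrightarrow> h"
        unfolding closure_sequential by auto
      then show ?thesis unfolding closure_sequential
        by (intro exI[of _ "\<lambda>n. a n + b n"]) (auto intro: Dadd tendsto_add)
    qed
    fix c :: complex and F
    assume F: "finite F" "F \<subseteq> B" "emeasure lebesgue (\<Union>F) < \<infinity>"
    have "open (\<Union>F)" using F(2) topological_basis_open[OF B(2)] by auto
    then have Fs: "\<Union>F \<in> sets lebesgue" by auto
    obtain q where q: "\<And>n. q n \<in> Q" "q \<longlonglongrightarrow> c"
      using Qc closure_sequential[of c Q] by auto
    let ?e = "abs_L2 (\<lambda>x::'a. 1 * indicator (\<Union>F) x)"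
    have e: "abs_L2 (\<lambda>x. a * indicator (\<Union>F) x) = a *\<^sub>C ?e" for a
      using square_integrable_indicator[OF Fs F(3), of 1]
      by (subst scaleC.abs_eq) (auto simp: l2_rel_def)
    have nm: "norm (a *\<^sub>C f) = norm a * norm f" for a and f :: "'a L2"
    proof -
      have "cinner (a *\<^sub>C f) (a *\<^sub>C f) = a * cnj (cinner (a *\<^sub>C f) f)"
        by (metis cinner_commute cinner_scaleC_left)
      also have "\<dots> = a * cnj a * cinner f f"
        by (metis cinner_commute cinner_scaleC_left complex_cnj_mult mult.assoc)
      also have "\<dots> = of_real ((norm a)\<^sup>2) * cinner f f"
        by (simp only: complex_norm_square)
      finally have "Re (cinner (a *\<^sub>C f) (a *\<^sub>C f)) = (norm a)\<^sup>2 * Re (cinner f f)"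
        by (simp only: Re_complex_of_real Im_complex_of_real times_complex.sel mult_zero_left diff_zero)
      then show ?thesis
        by (simp add: norm_L2_def inner_L2_def real_sqrt_mult)
    qed
    have "(\<lambda>n. norm (q n *\<^sub>C ?e - c *\<^sub>C ?e)) \<longlonglongrightarrow> 0"
    proof -
      have "q n *\<^sub>C ?e - c *\<^sub>C ?e = (q n - c) *\<^sub>C ?e" for n
        using square_integrable_indicator[OF Fs F(3)]
        by (simp only: e[symmetric] abs_L2_diff left_diff_distrib)
      moreover have "(\<lambda>n. norm (q n - c) * norm ?e) \<longlonglongrightarrow> norm (c - c) * norm ?e"
        by (intro tendsto_intros q(2))
      ultimately show ?thesis by (simp add: nm)
    qed
    then have "(\<lambda>n. q n *\<^sub>C ?e) \<longlonglongrightarrow> c *\<^sub>C ?e"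
      using Lim_null tendsto_norm_zero_iff by blast
    moreover have "q n *\<^sub>C ?e \<in> D" for n
    proof -
      have "q n *\<^sub>C ?e \<in> C"
        unfolding C_def e[symmetric] using q(1)[of n] F by (auto simp: g_def)
      then show ?thesis unfolding D_def by (intro image_eqI[of _ _ "[q n *\<^sub>C ?e]"]) auto
    qed
    ultimately show "abs_L2 (\<lambda>x. c * indicator (\<Union>F) x) \<in> closure D"
      unfolding e[of c] closure_sequential
      by (intro exI[of _ "\<lambda>n. q n *\<^sub>C ?e"] conjI allI)
  qed auto
  with \<open>countable D\<close> show ?thesis by blast
qed

instance L2 :: (euclidean_space) second_countable_topology
proof
  obtain D :: "'a L2 set" where D: "countable D" "closure D = UNIV"
    using countable_dense_L2 by auto
  let ?B = "(\<lambda>(d, r). ball d r) ` (D \<times> \<rat>)"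
  have "topological_basis ?B"
  proof (rule topological_basisI)
    fix U :: "'a L2 set" and f assume "open U" "f \<in> U"
    then obtain e where e: "e > 0" "ball f e \<subseteq> U" by (auto simp: open_contains_ball)
    obtain r where r: "r \<in> \<rat>" "0 < r" "r < e / 2"
      using Rats_dense_in_real[of 0 "e / 2"] e by auto
    obtain d where d: "d \<in> D" "dist d f < r"
      using D(2) r(2) closure_approachable[of f D] by auto
    have "ball d r \<subseteq> ball f e"
    proof
      fix h assume "h \<in> ball d r"
      then show "h \<in> ball f e"
        using d(2) r(3) dist_triangle[of f h d] by (simp add: dist_commute)
    qed
    then show "\<exists>B'\<in>?B. f \<in> B' \<and> B' \<subseteq> U"
      using d r e by (intro bexI[of _ "ball d r"]) auto
  qed auto
  moreover have "countable ?B" using D(1) countable_rat by auto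
  ultimately show "\<exists>B :: 'a L2 set set. countable B \<and> open = generate_topology B"
    using topological_basis_imp_subbasis by blast
qed


section \<open>Function spaces on a subset of Euclidean space\<close>

text \<open>The space \<open>L\<^sup>2(\<Omega>)\<close> is identified, via extension by zero, with the closed subspace of
  classes vanishing almost everywhere outside \<open>\<Omega>\<close>.\<close>

lift_definition vanishes_outside :: "'a::euclidean_space set \<Rightarrow> 'a L2 \<Rightarrow> bool"
  is "\<lambda>\<Omega> f. AE x in lebesgue. x \<notin> \<Omega> \<longrightarrow> f x = 0"
proof -
  fix \<Omega> :: "'a set" and f g :: "'a \<Rightarrow> complex"
  assume "l2_rel f g"
  then have "AE x in lebesgue. f x = g x" by (simp add: l2_rel_def)
  then have "AE x in lebesgue. (x \<notin> \<Omega> \<longrightarrow> f x = 0) \<longleftrightarrow> (x \<notin> \<Omega> \<longrightarrow> g x = 0)"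
    by eventually_elim simp
  then show "(AE x in lebesgue. x \<notin> \<Omega> \<longrightarrow> f x = 0) = (AE x in lebesgue. x \<notin> \<Omega> \<longrightarrow> g x = 0)"
    by (rule eventually_subst)
qed

definition L2_on :: "'a::euclidean_space set \<Rightarrow> 'a L2 set" where
  "L2_on \<Omega> = {f. vanishes_outside \<Omega> f}"

definition Linf :: "'a::euclidean_space set \<Rightarrow> ('a \<Rightarrow> real) set" where
  "Linf \<Omega> = {V. V \<in> borel_measurable (lebesgue_on \<Omega>) \<and> (\<exists>C. AE x in lebesgue_on \<Omega>. \<bar>V x\<bar> \<le> C)}"

definition Linf_norm :: "'a::euclidean_space set \<Rightarrow> ('a \<Rightarrow> real) \<Rightarrow> real" where
  "Linf_norm \<Omega> V = real_of_ereal (esssup (lebesgue_on \<Omega>) (\<lambda>x. ereal \<bar>V x\<bar>))"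

text \<open>Multiplication by \<open>\<chi>\<^sub>\<Omega> m\<close>, intended for measurable \<open>\<Omega>\<close> and \<open>m\<close> essentially bounded on \<open>\<Omega>\<close>.\<close>

definition mult_on :: "'a::euclidean_space set \<Rightarrow> ('a \<Rightarrow> real) \<Rightarrow> 'a L2 \<Rightarrow> 'a L2" where
  "mult_on \<Omega> m f = abs_L2 (\<lambda>x. if x \<in> \<Omega> then complex_of_real (m x) * rep_L2 f x else 0)"

abbreviation chi :: "'a::euclidean_space set \<Rightarrow> 'a L2 \<Rightarrow> 'a L2" where
  "chi \<omega> \<equiv> mult_on \<omega> (\<lambda>_. 1)"

primrec C_k :: "nat \<Rightarrow> ('a::euclidean_space \<Rightarrow> complex) \<Rightarrow> bool" where
  "C_k 0 f \<longleftrightarrow> continuous_on UNIV f"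
| "C_k (Suc k) f \<longleftrightarrow> (\<forall>x. f differentiable (at x)) \<and>
     (\<forall>b\<in>Basis. C_k k (\<lambda>x. frechet_derivative f (at x) b))"

definition test_function :: "'a::euclidean_space set \<Rightarrow> ('a \<Rightarrow> complex) \<Rightarrow> bool" where
  "test_function \<Omega> \<phi> \<longleftrightarrow> (\<forall>k. C_k k \<phi>) \<and>
     compact (closure {x. \<phi> x \<noteq> 0}) \<and> closure {x. \<phi> x \<noteq> 0} \<subseteq> \<Omega>"

text \<open>The sesquilinear pairing may be used here in place of the bilinear one because the
  space of test functions is closed under complex conjugation.\<close>

definition has_weak_derivative ::
    "'a::euclidean_space set \<Rightarrow> 'a \<Rightarrow> 'a L2 \<Rightarrow> 'a L2 \<Rightarrow> bool" where
  "has_weak_derivative \<Omega> b f g \<longleftrightarrow> f \<in> L2_on \<Omega> \<and> g \<in> L2_on \<Omega> \<and>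
     (\<forall>\<phi>. test_function \<Omega> \<phi> \<longrightarrow>
        cinner f (abs_L2 (\<lambda>x. frechet_derivative \<phi> (at x) b)) = - cinner g (abs_L2 \<phi>))"

definition weak_derivative :: "'a::euclidean_space set \<Rightarrow> 'a \<Rightarrow> 'a L2 \<Rightarrow> 'a L2" where
  "weak_derivative \<Omega> b f = (THE g. has_weak_derivative \<Omega> b f g)"

definition H1 :: "'a::euclidean_space set \<Rightarrow> 'a L2 set" where
  "H1 \<Omega> = {f \<in> L2_on \<Omega>. \<forall>b\<in>Basis. \<exists>g. has_weak_derivative \<Omega> b f g}"

definition H1_norm :: "'a::euclidean_space set \<Rightarrow> 'a L2 \<Rightarrow> real" where
  "H1_norm \<Omega> f = sqrt ((norm f)\<^sup>2 + (\<Sum>b\<in>Basis. (norm (weak_derivative \<Omega> b f))\<^sup>2))"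

definition H1_0 :: "'a::euclidean_space set \<Rightarrow> 'a L2 set" where
  "H1_0 \<Omega> = {f \<in> H1 \<Omega>. \<forall>\<epsilon>>0. \<exists>\<phi>. test_function \<Omega> \<phi> \<and> H1_norm \<Omega> (f - abs_L2 \<phi>) < \<epsilon>}"


section \<open>Schroedinger operators and their semigroups\<close>

datatype boundary_condition = Dirichlet | Neumann

fun form_domain :: "boundary_condition \<Rightarrow> 'a::euclidean_space set \<Rightarrow> 'a L2 set" where
  "form_domain Dirichlet \<Omega> = H1_0 \<Omega>"
| "form_domain Neumann \<Omega> = H1 \<Omega>"

definition schroedinger_form ::
    "'a::euclidean_space set \<Rightarrow> ('a \<Rightarrow> real) \<Rightarrow> 'a L2 \<Rightarrow> 'a L2 \<Rightarrow> complex" where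
  "schroedinger_form \<Omega> V f g =
     (\<Sum>b\<in>Basis. cinner (weak_derivative \<Omega> b f) (weak_derivative \<Omega> b g)) + cinner (mult_on \<Omega> V f) g"

text \<open>Unbounded operators are represented by their graphs.\<close>

definition schroedinger_operator ::
    "boundary_condition \<Rightarrow> 'a::euclidean_space set \<Rightarrow> ('a \<Rightarrow> real) \<Rightarrow> ('a L2 \<times> 'a L2) set" where
  "schroedinger_operator bc \<Omega> V =
     {(f, h). f \<in> form_domain bc \<Omega> \<and> h \<in> L2_on \<Omega> \<and>
        (\<forall>g\<in>form_domain bc \<Omega>. schroedinger_form \<Omega> V f g = cinner h g)}"

definition C0_semigroup_on :: "'a::euclidean_space L2 set \<Rightarrow> (real \<Rightarrow> 'a L2 \<Rightarrow> 'a L2) \<Rightarrow> bool" where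
  "C0_semigroup_on X U \<longleftrightarrow>
     (\<forall>t\<ge>0. (\<forall>f\<in>X. U t f \<in> X) \<and>
        (\<forall>f\<in>X. \<forall>g\<in>X. U t (f + g) = U t f + U t g) \<and>
        (\<forall>c. \<forall>f\<in>X. U t (c *\<^sub>C f) = c *\<^sub>C U t f) \<and>
        (\<exists>C. \<forall>f\<in>X. norm (U t f) \<le> C * norm f)) \<and>
     (\<forall>f\<in>X. U 0 f = f) \<and>
     (\<forall>s\<ge>0. \<forall>t\<ge>0. \<forall>f\<in>X. U (s + t) f = U s (U t f)) \<and>
     (\<forall>f\<in>X. ((\<lambda>t. U t f) \<longlongrightarrow> f) (at_right 0))"

definition generator ::
    "'a::euclidean_space L2 set \<Rightarrow> (real \<Rightarrow> 'a L2 \<Rightarrow> 'a L2) \<Rightarrow> ('a L2 \<times> 'a L2) set" where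
  "generator X U =
     {(f, g). f \<in> X \<and> g \<in> X \<and> ((\<lambda>t. (1 / t) *\<^sub>R (U t f - f)) \<longlongrightarrow> g) (at_right 0)}"

definition is_exp_semigroup ::
    "'a::euclidean_space L2 set \<Rightarrow> ('a L2 \<times> 'a L2) set \<Rightarrow> (real \<Rightarrow> 'a L2 \<Rightarrow> 'a L2) \<Rightarrow> bool" where
  "is_exp_semigroup X H U \<longleftrightarrow> C0_semigroup_on X U \<and> generator X U = {(f, - h) | f h. (f, h) \<in> H}"

text \<open>\<open>exp_semigroup X H t\<close> is \<open>e\<^sup>-\<^sup>t\<^sup>H\<close>, the strongly continuous semigroup on \<open>X\<close> generated by \<open>-H\<close>.
  Only its values for \<open>t \<ge> 0\<close> on \<open>X\<close>, which are uniquely determined by \<open>H\<close>, are meaningful.\<close>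

definition exp_semigroup ::
    "'a::euclidean_space L2 set \<Rightarrow> ('a L2 \<times> 'a L2) set \<Rightarrow> real \<Rightarrow> 'a L2 \<Rightarrow> 'a L2" where
  "exp_semigroup X H = (SOME U. is_exp_semigroup X H U)"


section \<open>Null-controllability and control cost\<close>

text \<open>Throughout, \<open>X\<close> is \<open>L\<^sup>2(\<Omega>)\<close> and \<open>H\<close> is the graph of an operator on \<open>X\<close>.\<close>

definition L2_time :: "real \<Rightarrow> 'a::euclidean_space L2 set \<Rightarrow> (real \<Rightarrow> 'a L2) set" where
  "L2_time T X = {v. v \<in> borel_measurable (lebesgue_on {0<..<T}) \<and> (\<forall>s\<in>{0<..<T}. v s \<in> X) \<and>
     integrable (lebesgue_on {0<..<T}) (\<lambda>s. (norm (v s))\<^sup>2)}"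

definition L2_time_norm :: "real \<Rightarrow> (real \<Rightarrow> 'a::euclidean_space L2) \<Rightarrow> real" where
  "L2_time_norm T v = sqrt (\<integral>s. (norm (v s))\<^sup>2 \<partial>lebesgue_on {0<..<T})"

definition null_controls :: "'a::euclidean_space L2 set \<Rightarrow> ('a L2 \<times> 'a L2) set \<Rightarrow> 'a set \<Rightarrow> real
    \<Rightarrow> 'a L2 \<Rightarrow> (real \<Rightarrow> 'a L2) set" where
  "null_controls X H \<omega> T u0 = {v \<in> L2_time T X.
     exp_semigroup X H T u0 +
       (\<integral>s. exp_semigroup X H (T - s) (chi \<omega> (v s)) \<partial>lebesgue_on {0<..<T}) = 0}"

text \<open>The first conjunct only says that \<open>e\<^sup>-\<^sup>t\<^sup>H\<close> exists, so that \<open>exp_semigroup X H\<close> is meaningful.\<close>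

definition null_controllable ::
    "'a::euclidean_space L2 set \<Rightarrow> ('a L2 \<times> 'a L2) set \<Rightarrow> 'a set \<Rightarrow> real \<Rightarrow> bool" where
  "null_controllable X H \<omega> T \<longleftrightarrow>
     (\<exists>U. is_exp_semigroup X H U) \<and> (\<forall>u0\<in>X. null_controls X H \<omega> T u0 \<noteq> {})"

text \<open>Only \<open>\<chi>\<^sub>\<omega> v\<close> enters the cost, since it is measured in \<open>L\<^sup>2((0,T), L\<^sup>2(\<omega>))\<close>.\<close>

definition control_cost ::
    "'a::euclidean_space L2 set \<Rightarrow> ('a L2 \<times> 'a L2) set \<Rightarrow> 'a set \<Rightarrow> real \<Rightarrow> ereal" where
  "control_cost X H \<omega> T = (SUP u0\<in>{u0 \<in> X. norm u0 = 1}.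
     INF v\<in>null_controls X H \<omega> T u0. ereal (L2_time_norm T (\<lambda>s. chi \<omega> (v s))))"


section \<open>Equidistributed sets and the cost bound on generalized rectangles\<close>

definition equidistributed :: "real \<Rightarrow> real \<Rightarrow> (real ^ 'n::finite) set \<Rightarrow> bool" where
  "equidistributed G \<delta> S \<longleftrightarrow> S \<in> sets lebesgue \<and>
     (\<exists>z :: int ^ 'n \<Rightarrow> real ^ 'n.
        (\<forall>j. ball (z j) \<delta> \<subseteq> {x. \<forall>i. G * of_int (j $ i) < x $ i \<and> x $ i < G * of_int (j $ i) + G}) \<and>
        (\<Union>j. ball (z j) \<delta>) \<subseteq> S)"

definition generalized_rectangle :: "ereal ^ 'n::finite \<Rightarrow> ereal ^ 'n \<Rightarrow> (real ^ 'n) set" where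
  "generalized_rectangle \<alpha> \<beta> = {x. \<forall>i. \<alpha> $ i < ereal (x $ i) \<and> ereal (x $ i) < \<beta> $ i}"

definition cost_bound ::
    "real \<Rightarrow> real \<Rightarrow> real \<Rightarrow> (real ^ 'n::finite) set \<Rightarrow> (real ^ 'n \<Rightarrow> real) \<Rightarrow> real \<Rightarrow> real" where
  "cost_bound D G \<delta> \<Omega> V T =
     (\<delta> / G) powr (- D * (1 + G powr (4 / 3) * Linf_norm \<Omega> V powr (2 / 3))) * (D / sqrt T) *
     exp (D * G\<^sup>2 * (ln (\<delta> / G))\<^sup>2 / (2 * T) + Linf_norm \<Omega> (\<lambda>x. max (- V x) 0) * T)"

text \<open>\<open>rectangle_cost_constant TYPE('n) D\<close> states that \<open>D\<close> is an admissible choice for the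
  constant \<open>D(d)\<close> in dimension \<open>d = CARD('n)\<close>.\<close>

definition rectangle_cost_constant :: "'n::finite itself \<Rightarrow> real \<Rightarrow> bool" where
  "rectangle_cost_constant TYPE('n) D \<longleftrightarrow> 0 < D \<and>
     (\<forall>G \<delta> (\<alpha> :: ereal ^ 'n) \<beta> V bc S T.
        0 < G \<longrightarrow> 0 < \<delta> \<longrightarrow> \<delta> < G / 2 \<longrightarrow> (\<forall>i. \<alpha> $ i < \<beta> $ i) \<longrightarrow>
        {x. \<forall>i. 0 < x $ i \<and> x $ i < G} \<subseteq> generalized_rectangle \<alpha> \<beta> \<longrightarrow>
        V \<in> Linf (generalized_rectangle \<alpha> \<beta>) \<longrightarrow> equidistributed G \<delta> S \<longrightarrow> 0 < T \<longrightarrow>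
        (let \<Omega> = generalized_rectangle \<alpha> \<beta>; H = schroedinger_operator bc \<Omega> V
         in null_controllable (L2_on \<Omega>) H (\<Omega> \<inter> S) T \<and>
            control_cost (L2_on \<Omega>) H (\<Omega> \<inter> S) T \<le> ereal (cost_bound D G \<delta> \<Omega> V T)))"


section \<open>The triangle and the prism\<close>

definition right_triangle :: "real \<Rightarrow> (real ^ 2) set" where
  "right_triangle L = {p. 0 < p $ 1 \<and> p $ 1 < L \<and> 0 < p $ 2 \<and> p $ 2 < L \<and> p $ 2 < p $ 1}"

definition prism :: "real \<Rightarrow> (real ^ 3) set" where
  "prism L = {p. vector [p $ 1, p $ 2] \<in> right_triangle L \<and> 0 < p $ 3 \<and> p $ 3 < L}"

end

theory Submission
  imports Defs "HOL-Real_Asymp.Real_Asymp"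
begin

text \<open>The domain is one half of a cube \<open>Q\<close>, cut along the hyperplane that is fixed by exchanging two
  coordinates. Let \<open>J\<close> extend functions from the half to \<open>Q\<close> by odd reflection in the Dirichlet case and by
  even reflection in the Neumann case, scaled by \<open>1/\<surd>2\<close> to an isometry. Then \<open>J\<close> and its adjoint map the
  form domains into each other and intertwine the forms, where the potential is reflected to \<open>Q\<close>.
  Hence the semigroup on the half is \<open>J\<^sup>* e\<^sup>-\<^sup>t\<^sup>H J\<close>, and \<open>J\<^sup>*\<close> turns a null control on \<open>Q\<close> into
  one on the half that is not more expensive. The reflected control set is \<open>(2G, \<delta>)\<close>-equidistributed,
  so that the cost bound for the cube applies. That the semigroup on \<open>Q\<close> commutes with
  the reflection, and that \<open>e\<^sup>-\<^sup>t\<^sup>H\<close> is well defined at all, is the uniqueness of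
  semigroups with a given dissipative generator.\<close>

section \<open>Representatives of classes\<close>

text \<open>The even extension is instead tested directly: a test function on \<open>Q\<close> is
  cut off near the hyperplane, and the derivative of the cutoff, which is of size k, only ever meets
  an antisymmetric function, which vanishes there to first order. The same estimate puts the
  restrictions of odd functions of \<open>H1_0\<close> of the cube into \<open>H1_0\<close> of the
  half, so it serves both boundary conditions. No spectral theory enters: the assumption on cubes
  supplies the semigroup there, and reflection supplies the one on the half. Since
  \<open>exp_semigroup\<close> picks some semigroup, the explicit one has to be compared with the
  one picked. Uniqueness is an energy estimate along orbits. It needs orbits that are differentiable
  from both sides, hence local boundedness of the semigroup, hence the uniform boundedness
  principle. The cell size doubles because the diagonal may cut the ball of a cell of size G; among
  the subcells of a doubled cell, one stays on one side of the diagonal.\<close>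

lemma square_integrable_rep [simp]: "square_integrable (rep_L2 f)"
  using Quotient3_rep_reflp[OF Quotient3_L2, of f] by (simp add: l2_rel_def)

lemma abs_rep_L2 [simp]: "abs_L2 (rep_L2 f) = f"
  by (rule Quotient3_abs_rep[OF Quotient3_L2])

lemma rep_L2_measurable [measurable]: "rep_L2 f \<in> borel_measurable lebesgue"
  using square_integrable_rep[of f] by (simp add: square_integrable_def)

lemma square_integrable_measurable:
  "square_integrable u \<Longrightarrow> u \<in> borel_measurable lebesgue"
  by (simp add: square_integrable_def)

lemma rep_abs_L2: "square_integrable u \<Longrightarrow> AE x in lebesgue. rep_L2 (abs_L2 u) x = u x"
  using rep_abs_rsp_left[OF Quotient3_L2, of u u] by (simp add: l2_rel_def)

lemma abs_L2_eqI:
  "square_integrable u \<Longrightarrow> square_integrable v \<Longrightarrow> AE x in lebesgue. u x = v x \<Longrightarrow> abs_L2 u = abs_L2 v"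
  by (rule Quotient3_rel_abs[OF Quotient3_L2]) (simp add: l2_rel_def)

text \<open>Operator identities below are proved by collecting the almost everywhere descriptions of
  all representatives involved and finishing pointwise with \<open>eventually_elim\<close>.\<close>

lemma L2_eq_iff: "f = g \<longleftrightarrow> (AE x in lebesgue. rep_L2 f x = rep_L2 g x)"
proof
  assume "AE x in lebesgue. rep_L2 f x = rep_L2 g x"
  then have "abs_L2 (rep_L2 f) = abs_L2 (rep_L2 g)" by (intro abs_L2_eqI) auto
  then show "f = g" by simp
qed simp

lemma square_integrable_AE_bound:
  assumes w: "square_integrable w" and "u \<in> borel_measurable lebesgue"
    and "AE x in lebesgue. norm (u x) \<le> norm (w x)"
  shows "square_integrable u"
  unfolding square_integrable_def
proof
  show "integrable lebesgue (\<lambda>x. (norm (u x))\<^sup>2)"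
  proof (rule Bochner_Integration.integrable_bound)
    show "integrable lebesgue (\<lambda>x. (norm (w x))\<^sup>2)"
      using w by (simp add: square_integrable_def)
    show "AE x in lebesgue. norm ((norm (u x))\<^sup>2) \<le> norm ((norm (w x))\<^sup>2)"
      using assms(3) by eventually_elim (auto intro: power_mono)
  qed (use assms(2) in measurable)
qed fact

lemma square_integrable_AE_cong:
  assumes "square_integrable w" "u \<in> borel_measurable lebesgue" "AE x in lebesgue. u x = w x"
  shows "square_integrable u"
  by (rule square_integrable_AE_bound[OF assms(1,2)]) (use assms(3) in \<open>eventually_elim, simp\<close>)

lemma abs_L2_add: "square_integrable u \<Longrightarrow> square_integrable v \<Longrightarrow>
    abs_L2 u + abs_L2 v = abs_L2 (\<lambda>x. u x + v x)"
  by (simp add: plus_L2.abs_eq l2_rel_def)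

lemma abs_L2_scaleC: "square_integrable u \<Longrightarrow> c *\<^sub>C abs_L2 u = abs_L2 (\<lambda>x. c * u x)"
  by (simp add: scaleC.abs_eq l2_rel_def)

lemma cinner_abs_L2: "square_integrable u \<Longrightarrow> square_integrable v \<Longrightarrow>
    cinner (abs_L2 u) (abs_L2 v) = (\<integral>x. u x * cnj (v x) \<partial>lebesgue)"
  by (simp add: cinner.abs_eq l2_rel_def)

lemma cinner_rep: "cinner f g = (\<integral>x. rep_L2 f x * cnj (rep_L2 g x) \<partial>lebesgue)"
  using cinner_abs_L2[OF square_integrable_rep[of f] square_integrable_rep[of g]] by simp

lemma rep_L2_add: "AE x in lebesgue. rep_L2 (f + g) x = rep_L2 f x + rep_L2 g x"
  using rep_abs_L2[OF square_integrable_add[OF square_integrable_rep[of f] square_integrable_rep[of g]]]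
  by (simp add: abs_L2_add[symmetric])

lemma rep_L2_scaleC: "AE x in lebesgue. rep_L2 (c *\<^sub>C f) x = c * rep_L2 f x"
  using rep_abs_L2[OF square_integrable_mult[OF square_integrable_rep[of f], of c]]
  by (simp add: abs_L2_scaleC[symmetric])

lemma rep_L2_zero: "AE x in lebesgue. rep_L2 0 x = 0"
  unfolding zero_L2_def by (rule rep_abs_L2[OF square_integrable_zero])

section \<open>Complex linear structure\<close>

lemma scaleC_add_right: "c *\<^sub>C (f + g) = c *\<^sub>C f + c *\<^sub>C (g :: 'a::euclidean_space L2)"
  by transfer (auto simp: l2_rel_def distrib_left square_integrable_add square_integrable_mult)

lemma scaleC_scaleC: "a *\<^sub>C b *\<^sub>C f = (a * b) *\<^sub>C (f :: 'a::euclidean_space L2)"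
  by transfer (auto simp: l2_rel_def mult.assoc square_integrable_mult)

lemma scaleC_of_real: "complex_of_real r *\<^sub>C f = r *\<^sub>R f"
  by (simp add: scaleR_L2_def)

lemma scaleC_minus_right: "c *\<^sub>C (- f) = - (c *\<^sub>C f)"
  unfolding uminus_L2_def by (simp add: scaleC_scaleC)

lemma scaleC_diff_right: "c *\<^sub>C (f - g) = c *\<^sub>C f - c *\<^sub>C g"
  by (simp only: diff_conv_add_uminus scaleC_add_right scaleC_minus_right)

lemma cinner_add_right: "cinner h (f + g) = cinner h f + cinner h g"
  by (metis cinner_add_left cinner_commute complex_cnj_add)

lemma cinner_scaleC_right: "cinner h (c *\<^sub>C f) = cnj c * cinner h f"
  by (metis cinner_commute cinner_scaleC_left complex_cnj_mult)

lemma cinner_minus_left: "cinner (- f) g = - cinner f g"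
  by (simp add: uminus_L2_def cinner_scaleC_left)

lemma cinner_minus_right: "cinner f (- g) = - cinner f g"
  by (simp add: uminus_L2_def cinner_scaleC_right)

lemma cinner_diff_left: "cinner (f - g) h = cinner f h - cinner g h"
  by (simp only: diff_conv_add_uminus cinner_add_left cinner_minus_left)

lemma cinner_diff_right: "cinner h (f - g) = cinner h f - cinner h g"
  by (simp only: diff_conv_add_uminus cinner_add_right cinner_minus_right)

lemma cinner_scaleR_left: "cinner (r *\<^sub>R f) g = of_real r * cinner f g"
  by (simp add: scaleR_L2_def cinner_scaleC_left)

lemma cinner_scaleR_right: "cinner f (r *\<^sub>R g) = of_real r * cinner f g"
  by (simp add: scaleR_L2_def cinner_scaleC_right)

lemma cinner_zero_left [simp]: "cinner 0 g = 0"
  using cinner_scaleR_left[of 0 0 g] by simp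

lemma cinner_zero_right [simp]: "cinner g 0 = 0"
  using cinner_scaleR_right[of g 0 0] by simp

lemma cinner_sum_left: "cinner (\<Sum>i\<in>I. f i) g = (\<Sum>i\<in>I. cinner (f i) g)"
  by (induction I rule: infinite_finite_induct) (auto simp: cinner_add_left)

lemmas cinner_simps = cinner_add_left cinner_add_right cinner_diff_left cinner_diff_right
  cinner_minus_left cinner_minus_right cinner_scaleR_left cinner_scaleR_right
  cinner_scaleC_left cinner_scaleC_right

lemma norm_eq_cinner: "(norm f)\<^sup>2 = Re (cinner f f)"
  by (simp add: norm_L2_def inner_L2_def cinner_self(2))

lemma norm_scaleC: "norm (c *\<^sub>C f) = norm c * norm f"
proof -
  have "cinner (c *\<^sub>C f) (c *\<^sub>C f) = (c * cnj c) * cinner f f"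
    by (simp add: cinner_scaleC_left cinner_scaleC_right)
  then have "cinner (c *\<^sub>C f) (c *\<^sub>C f) = of_real ((norm c)\<^sup>2) * cinner f f"
    by (simp only: complex_norm_square)
  then have "Re (cinner (c *\<^sub>C f) (c *\<^sub>C f)) = (norm c)\<^sup>2 * Re (cinner f f)"
    by (simp only: Re_complex_of_real Im_complex_of_real times_complex.sel mult_zero_left diff_zero)
  then have "(norm (c *\<^sub>C f))\<^sup>2 = (norm c * norm f)\<^sup>2"
    by (simp add: norm_eq_cinner power_mult_distrib)
  then show ?thesis by (simp add: power2_eq_iff_nonneg)
qed

lemma cinner_bound: "norm (cinner f g) \<le> norm f * norm g"
proof (cases "cinner f g = 0")
  case False
  \<comment> \<open>A phase of modulus one that turns the complex pairing into its modulus, so that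
    the real Cauchy-Schwarz inequality of the type class applies to \<open>c *\<^sub>C f\<close> and
    \<open>g\<close>.\<close>
  define c where "c = cnj (cinner f g) / norm (cinner f g)"
  have "c * cinner f g = (cinner f g * cnj (cinner f g)) / norm (cinner f g)"
    by (simp add: c_def)
  also have "\<dots> = norm (cinner f g)"
    using False by (simp only: complex_norm_square[symmetric]) (simp add: power2_eq_square)
  finally have "c * cinner f g = norm (cinner f g)" .
  then have "norm (cinner f g) = inner (c *\<^sub>C f) g"
    by (simp add: inner_L2_def cinner_scaleC_left)
  also have "\<dots> \<le> norm (c *\<^sub>C f) * norm g" by (rule norm_cauchy_schwarz)
  also have "norm c = 1" using False by (simp add: c_def norm_divide)
  then have "norm (c *\<^sub>C f) = norm f" by (simp add: norm_scaleC)
  finally show ?thesis .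
qed simp

lemma tendsto_cinner_left:
  assumes "(f \<longlongrightarrow> a) F" shows "((\<lambda>n. cinner (f n) g) \<longlongrightarrow> cinner a g) F"
proof -
  have "bounded_linear (\<lambda>f. cinner f g)"
    by (rule bounded_linear_intro[where K="norm g"])
       (auto simp: cinner_simps scaleR_conv_of_real cinner_bound)
  from bounded_linear.tendsto[OF this assms] show ?thesis .
qed

lemma tendsto_cinner_right:
  assumes "(f \<longlongrightarrow> a) F" shows "((\<lambda>n. cinner g (f n)) \<longlongrightarrow> cinner g a) F"
  using tendsto_cnj[OF tendsto_cinner_left[OF assms, of g]] by (simp flip: cinner_commute)

section \<open>Convergence in mean square\<close>

text \<open>The bound by \<open>w\<close> passes to the limit, so the squared distance to
  \<open>f\<close> is dominated by four times the square of \<open>w\<close>, and dominated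
  convergence applies. The majorant need not be related to the limit, as is required for infinite
  series and for cutoffs.\<close>

lemma tendsto_abs_L2:
  fixes s :: "nat \<Rightarrow> 'a::euclidean_space \<Rightarrow> complex"
  assumes w: "square_integrable w"
    and m: "\<And>n. s n \<in> borel_measurable lebesgue" "f \<in> borel_measurable lebesgue"
    and b: "\<And>n. AE x in lebesgue. norm (s n x) \<le> norm (w x)"
    and lim: "AE x in lebesgue. (\<lambda>n. s n x) \<longlonglongrightarrow> f x"
  shows "square_integrable f" "(\<lambda>n. abs_L2 (s n)) \<longlonglongrightarrow> abs_L2 f"
proof -
  have ball: "AE x in lebesgue. \<forall>n. norm (s n x) \<le> norm (w x)"
    using b by (simp add: AE_all_countable)
  have bf: "AE x in lebesgue. norm (f x) \<le> norm (w x)"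
    using ball lim
  proof eventually_elim
    case (elim x)
    then show ?case by (intro tendsto_upperbound[OF tendsto_norm[OF elim(2)]]) auto
  qed
  show sf: "square_integrable f" by (rule square_integrable_AE_bound[OF w m(2) bf])
  have sq: "square_integrable (s n)" for n by (rule square_integrable_AE_bound[OF w m(1) b])
  have sqd: "square_integrable (\<lambda>x. s n x - f x)" for n
    using square_integrable_add[OF sq[of n] square_integrable_mult[OF sf, of "-1"]] by simp
  note m[measurable]
  have "(\<lambda>n. \<integral>x. (norm (s n x - f x))\<^sup>2 \<partial>lebesgue) \<longlonglongrightarrow> (\<integral>x. 0 \<partial>(lebesgue :: 'a measure))"
  proof (rule integral_dominated_convergence[where w="\<lambda>x. 4 * (norm (w x))\<^sup>2"])
    show "integrable lebesgue (\<lambda>x. 4 * (norm (w x))\<^sup>2)"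
      using w by (auto simp: square_integrable_def)
    show "AE x in lebesgue. (\<lambda>n. (norm (s n x - f x))\<^sup>2) \<longlonglongrightarrow> 0"
      using lim
    proof eventually_elim
      fix x assume "(\<lambda>n. s n x) \<longlonglongrightarrow> f x"
      then have "(\<lambda>n. (norm (s n x - f x))\<^sup>2) \<longlonglongrightarrow> (norm (f x - f x))\<^sup>2"
        by (intro tendsto_intros)
      then show "(\<lambda>n. (norm (s n x - f x))\<^sup>2) \<longlonglongrightarrow> 0" by simp
    qed
    show "AE x in lebesgue. norm ((norm (s n x - f x))\<^sup>2) \<le> 4 * (norm (w x))\<^sup>2" for n
      using b[of n] bf
    proof eventually_elim
      case (elim x)
      have "norm (s n x - f x) \<le> 2 * norm (w x)"
        using norm_triangle_ineq4[of "s n x" "f x"] elim by simp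
      then have "(norm (s n x - f x))\<^sup>2 \<le> (2 * norm (w x))\<^sup>2"
        by (intro power_mono) auto
      then show ?case by (simp add: power_mult_distrib)
    qed
  qed measurable
  then have "(\<lambda>n. (norm (abs_L2 (s n) - abs_L2 f))\<^sup>2) \<longlonglongrightarrow> 0"
    by (simp add: abs_L2_diff[OF sq sf] norm_abs_L2[OF sqd])
  then have "(\<lambda>n. sqrt ((norm (abs_L2 (s n) - abs_L2 f))\<^sup>2)) \<longlonglongrightarrow> sqrt 0"
    by (rule tendsto_real_sqrt)
  then have "(\<lambda>n. norm (abs_L2 (s n) - abs_L2 f)) \<longlonglongrightarrow> 0" by simp
  then show "(\<lambda>n. abs_L2 (s n)) \<longlonglongrightarrow> abs_L2 f"
    using Lim_null tendsto_norm_zero_iff by blast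
qed

lemma rep_L2_sum:
  "AE x in lebesgue. rep_L2 (\<Sum>i<n. f i) x = (\<Sum>i<(n::nat). rep_L2 (f i) x)"
proof (induction n)
  case 0 then show ?case using rep_L2_zero by simp
next
  case (Suc n)
  with rep_L2_add[of "\<Sum>i<n. f i" "f n"] show ?case by (auto elim!: eventually_elim2)
qed

text \<open>Minkowski's inequality for sums of moduli: taking moduli changes no norm, so the sum is
  controlled although all pointwise cancellation has been given up.\<close>

lemma abs_L2_norm_sum:
  fixes f :: "nat \<Rightarrow> 'a::euclidean_space L2"
  shows "square_integrable (\<lambda>x. of_real (\<Sum>i<n. norm (rep_L2 (f i) x)))" (is "?S n")
    and "norm (abs_L2 (\<lambda>x. of_real (\<Sum>i<n. norm (rep_L2 (f i) x)))) \<le> (\<Sum>i<n. norm (f i))"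
proof -
  have 1: "square_integrable (\<lambda>x. complex_of_real (norm (rep_L2 g x)))" for g :: "'a L2"
    by (rule square_integrable_AE_bound[OF square_integrable_rep[of g]]) auto
  have n1: "norm (abs_L2 (\<lambda>x. complex_of_real (norm (rep_L2 g x)))) = norm g" for g :: "'a L2"
  proof -
    have "(norm (abs_L2 (\<lambda>x. complex_of_real (norm (rep_L2 g x)))))\<^sup>2 = (norm (abs_L2 (rep_L2 g)))\<^sup>2"
      unfolding norm_abs_L2[OF 1] norm_abs_L2[OF square_integrable_rep] by simp
    then show ?thesis by simp
  qed
  show s: "?S n" for n
  proof (induction n)
    case 0 then show ?case by (simp add: square_integrable_zero)
  next
    case (Suc n)
    from square_integrable_add[OF Suc 1[of "f n"]] show ?case by simp
  qed
  show "norm (abs_L2 (\<lambda>x. of_real (\<Sum>i<n. norm (rep_L2 (f i) x)))) \<le> (\<Sum>i<n. norm (f i))"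
  proof (induction n)
    case 0 then show ?case by (simp flip: zero_L2_def)
  next
    case (Suc n)
    have "abs_L2 (\<lambda>x. of_real (\<Sum>i<Suc n. norm (rep_L2 (f i) x)))
       = abs_L2 (\<lambda>x. of_real (\<Sum>i<n. norm (rep_L2 (f i) x))) + abs_L2 (\<lambda>x. of_real (norm (rep_L2 (f n) x)))"
      unfolding abs_L2_add[OF s 1] by simp
    then show ?case using Suc n1[of "f n"] norm_triangle_mono by fastforce
  qed
qed

text \<open>The Riesz-Fischer theorem in terms of series. Monotone convergence bounds the integral
  of the square of the pointwise sum of moduli, so that sum is finite almost everywhere and square
  integrable; it then dominates the partial sums of the series itself.\<close>

lemma summable_norm_L2:
  fixes f :: "nat \<Rightarrow> 'a::euclidean_space L2"
  assumes "summable (\<lambda>n. norm (f n))"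
  shows "summable f"
proof -
  define S where "S = (\<Sum>n. norm (f n))"
  define p where "p n x = (\<Sum>i<n. norm (rep_L2 (f i) x))" for n x
  have pm [measurable]: "p n \<in> borel_measurable lebesgue" for n unfolding p_def by measurable
  have inc: "incseq (\<lambda>n x. ennreal ((p n x)\<^sup>2))"
    by (intro incseq_SucI le_funI ennreal_leI power_mono) (auto simp: p_def sum_nonneg)
  have le: "(\<integral>\<^sup>+x. ennreal ((p n x)\<^sup>2) \<partial>lebesgue) \<le> ennreal (S\<^sup>2)" for n
  proof -
    have sq: "square_integrable (\<lambda>x. complex_of_real (p n x))"
      unfolding p_def by (rule abs_L2_norm_sum)
    then have i: "integrable lebesgue (\<lambda>x. (p n x)\<^sup>2)" by (simp add: square_integrable_def)
    have "(\<integral>\<^sup>+x. ennreal ((p n x)\<^sup>2) \<partial>lebesgue) = ennreal (\<integral>x. (p n x)\<^sup>2 \<partial>lebesgue)"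
      by (rule nn_integral_eq_integral[OF i]) auto
    also have "(\<integral>x. (p n x)\<^sup>2 \<partial>lebesgue) = (norm (abs_L2 (\<lambda>x. complex_of_real (p n x))))\<^sup>2"
      unfolding norm_abs_L2[OF sq] by simp
    also have "\<dots> \<le> S\<^sup>2"
    proof (rule power_mono)
      have "norm (abs_L2 (\<lambda>x. complex_of_real (p n x))) \<le> (\<Sum>i<n. norm (f i))"
        unfolding p_def by (rule abs_L2_norm_sum)
      also have "\<dots> \<le> S"
        unfolding S_def by (rule sum_le_suminf[OF assms]) auto
      finally show "norm (abs_L2 (\<lambda>x. complex_of_real (p n x))) \<le> S" .
    qed simp
    finally show ?thesis by (simp add: ennreal_leI)
  qed
  have fin: "(\<integral>\<^sup>+x. (SUP n. ennreal ((p n x)\<^sup>2)) \<partial>lebesgue) \<le> ennreal (S\<^sup>2)"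
  proof -
    have "(\<integral>\<^sup>+x. (SUP n. ennreal ((p n x)\<^sup>2)) \<partial>lebesgue) = (SUP n. \<integral>\<^sup>+x. ennreal ((p n x)\<^sup>2) \<partial>lebesgue)"
      by (rule nn_integral_monotone_convergence_SUP[OF inc]) measurable
    then show ?thesis using le by (simp add: SUP_least)
  qed
  have "AE x in lebesgue. (SUP n. ennreal ((p n x)\<^sup>2)) \<noteq> \<infinity>"
    by (rule nn_integral_noteq_infinite)
       (use fin in \<open>measurable, auto simp: top_unique\<close>)
  then have sm: "AE x in lebesgue. summable (\<lambda>i. norm (rep_L2 (f i) x))"
  proof eventually_elim
    case (elim x)
    then obtain c where c: "(SUP n. ennreal ((p n x)\<^sup>2)) = ennreal c" "0 \<le> c"
      by (metis ennreal_cases infinity_ennreal_def)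
    have "(p n x)\<^sup>2 \<le> c" for n
      using SUP_upper[of n UNIV "\<lambda>n. ennreal ((p n x)\<^sup>2)"] c by simp
    then have "p n x \<le> sqrt c" for n by (rule real_le_rsqrt)
    then show ?case
      by (intro summableI_nonneg_bounded[of _ "sqrt c"]) (auto simp: p_def)
  qed
  define w where "w x = (\<Sum>i. norm (rep_L2 (f i) x))" for x
  have wm [measurable]: "w \<in> borel_measurable lebesgue" unfolding w_def by measurable
  have lim: "AE x in lebesgue. (\<lambda>n. p n x) \<longlonglongrightarrow> w x"
    using sm unfolding p_def w_def by eventually_elim (rule summable_LIMSEQ)
  have ub: "AE x in lebesgue. \<forall>n. p n x \<le> w x"
    using sm unfolding p_def w_def by eventually_elim (auto intro!: sum_le_suminf)
  have w: "square_integrable (\<lambda>x. complex_of_real (w x))"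
    unfolding square_integrable_def
  proof
    have "(\<integral>\<^sup>+x. ennreal ((w x)\<^sup>2) \<partial>lebesgue) \<le> (\<integral>\<^sup>+x. (SUP n. ennreal ((p n x)\<^sup>2)) \<partial>lebesgue)"
    proof (rule nn_integral_mono_AE, use lim in eventually_elim)
      case (elim x)
      have "(\<lambda>n. ennreal ((p n x)\<^sup>2)) \<longlonglongrightarrow> ennreal ((w x)\<^sup>2)"
        by (intro tendsto_ennrealI tendsto_intros elim)
      then show ?case by (rule LIMSEQ_le_const2) (auto intro!: exI[of _ 0] SUP_upper)
    qed
    also note fin
    also have "ennreal (S\<^sup>2) < \<infinity>" by simp
    finally have "(\<integral>\<^sup>+x. ennreal ((w x)\<^sup>2) \<partial>lebesgue) < \<infinity>" .
    then show "integrable lebesgue (\<lambda>x. (norm (complex_of_real (w x)))\<^sup>2)"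
      by (intro integrableI_nonneg) auto
  qed measurable
  define s where "s n x = (\<Sum>i<n. rep_L2 (f i) x)" for n x
  define g where "g x = (\<Sum>i. rep_L2 (f i) x)" for x
  have "(\<lambda>n. abs_L2 (s n)) \<longlonglongrightarrow> abs_L2 g"
  proof (rule tendsto_abs_L2[OF w])
    show "s n \<in> borel_measurable lebesgue" for n unfolding s_def by measurable
    show "g \<in> borel_measurable lebesgue" unfolding g_def by measurable
    show "AE x in lebesgue. norm (s n x) \<le> norm (complex_of_real (w x))" for n
      using ub
    proof eventually_elim
      case (elim x)
      have "norm (s n x) \<le> p n x" unfolding s_def p_def by (rule norm_sum)
      also have "\<dots> \<le> w x" using elim by blast
      finally show ?case by simp
    qed
    show "AE x in lebesgue. (\<lambda>n. s n x) \<longlonglongrightarrow> g x"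
      using sm unfolding s_def g_def
      by eventually_elim (rule summable_LIMSEQ, rule summable_norm_cancel)
  qed
  moreover have "abs_L2 (s n) = (\<Sum>i<n. f i)" for n
  proof -
    have "square_integrable (s n)"
      unfolding s_def
      by (rule square_integrable_AE_cong[OF square_integrable_rep[of "\<Sum>i<n. f i"]])
         (use rep_L2_sum[of f n] in \<open>auto elim: eventually_mono\<close>)
    then have "abs_L2 (s n) = abs_L2 (rep_L2 (\<Sum>i<n. f i))"
      by (rule abs_L2_eqI) (use rep_L2_sum[of f n] in \<open>auto elim: eventually_mono simp: s_def\<close>)
    then show ?thesis by simp
  qed
  ultimately show ?thesis by (auto simp: summable_def sums_def)
qed

section \<open>Uniform boundedness\<close>

text \<open>\<open>B\<close> stands in for the operator norm. Among the decreasing constants (3/4)^n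
  B0, one is chosen that is still a bound while the next one fails at some \<open>z\<close>. It
  cannot lie below \<open>c\<close>, since otherwise \<open>c\<close> would be a bound as
  well.\<close>

lemma bounded_linear_nearly_optimal_bound:
  assumes T: "bounded_linear T" and c: "0 < c" and nc: "\<not> (\<forall>x. norm (T x) \<le> c * norm x)"
  shows "\<exists>B z. c \<le> B \<and> (\<forall>x. norm (T x) \<le> B * norm x) \<and> 3 / 4 * B * norm z < norm (T z)"
proof -
  obtain B0 where B0: "\<forall>x. norm (T x) \<le> norm x * B0"
    using bounded_linear.bounded[OF T] by blast
  define P where "P n \<longleftrightarrow> (\<forall>x. norm (T x) \<le> (3/4) ^ n * B0 * norm x)" for n :: nat
  have mono: "(\<forall>x. norm (T x) \<le> b * norm x)" if "\<forall>x. norm (T x) \<le> a * norm x" "a \<le> b" for a b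
    using order_trans[OF that(1)[rule_format] mult_right_mono[OF that(2) norm_ge_zero]] by blast
  have "(\<lambda>n. (3/4) ^ n * B0) \<longlonglongrightarrow> 0 * B0"
    by (intro tendsto_mult LIMSEQ_power_zero tendsto_const) auto
  then have "eventually (\<lambda>n. (3/4) ^ n * B0 < c) sequentially"
    using c by (intro order_tendstoD) auto
  then obtain m where "(3/4) ^ m * B0 < c" by (auto simp: eventually_sequentially)
  then have "\<not> P m" using mono[of "(3/4) ^ m * B0" c] nc unfolding P_def by (blast intro: less_imp_le)
  moreover have "P 0" using B0 by (simp add: P_def mult.commute)
  ultimately obtain n where n: "P n" "\<not> P (Suc n)" by (metis nat_induct[of P])
  then obtain z where "3 / 4 * ((3/4) ^ n * B0) * norm z < norm (T z)"
    unfolding P_def not_all not_le by (auto simp: mult.assoc)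
  moreover have "c \<le> (3/4) ^ n * B0"
    using n(1) mono[of "(3/4) ^ n * B0" c] nc unfolding P_def by (metis linear)
  ultimately show ?thesis using n(1) unfolding P_def by blast
qed

text \<open>The vector \<open>T y\<close> is half the difference of the images of
  \<open>x + y\<close> and \<open>x - y\<close>, so one of these two images is at least as long as
  \<open>T y\<close>. Hence the growth of \<open>T\<close> is felt in a ball around any prescribed
  point \<open>x\<close>.\<close>

lemma linear_ball_witness:
  assumes T: "linear T" and r: "0 < r" and z: "K * norm z < norm (T z)"
  shows "\<exists>y. norm y \<le> r \<and> K * r \<le> norm (T (x + y))"
proof -
  have z0: "z \<noteq> 0" using z linear_0[OF T] by auto
  define y where "y = (r / norm z) *\<^sub>R z"
  have ny: "norm y = r" using z0 r by (simp add: y_def)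
  have "K * r \<le> norm (T y)"
    using z z0 r by (simp add: y_def linear_cmul[OF T] field_simps)
  also have "T y = (1/2) *\<^sub>R (T (x + y) - T (x + - y))"
    using linear_add[OF T, of x y] linear_add[OF T, of x "-y"] linear_neg[OF T, of y]
    by (simp add: scaleR_2[symmetric])
  also have "norm \<dots> \<le> max (norm (T (x + y))) (norm (T (x + - y)))"
    using norm_triangle_ineq4[of "T (x + y)" "T (x + - y)"] by simp
  finally have "K * r \<le> max (norm (T (x + y))) (norm (T (x + - y)))" .
  then show ?thesis using ny by (metis max_def norm_minus_cancel order_refl)
qed

text \<open>Completeness enters only through the convergence of absolutely convergent series, so that
  Sokal's gliding hump argument applies without the Baire category theorem.\<close>

theorem uniform_boundedness_L2:
  fixes T :: "nat \<Rightarrow> 'a::euclidean_space L2 \<Rightarrow> 'b::real_normed_vector"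
  assumes T: "\<And>n. bounded_linear (T n)" and b: "\<And>x. \<exists>M. \<forall>n. norm (T n x) \<le> M"
  shows "\<exists>M. \<forall>n x. norm (T n x) \<le> M * norm x"
proof (rule ccontr)
  assume "\<not> ?thesis"
  then have "\<forall>n. \<exists>k. \<not> (\<forall>x. norm (T k x) \<le> 4 ^ n * norm x)" by blast
  then obtain k where k: "\<And>n. \<not> (\<forall>x. norm (T (k n) x) \<le> 4 ^ n * norm x)" by metis
  have "\<forall>n. \<exists>B z. 4 ^ n \<le> B \<and> (\<forall>x. norm (T (k n) x) \<le> B * norm x) \<and>
      3 / 4 * B * norm z < norm (T (k n) z)"
    using bounded_linear_nearly_optimal_bound[OF T _ k] by simp
  then obtain B z where B: "\<And>n. 4 ^ n \<le> B n" "\<And>n x. norm (T (k n) x) \<le> B n * norm x"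
      "\<And>n. 3 / 4 * B n * norm (z n) < norm (T (k n) (z n))"
    by metis
  have B0: "0 \<le> B n" for n using B(1)[of n] by (rule order_trans[rotated]) simp
  \<comment> \<open>The radii (1/3)^n leave a tail of at most half the last radius. The gain 3/4
    therefore beats the loss 1/2 and leaves a quarter of \<open>B n * (1/3) ^ n\<close>, which is
    unbounded because \<open>B n\<close> is at least 4^n.\<close>
  define step where "step n x =
    (SOME y. norm y \<le> (1/3) ^ n \<and> 3 / 4 * B n * (1/3) ^ n \<le> norm (T (k n) (x + y)))" for n x
  have "\<exists>y. norm y \<le> (1/3) ^ n \<and> 3 / 4 * B n * (1/3) ^ n \<le> norm (T (k n) (x + y))" for n x
    by (rule linear_ball_witness[OF bounded_linear.linear[OF T] _ B(3)]) simp
  then have step: "norm (step n x) \<le> (1/3) ^ n"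
      "3 / 4 * B n * (1/3) ^ n \<le> norm (T (k n) (x + step n x))" for n x
    unfolding step_def by (rule someI2_ex; simp)+
  define x where "x = rec_nat 0 (\<lambda>n x. x + step n x)"
  have x: "x 0 = 0" "x (Suc n) = x n + step n (x n)" for n by (simp_all add: x_def)
  have sum: "x n = (\<Sum>i<n. step i (x i))" for n by (induction n) (simp_all add: x)
  have sn: "summable (\<lambda>i. norm (step i (x i)))"
    by (rule summable_comparison_test'[where g="\<lambda>i. (1/3)^i" and N=0]) (auto simp: step)
  define X where "X = (\<Sum>i. step i (x i))"
  have lim: "x \<longlonglongrightarrow> X"
    using summable_LIMSEQ[OF summable_norm_L2[OF sn]] by (simp add: X_def sum[symmetric])
  have tail: "norm (X - x (Suc n)) \<le> (1/3) ^ n / 2" for n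
  proof -
    have "norm (x (Suc n + m) - x (Suc n)) \<le> (1/3) ^ n / 2 * (1 - (1/3) ^ m)" for m
    proof (induction m)
      case (Suc m)
      have "norm (x (Suc n + Suc m) - x (Suc n))
          \<le> norm (x (Suc n + m) - x (Suc n)) + norm (step (Suc n + m) (x (Suc n + m)))"
        using norm_triangle_ineq[of "x (Suc n + m) - x (Suc n)" "step (Suc n + m) (x (Suc n + m))"]
        by (simp add: x algebra_simps)
      also have "\<dots> \<le> (1/3) ^ n / 2 * (1 - (1/3) ^ m) + (1/3) ^ (Suc n + m)"
        by (intro add_mono Suc step)
      also have "(1/3) ^ n / 2 * (1 - (1/3) ^ m) + (1/3) ^ (Suc n + m)
          = (1/3) ^ n / 2 * (1 - (1/3 :: real) ^ Suc m)"
      proof -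
        have "a / 2 * (1 - b) + 1 / 3 * a * b = a / 2 * (1 - 1 / 3 * b)" for a b :: real
          by (simp add: field_simps)
        from this[of "(1/3) ^ n" "(1/3) ^ m"] show ?thesis
          by (simp only: power_add power_Suc)
      qed
      finally show ?case .
    qed simp
    moreover have "(1/3) ^ n / 2 * (1 - (1/3) ^ m) \<le> (1/3) ^ n / (2::real)" for m
      by (rule mult_left_le) auto
    ultimately have "norm (x (Suc n + m) - x (Suc n)) \<le> (1/3) ^ n / 2" for m
      by (rule order_trans)
    moreover have "(\<lambda>m. norm (x (Suc n + m) - x (Suc n))) \<longlonglongrightarrow> norm (X - x (Suc n))"
      using LIMSEQ_ignore_initial_segment[OF lim, of "Suc n"]
      by (intro tendsto_intros) (simp only: add.commute)
    ultimately show ?thesis by (intro LIMSEQ_le_const2) auto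
  qed
  obtain M where M: "\<And>n. norm (T n X) \<le> M" using b by blast
  have grow: "(4/3) ^ n \<le> 4 * M" for n
  proof -
    interpret bounded_linear "T (k n)" by (rule T)
    have "3 / 4 * B n * (1/3) ^ n \<le> norm (T (k n) (x (Suc n)))" using step(2) by (simp add: x)
    also have "T (k n) (x (Suc n)) = T (k n) X - T (k n) (X - x (Suc n))" by (simp add: diff)
    also have "norm \<dots> \<le> M + B n * ((1/3) ^ n / 2)"
      by (intro norm_triangle_le_diff add_mono M order_trans[OF B(2)] mult_left_mono tail B0)
    finally have "B n * (1/3) ^ n \<le> 4 * M" by simp
    moreover have "4 ^ n * (1/3) ^ n \<le> B n * (1/3) ^ n"
      using B(1)[of n] by (intro mult_right_mono) auto
    ultimately show ?thesis by (simp flip: power_mult_distrib)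
  qed
  obtain n where "4 * M < (4/3) ^ n" using real_arch_pow[of "4/3" "4 * M"] by auto
  with grow[of n] show False by simp
qed

section \<open>Smooth functions\<close>

abbreviation partial :: "'a::euclidean_space \<Rightarrow> ('a \<Rightarrow> complex) \<Rightarrow> 'a \<Rightarrow> complex" where
  "partial b f \<equiv> \<lambda>x. frechet_derivative f (at x) b"

definition smooth :: "('a::euclidean_space \<Rightarrow> complex) \<Rightarrow> bool" where
  "smooth f \<longleftrightarrow> (\<forall>k. C_k k f)"

lemma C_k_SucI:
  assumes "\<And>x. (f has_derivative D x) (at x)" "\<And>b. b \<in> Basis \<Longrightarrow> C_k k (\<lambda>x. D x b)"
  shows "C_k (Suc k) f"
proof -
  have "frechet_derivative f (at x) = D x" for x
    using frechet_derivative_at[OF assms(1)] by simp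
  then show ?thesis using assms by (auto simp: differentiable_def)
qed

lemma C_k_SucD: "C_k (Suc k) f \<Longrightarrow> C_k k f"
proof (induction k arbitrary: f)
  case 0
  then show ?case by (auto intro!: continuous_at_imp_continuous_on differentiable_imp_continuous_within)
qed auto

lemma C_k_has_derivative: "C_k (Suc k) f \<Longrightarrow> (f has_derivative frechet_derivative f (at x)) (at x)"
  by (simp add: frechet_derivative_works)

lemma C_k_add: "C_k k f \<Longrightarrow> C_k k g \<Longrightarrow> C_k k (\<lambda>x. f x + g x)"
proof (induction k arbitrary: f g)
  case 0 then show ?case by (auto intro: continuous_intros)
next
  case (Suc k)
  show ?case
    by (rule C_k_SucI[OF has_derivative_add[OF C_k_has_derivative[OF Suc.prems(1)]
          C_k_has_derivative[OF Suc.prems(2)]]]) (use Suc in auto)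
qed

lemma C_k_mult: "C_k k f \<Longrightarrow> C_k k g \<Longrightarrow> C_k k (\<lambda>x. f x * g x)"
proof (induction k arbitrary: f g)
  case 0 then show ?case by (auto intro: continuous_intros)
next
  case (Suc k)
  show ?case
  proof (rule C_k_SucI[OF has_derivative_mult[OF C_k_has_derivative[OF Suc.prems(1)]
          C_k_has_derivative[OF Suc.prems(2)]]])
    fix b :: 'a assume "b \<in> Basis"
    then show "C_k k (\<lambda>x. f x * frechet_derivative g (at x) b + frechet_derivative f (at x) b * g x)"
      using Suc.prems by (intro C_k_add Suc.IH C_k_SucD[OF Suc.prems(1)] C_k_SucD[OF Suc.prems(2)]) auto
  qed
qed

lemma C_k_cnj: "C_k k f \<Longrightarrow> C_k k (\<lambda>x. cnj (f x))"
proof (induction k arbitrary: f)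
  case 0 then show ?case by (auto intro: continuous_intros)
next
  case (Suc k)
  show ?case
    by (rule C_k_SucI[OF bounded_linear.has_derivative[OF bounded_linear_cnj
          C_k_has_derivative[OF Suc.prems]]]) (use Suc in auto)
qed

text \<open>\<open>C_k\<close> differentiates only in basis directions, and the partial derivative
  of the composition in direction \<open>b\<close> is the one of \<open>f\<close> in direction
  \<open>s b\<close>. For the induction to close, \<open>s b\<close> has to be a basis vector
  again.\<close>

lemma C_k_compose_linear:
  assumes "linear s" "\<And>b. b \<in> Basis \<Longrightarrow> s b \<in> Basis"
  shows "C_k k f \<Longrightarrow> C_k k (\<lambda>x. f (s x))"
proof (induction k arbitrary: f)
  case 0 then show ?case
    using continuous_on_compose2[of UNIV f UNIV s] linear_continuous_on[of s UNIV] assms(1)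
    by (simp add: linear_conv_bounded_linear)
next
  case (Suc k)
  have s: "(s has_derivative s) (at x)" for x
    using assms(1) by (simp add: bounded_linear_imp_has_derivative linear_conv_bounded_linear)
  show ?case
    by (rule C_k_SucI[OF has_derivative_compose[OF s C_k_has_derivative[OF Suc.prems]]])
       (use Suc assms(2) in auto)
qed

lemma smooth_has_derivative: "smooth f \<Longrightarrow> (f has_derivative frechet_derivative f (at x)) (at x)"
  unfolding smooth_def by (blast intro: C_k_has_derivative)

lemma smooth_continuous: "smooth f \<Longrightarrow> continuous_on A f"
  by (metis C_k.simps(1) continuous_on_subset smooth_def subset_UNIV)

lemma smooth_partial: "smooth f \<Longrightarrow> b \<in> Basis \<Longrightarrow> smooth (partial b f)"
  unfolding smooth_def by (metis C_k.simps(2))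

lemma smooth_add: "smooth f \<Longrightarrow> smooth g \<Longrightarrow> smooth (\<lambda>x. f x + g x)"
  by (simp add: smooth_def C_k_add)

lemma smooth_mult: "smooth f \<Longrightarrow> smooth g \<Longrightarrow> smooth (\<lambda>x. f x * g x)"
  by (simp add: smooth_def C_k_mult)

lemma smooth_cnj: "smooth f \<Longrightarrow> smooth (\<lambda>x. cnj (f x))"
  by (simp add: smooth_def C_k_cnj)

text \<open>A family that is closed under partial differentiation is continuously differentiable to
  every order at once, so no formulas for higher derivatives are required.\<close>

lemma smooth_coinduct:
  assumes "f \<in> F" "\<And>f x. f \<in> F \<Longrightarrow> (f has_derivative D f x) (at x)"
    and "\<And>f b. f \<in> F \<Longrightarrow> b \<in> Basis \<Longrightarrow> (\<lambda>x. D f x b) \<in> F"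
  shows "smooth f"
proof -
  have "C_k k f" if "f \<in> F" for k f
    using that
  proof (induction k arbitrary: f)
    case 0 then show ?case
      using assms(2) by (auto intro!: continuous_at_imp_continuous_on has_derivative_continuous)
  next
    case (Suc k) then show ?case using assms by (intro C_k_SucI[where D="D f"]) auto
  qed
  then show ?thesis using assms(1) by (simp add: smooth_def)
qed

lemma smooth_const: "smooth (\<lambda>x. c)"
  by (rule smooth_coinduct[where F="range (\<lambda>c x. c)" and D="\<lambda>f x h. 0"]) auto

lemma partial_eqI: "(f has_derivative f') (at x) \<Longrightarrow> partial b f x = f' b"
  using frechet_derivative_at[of f f' x] by simp

lemma partial_mult: "smooth f \<Longrightarrow> smooth g \<Longrightarrow>
    partial b (\<lambda>x. f x * g x) = (\<lambda>x. f x * partial b g x + partial b f x * g x)"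
  by (intro ext partial_eqI has_derivative_mult smooth_has_derivative)

lemma partial_cmult: "smooth f \<Longrightarrow> partial b (\<lambda>x. c * f x) = (\<lambda>x. c * partial b f x)"
  by (intro ext partial_eqI has_derivative_mult_right smooth_has_derivative)

lemma partial_cnj: "smooth f \<Longrightarrow> partial b (\<lambda>x. cnj (f x)) = (\<lambda>x. cnj (partial b f x))"
  by (intro ext partial_eqI bounded_linear.has_derivative[OF bounded_linear_cnj] smooth_has_derivative)

lemma partial_compose_linear:
  assumes "smooth f" "linear s"
  shows "partial b (\<lambda>x. f (s x)) = (\<lambda>x. partial (s b) f (s x))"
proof (intro ext partial_eqI)
  fix x
  have "(s has_derivative s) (at x)"
    using assms(2) by (simp add: bounded_linear_imp_has_derivative linear_conv_bounded_linear)
  then show "((\<lambda>x. f (s x)) has_derivative (\<lambda>h. frechet_derivative f (at (s x)) (s h))) (at x)"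
    by (rule has_derivative_compose) (rule smooth_has_derivative[OF assms(1)])
qed

section \<open>Flat functions\<close>

text \<open>For m = 0 this is the standard smooth function exp(-1/s), extended by zero. The negative
  powers are included because differentiation produces them, so that all derivatives are
  combinations of functions of this kind.\<close>

definition flat :: "nat \<Rightarrow> real \<Rightarrow> real" where
  "flat m s = (if 0 < s then inverse s ^ m * exp (- inverse s) else 0)"

lemma flat_nonneg: "0 \<le> flat m s"
  by (simp add: flat_def)

lemma flat_0_le_1: "flat 0 s \<le> 1"
  by (simp add: flat_def)

lemma flat_pos_iff: "0 < flat m s \<longleftrightarrow> 0 < s"
  by (simp add: flat_def)

lemma power_mult_exp_minus_le:
  assumes "0 \<le> (y::real)" shows "y ^ n * exp (- y) \<le> fact n"
proof -
  have "(\<Sum>k\<in>{n}. y ^ k /\<^sub>R fact k) \<le> exp y"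
    unfolding exp_def using assms by (intro sum_le_suminf summable_exp_generic) auto
  then show ?thesis by (simp add: exp_minus field_simps)
qed

text \<open>Putting y = 1/s into y^n exp(-y) \<le> n! shows that each of these functions vanishes to
  every order at 0. The case k = 2 yields the derivative at 0, the case k = 0 a uniform bound by
  m!.\<close>

lemma flat_bound: "flat m s \<le> fact (m + k) * \<bar>s\<bar> ^ k"
proof (cases "0 < s")
  case True
  have "inverse s ^ (m + k) * exp (- inverse s) \<le> fact (m + k)"
    using True by (intro power_mult_exp_minus_le) auto
  then have "inverse s ^ (m + k) * exp (- inverse s) * s ^ k \<le> fact (m + k) * s ^ k"
    using True by (intro mult_right_mono) auto
  moreover have "inverse s ^ (m + k) * exp (- inverse s) * s ^ k = flat m s"
    using True by (simp add: flat_def power_add field_simps)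
  ultimately show ?thesis using True by simp
next
  case False
  then show ?thesis by (simp add: flat_def)
qed

lemma flat_has_derivative:
  "(flat m has_real_derivative flat (m + 2) s - real m * flat (m + 1) s) (at s)"
proof (cases s "0 :: real" rule: linorder_cases)
  case less
  have "((\<lambda>s. 0) has_real_derivative 0) (at s)" by simp
  then have "(flat m has_real_derivative 0) (at s)"
    by (rule has_field_derivative_transform_within_open[where S="{..<0}"])
       (use less in \<open>auto simp: flat_def\<close>)
  then show ?thesis using less by (simp add: flat_def)
next
  case equal
  have "((\<lambda>h. flat m h / h) \<longlongrightarrow> 0) (at 0)"
  proof (rule tendsto_rabs_zero_cancel, rule tendsto_sandwich[where f="\<lambda>_. 0"])
    show "\<forall>\<^sub>F h in at 0. \<bar>flat m h / h\<bar> \<le> fact (m + 2) * \<bar>h\<bar>"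
    proof (rule eventually_mono[OF eventually_neq_at_within[of 0]])
      fix h :: real assume "h \<noteq> 0"
      then show "\<bar>flat m h / h\<bar> \<le> fact (m + 2) * \<bar>h\<bar>"
        using flat_bound[of m h 2] flat_nonneg[of m h]
        by (simp add: abs_divide divide_le_eq power2_eq_square mult.assoc del: fact_Suc)
    qed
    have "((\<lambda>h::real. fact (m + 2) * \<bar>h\<bar>) \<longlongrightarrow> fact (m + 2) * \<bar>0\<bar>) (at 0)"
      by (intro tendsto_intros)
    then show "((\<lambda>h::real. fact (m + 2) * \<bar>h\<bar>) \<longlongrightarrow> 0) (at 0)" by simp
  qed auto
  then show ?thesis using equal by (simp add: DERIV_def flat_def)
next
  case greater
  have "((\<lambda>s. inverse s ^ m * exp (- inverse s)) has_real_derivative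
      flat (m + 2) s - real m * flat (m + 1) s) (at s)"
    using greater
    by (auto intro!: derivative_eq_intros simp: flat_def power_add power2_eq_square algebra_simps
          power_Suc[symmetric] simp del: power_Suc)
       (cases m; simp add: algebra_simps)
  then show ?thesis
    by (rule has_field_derivative_transform_within_open[where S="{0<..}"])
       (use greater in \<open>auto simp: flat_def\<close>)
qed

lemma flat_0_tendsto: "(flat 0 \<longlongrightarrow> 1) at_top"
proof -
  have "((\<lambda>s::real. exp (- inverse s)) \<longlongrightarrow> exp (- 0)) at_top"
    by (intro tendsto_intros tendsto_inverse_0_at_top filterlim_ident)
  moreover have "\<forall>\<^sub>F s in at_top. exp (- inverse s) = flat 0 s"
    by (rule eventually_mono[OF eventually_gt_at_top[of 0]]) (simp add: flat_def)
  ultimately show ?thesis by (simp add: tendsto_cong)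
qed

text \<open>Closed under differentiation by construction, since the derivative of
  \<open>flat m\<close> is a combination of \<open>flat (m + 1)\<close> and
  \<open>flat (m + 2)\<close>. Bump functions and cutoffs built from these clauses are thus smooth
  without separate arguments.\<close>

inductive elementary :: "('a::euclidean_space \<Rightarrow> real) \<Rightarrow> bool" where
  const: "elementary (\<lambda>x. c)"
| inner: "elementary (\<lambda>x. x \<bullet> v)"
| add: "elementary f \<Longrightarrow> elementary g \<Longrightarrow> elementary (\<lambda>x. f x + g x)"
| mult: "elementary f \<Longrightarrow> elementary g \<Longrightarrow> elementary (\<lambda>x. f x * g x)"
| flat: "elementary f \<Longrightarrow> elementary (\<lambda>x. flat m (f x))"

lemma elementary_diff: "elementary f \<Longrightarrow> elementary g \<Longrightarrow> elementary (\<lambda>x. f x - g x)"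
  using elementary.add[OF _ elementary.mult[OF elementary.const[of "-1"]]] by fastforce

lemma elementary_sum: "(\<And>i. i \<in> I \<Longrightarrow> elementary (f i)) \<Longrightarrow> elementary (\<lambda>x. \<Sum>i\<in>I. f i x)"
  by (induction I rule: infinite_finite_induct) (auto intro: elementary.intros)

lemma elementary_prod: "(\<And>i. i \<in> I \<Longrightarrow> elementary (f i)) \<Longrightarrow> elementary (\<lambda>x. \<Prod>i\<in>I. f i x)"
  by (induction I rule: infinite_finite_induct) (auto intro: elementary.intros)

lemma elementary_derivative:
  "elementary f \<Longrightarrow> \<exists>D. (\<forall>x. (f has_derivative D x) (at x)) \<and> (\<forall>b. elementary (\<lambda>x. D x b))"
proof (induction rule: elementary.induct)
  case (const c)
  show ?case by (intro exI[of _ "\<lambda>x h. 0"]) (auto intro: elementary.const)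
next
  case (inner v)
  show ?case
    by (intro exI[of _ "\<lambda>x h. h \<bullet> v"])
       (auto intro!: elementary.const derivative_eq_intros)
next
  case (add f g)
  then obtain D E where "\<forall>x. (f has_derivative D x) (at x)" "\<forall>b. elementary (\<lambda>x. D x b)"
    "\<forall>x. (g has_derivative E x) (at x)" "\<forall>b. elementary (\<lambda>x. E x b)" by auto
  then show ?case
    by (intro exI[of _ "\<lambda>x h. D x h + E x h"]) (auto intro: elementary.add has_derivative_add)
next
  case (mult f g)
  then obtain D E where "\<forall>x. (f has_derivative D x) (at x)" "\<forall>b. elementary (\<lambda>x. D x b)"
    "\<forall>x. (g has_derivative E x) (at x)" "\<forall>b. elementary (\<lambda>x. E x b)" by auto
  with mult.hyps show ?case
    by (intro exI[of _ "\<lambda>x h. f x * E x h + D x h * g x"] conjI allI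
        elementary.add elementary.mult has_derivative_mult) auto
next
  case (flat f m)
  then obtain D where D: "\<And>x. (f has_derivative D x) (at x)" "\<And>b. elementary (\<lambda>x. D x b)" by auto
  have "((\<lambda>x. flat m (f x)) has_derivative
      (\<lambda>h. D x h * (flat (m + 2) (f x) - real m * flat (m + 1) (f x)))) (at x)" for x
    using has_derivative_compose[OF D(1) flat_has_derivative[unfolded has_field_derivative_def]]
    by (simp add: mult.commute)
  moreover have "elementary (\<lambda>x. D x b * (flat (m + 2) (f x) - real m * flat (m + 1) (f x)))" for b
    by (intro elementary.mult D(2) elementary_diff elementary.flat flat.hyps elementary.const)
  ultimately show ?case
    by (intro exI[of _ "\<lambda>x h. D x h * (flat (m + 2) (f x) - real m * flat (m + 1) (f x))"]) blast
qed

lemma smooth_elementary: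
  assumes "elementary f" shows "smooth (\<lambda>x. complex_of_real (f x))"
proof -
  define D where "D f = (SOME D. (\<forall>x. (f has_derivative D x) (at x)) \<and> (\<forall>b. elementary (\<lambda>x. D x b)))"
    for f :: "'a \<Rightarrow> real"
  have D: "(f has_derivative D f x) (at x)" "elementary (\<lambda>x. D f x b)" if "elementary f" for f x b
    using someI_ex[OF elementary_derivative[OF that]] by (auto simp: D_def)
  show ?thesis
  \<comment> \<open>The family consists of complex-valued functions; \<open>Re\<close> recovers the
    real function on which the chosen derivative \<open>D\<close> is defined.\<close>
  proof (rule smooth_coinduct[where F="{\<lambda>x. complex_of_real (f x) |f. elementary f}"
        and D="\<lambda>f x h. of_real (D (\<lambda>x. Re (f x)) x h)"])
    show "(\<lambda>x. complex_of_real (f x)) \<in> {\<lambda>x. complex_of_real (f x) |f. elementary f}"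
      using assms by blast
  qed (auto intro!: has_derivative_of_real D)
qed

lemma elementary_continuous: "elementary f \<Longrightarrow> continuous_on A f"
  using elementary_derivative[of f]
  by (auto intro!: continuous_at_imp_continuous_on intro: has_derivative_continuous)

section \<open>Test functions\<close>

lemma test_function_alt: "test_function \<Omega> \<phi> \<longleftrightarrow> smooth \<phi> \<and>
     compact (closure {x. \<phi> x \<noteq> 0}) \<and> closure {x. \<phi> x \<noteq> 0} \<subseteq> \<Omega>"
  by (simp add: test_function_def smooth_def)

lemma test_function_smooth: "test_function \<Omega> \<phi> \<Longrightarrow> smooth \<phi>"
  by (simp add: test_function_alt)

text \<open>The closure of the support need not be computed: it is a closed subset of any compact
  set outside of which the function vanishes.\<close>

lemma test_functionI:
  assumes "smooth \<phi>" "compact K" "K \<subseteq> \<Omega>" "\<And>x. x \<notin> K \<Longrightarrow> \<phi> x = 0"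
  shows "test_function \<Omega> \<phi>"
proof -
  have *: "closure {x. \<phi> x \<noteq> 0} \<subseteq> K"
    using assms by (intro closure_minimal compact_imp_closed) auto
  then have "compact (K \<inter> closure {x. \<phi> x \<noteq> 0})"
    by (intro compact_Int_closed assms) auto
  also have "K \<inter> closure {x. \<phi> x \<noteq> 0} = closure {x. \<phi> x \<noteq> 0}" using * by blast
  finally show ?thesis
    using assms * by (auto simp: test_function_alt)
qed

lemma test_functionE:
  assumes "test_function \<Omega> \<phi>"
  obtains K where "compact K" "K \<subseteq> \<Omega>" "\<And>x. x \<notin> K \<Longrightarrow> \<phi> x = 0"
proof (rule that[of "closure {x. \<phi> x \<noteq> 0}"])
  show "\<phi> x = 0" if "x \<notin> closure {x. \<phi> x \<noteq> 0}" for x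
    using that closure_subset[of "{x. \<phi> x \<noteq> 0}"] by auto
qed (use assms in \<open>auto simp: test_function_alt\<close>)

lemma test_function_mono: "test_function \<Omega> \<phi> \<Longrightarrow> \<Omega> \<subseteq> \<Omega>' \<Longrightarrow> test_function \<Omega>' \<phi>"
  by (auto simp: test_function_def)

lemma test_function_vanishes: "test_function \<Omega> \<phi> \<Longrightarrow> x \<notin> \<Omega> \<Longrightarrow> \<phi> x = 0"
  by (rule test_functionE[of \<Omega> \<phi>]) auto

lemma test_function_partial:
  assumes "test_function \<Omega> \<phi>" "b \<in> Basis" shows "test_function \<Omega> (partial b \<phi>)"
proof -
  obtain K where K: "compact K" "K \<subseteq> \<Omega>" "\<And>x. x \<notin> K \<Longrightarrow> \<phi> x = 0"
    by (rule test_functionE[OF assms(1)]) blast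
  show ?thesis
  proof (rule test_functionI[OF _ K(1,2)])
    fix x assume "x \<notin> K"
    have "((\<lambda>x. 0) has_derivative (\<lambda>h. 0)) (at x)" by simp
    then have "(\<phi> has_derivative (\<lambda>h. 0)) (at x)"
      by (rule has_derivative_transform_within_open[of _ _ _ _ "- K"])
         (use K \<open>x \<notin> K\<close> in \<open>auto simp: compact_imp_closed open_Compl\<close>)
    then show "partial b \<phi> x = 0" by (rule partial_eqI)
  qed (use assms in \<open>auto intro: smooth_partial test_function_smooth\<close>)
qed

lemma test_function_add:
  assumes "test_function \<Omega> \<phi>" "test_function \<Omega> \<psi>" shows "test_function \<Omega> (\<lambda>x. \<phi> x + \<psi> x)"
proof -
  obtain K L where "compact K" "K \<subseteq> \<Omega>" "\<And>x. x \<notin> K \<Longrightarrow> \<phi> x = 0"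
    "compact L" "L \<subseteq> \<Omega>" "\<And>x. x \<notin> L \<Longrightarrow> \<psi> x = 0"
    by (rule test_functionE[OF assms(1)], rule test_functionE[OF assms(2)]) blast
  then show ?thesis
    by (intro test_functionI[of _ "K \<union> L"])
       (auto intro: smooth_add test_function_smooth[OF assms(1)] test_function_smooth[OF assms(2)])
qed

lemma test_function_mult:
  assumes "test_function \<Omega> \<phi>" "smooth \<psi>" shows "test_function \<Omega> (\<lambda>x. \<psi> x * \<phi> x)"
proof -
  obtain K where "compact K" "K \<subseteq> \<Omega>" "\<And>x. x \<notin> K \<Longrightarrow> \<phi> x = 0"
    by (rule test_functionE[OF assms(1)]) blast
  then show ?thesis
    by (intro test_functionI[of _ K] smooth_mult assms(2) test_function_smooth[OF assms(1)]) auto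
qed

lemma test_function_cmult: "test_function \<Omega> \<phi> \<Longrightarrow> test_function \<Omega> (\<lambda>x. c * \<phi> x)"
  by (rule test_function_mult[OF _ smooth_const])

lemma test_function_bounded:
  assumes "test_function \<Omega> \<phi>" shows "\<exists>M\<ge>0. \<forall>x. norm (\<phi> x) \<le> M"
proof -
  obtain K where K: "compact K" "\<And>x. x \<notin> K \<Longrightarrow> \<phi> x = 0"
    by (rule test_functionE[OF assms]) blast
  have "bounded (\<phi> ` K)"
    by (intro compact_imp_bounded compact_continuous_image smooth_continuous K test_function_smooth[OF assms])
  then obtain M where "\<forall>x\<in>K. norm (\<phi> x) \<le> M" by (auto simp: bounded_iff)
  then have "norm (\<phi> x) \<le> max M 0" for x using K(2)[of x] by (cases "x \<in> K") auto
  then show ?thesis by (intro exI[of _ "max M 0"]) auto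
qed

lemma square_integrable_compact_support:
  assumes "u \<in> borel_measurable lebesgue" "compact K" "\<And>x. norm (u x) \<le> M" "\<And>x. x \<notin> K \<Longrightarrow> u x = 0"
  shows "square_integrable u"
proof (rule square_integrable_AE_bound)
  show "square_integrable (\<lambda>x. complex_of_real M * indicator K x)"
    using lmeasurable_compact[OF assms(2)]
    by (intro square_integrable_indicator) (auto simp: fmeasurable_def)
  show "AE x in lebesgue. norm (u x) \<le> norm (complex_of_real M * indicator K x)"
  proof (rule AE_I2)
    fix x show "norm (u x) \<le> norm (complex_of_real M * indicator K x)"
      using assms(3)[of x] assms(4)[of x] by (cases "x \<in> K") auto
  qed
qed fact

lemma smooth_measurable: "smooth \<phi> \<Longrightarrow> \<phi> \<in> borel_measurable lebesgue"
  using borel_measurable_continuous_onI[OF smooth_continuous, of \<phi>]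
  by (simp add: measurable_completion)

lemma test_function_square_integrable:
  assumes "test_function \<Omega> \<phi>" shows "square_integrable \<phi>"
proof -
  obtain K where K: "compact K" "\<And>x. x \<notin> K \<Longrightarrow> \<phi> x = 0"
    by (rule test_functionE[OF assms]) blast
  obtain M where "\<forall>x. norm (\<phi> x) \<le> M" using test_function_bounded[OF assms] by blast
  then show ?thesis
    using K by (intro square_integrable_compact_support[of _ K M] smooth_measurable
        test_function_smooth[OF assms]) auto
qed

text \<open>The partial derivatives are test functions again and hence bounded. The constant
  dominates difference quotients in the integration by parts, and it later bounds the difference
  between a test function and its reflection by the distance to the hyperplane.\<close>

lemma test_function_lipschitz:
  assumes "test_function \<Omega> \<phi>" shows "\<exists>C\<ge>0. \<forall>x y. norm (\<phi> x - \<phi> y) \<le> C * norm (x - y)"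
proof -
  have "\<exists>M\<ge>0. \<forall>x. norm (partial b \<phi> x) \<le> M" if "b \<in> Basis" for b
    by (rule test_function_bounded[OF test_function_partial[OF assms that]])
  then obtain M where M: "\<And>b x. b \<in> Basis \<Longrightarrow> norm (partial b \<phi> x) \<le> M b" "\<And>b. b \<in> Basis \<Longrightarrow> 0 \<le> M b"
    by metis
  define C where "C = (\<Sum>b\<in>Basis. M b)"
  have C0: "0 \<le> C" unfolding C_def by (intro sum_nonneg M(2))
  have on: "onorm (frechet_derivative \<phi> (at x)) \<le> C" for x
  proof (rule onorm_bound[OF C0])
    fix h
    have lin: "linear (frechet_derivative \<phi> (at x))"
      using smooth_has_derivative[OF test_function_smooth[OF assms]] has_derivative_linear by blast
    have "frechet_derivative \<phi> (at x) h = frechet_derivative \<phi> (at x) (\<Sum>b\<in>Basis. (h \<bullet> b) *\<^sub>R b)"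
      by (simp add: euclidean_representation)
    also have "\<dots> = (\<Sum>b\<in>Basis. (h \<bullet> b) *\<^sub>R partial b \<phi> x)"
      by (simp add: linear_sum[OF lin] linear_cmul[OF lin])
    also have "norm \<dots> \<le> (\<Sum>b\<in>Basis. norm h * M b)"
      by (intro sum_norm_le) (auto intro!: mult_mono M simp: Basis_le_norm)
    finally show "norm (frechet_derivative \<phi> (at x) h) \<le> C * norm h"
      by (simp add: C_def sum_distrib_left mult.commute)
  qed
  have "norm (\<phi> x - \<phi> y) \<le> C * norm (x - y)" for x y
    by (rule differentiable_bound[where S=UNIV and f'="\<lambda>x. frechet_derivative \<phi> (at x)"])
       (use on smooth_has_derivative[OF test_function_smooth[OF assms]] in auto)
  then show ?thesis using C0 by blast
qed

text \<open>The difference quotients have integral zero by translation invariance, and dominated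
  convergence passes this on to the derivative. Applied to a product, it is integration by
  parts.\<close>

lemma integral_partial_eq_0:
  fixes u :: "'a::euclidean_space \<Rightarrow> complex"
  assumes "test_function UNIV u" "b \<in> Basis" shows "(\<integral>x. partial b u x \<partial>lebesgue) = 0"
proof -
  note sm = test_function_smooth[OF assms(1)]
  obtain K where K: "compact K" "\<And>x. x \<notin> K \<Longrightarrow> u x = 0"
    by (rule test_functionE[OF assms(1)]) blast
  obtain R where R: "\<And>x. x \<in> K \<Longrightarrow> norm x \<le> R"
    using compact_imp_bounded[OF K(1)] by (auto simp: bounded_iff)
  obtain C where C: "0 \<le> C" "\<And>x y. norm (u x - u y) \<le> C * norm (x - y)"
    using test_function_lipschitz[OF assms(1)] by blast
  define t where "t n = inverse (real (Suc n))" for n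
  have t: "0 < t n" "t n \<le> 1" for n by (auto simp: t_def field_simps)
  define d where "d n x = (u (x + t n *\<^sub>R b) - u x) / of_real (t n)" for n x
  have ub [measurable]: "u \<in> borel_measurable borel"
    by (intro borel_measurable_continuous_onI smooth_continuous sm)
  have dm: "d n \<in> borel_measurable lborel" for n unfolding d_def by measurable
  have ui: "integrable lborel u"
  proof -
    obtain M where M: "\<forall>x. norm (u x) \<le> M" using test_function_bounded[OF assms(1)] by blast
    have "integrable lborel (\<lambda>x. M * indicator K x)"
      using K(1) by (intro integrable_mult_right integrable_real_indicator)
         (use emeasure_bounded_finite[OF compact_imp_bounded[OF K(1)]] in \<open>auto simp: borel_compact\<close>)
    then show ?thesis
      by (rule Bochner_Integration.integrable_bound)
         (use M K(2) in \<open>auto simp: indicator_def intro!: AE_I2 order_trans[OF _ abs_ge_self]\<close>)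
  qed
  have "(\<lambda>n. \<integral>x. d n x \<partial>lborel) \<longlonglongrightarrow> (\<integral>x. partial b u x \<partial>lborel)"
  \<comment> \<open>The increments \<open>t n\<close> are at most 1, so all difference quotients
    vanish outside the ball of radius \<open>R + 1\<close>; inside it they are bounded by the
    Lipschitz constant.\<close>
  proof (rule integral_dominated_convergence[where w="\<lambda>x. C * indicator (cball 0 (R + 1)) x"])
    show "partial b u \<in> borel_measurable lborel"
      using smooth_continuous[OF smooth_partial[OF sm assms(2)]]
      by (simp add: borel_measurable_continuous_onI)
    show "d n \<in> borel_measurable lborel" for n by (rule dm)
    show "integrable lborel (\<lambda>x. C * indicator (cball (0::'a) (R + 1)) x)"
      by (intro integrable_mult_right integrable_real_indicator) (use emeasure_bounded_finite[OF bounded_cball, of "0::'a" "R + 1"] in auto)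
    show "AE x in lborel. (\<lambda>n. d n x) \<longlonglongrightarrow> partial b u x"
    proof (rule AE_I2)
      fix x
      have "((\<lambda>s. u (x + s *\<^sub>R b)) has_derivative (\<lambda>s. frechet_derivative u (at x) (s *\<^sub>R b))) (at 0)"
        by (rule has_derivative_compose[where f="\<lambda>s. x + s *\<^sub>R b" and f'="\<lambda>s. s *\<^sub>R b"])
           (auto intro!: derivative_eq_intros smooth_has_derivative[OF sm])
      moreover have "frechet_derivative u (at x) (s *\<^sub>R b) = s *\<^sub>R partial b u x" for s
        using smooth_has_derivative[OF sm] by (intro linear_cmul has_derivative_linear)
      ultimately have "((\<lambda>s. u (x + s *\<^sub>R b)) has_vector_derivative partial b u x) (at 0)"
        by (simp add: has_vector_derivative_def)
      then have "((\<lambda>s. norm (u (x + s *\<^sub>R b) - u x - s *\<^sub>R partial b u x) / norm s) \<longlongrightarrow> 0) (at 0)"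
        by (simp add: has_vector_derivative_def has_derivative_at)
      moreover have "norm (u (x + s *\<^sub>R b) - u x - s *\<^sub>R partial b u x) / norm s
          = norm ((u (x + s *\<^sub>R b) - u x) /\<^sub>R s - partial b u x)" if "s \<noteq> 0" for s
      proof -
        have "u (x + s *\<^sub>R b) - u x - s *\<^sub>R partial b u x
            = s *\<^sub>R ((u (x + s *\<^sub>R b) - u x) /\<^sub>R s - partial b u x)"
          using that by (simp add: scaleR_diff_right)
        then show ?thesis using that by (simp only: norm_scaleR) simp
      qed
      ultimately have "((\<lambda>s. norm ((u (x + s *\<^sub>R b) - u x) /\<^sub>R s - partial b u x)) \<longlongrightarrow> 0) (at 0)"
        by (rule Lim_transform_eventually[OF _ eventually_mono[OF eventually_neq_at_within[of 0]]])
      then have "((\<lambda>s. (u (x + s *\<^sub>R b) - u x) /\<^sub>R s) \<longlongrightarrow> partial b u x) (at 0)"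
        by (rule LIM_zero_cancel[OF tendsto_norm_zero_cancel])
      moreover have "filterlim t (at 0) sequentially"
        unfolding filterlim_at using less_imp_neq[OF t(1)] LIMSEQ_inverse_real_of_nat
        unfolding t_def by auto
      ultimately have "(\<lambda>n. (u (x + t n *\<^sub>R b) - u x) /\<^sub>R t n) \<longlonglongrightarrow> partial b u x"
        by (rule filterlim_compose)
      then show "(\<lambda>n. d n x) \<longlonglongrightarrow> partial b u x"
        by (simp add: d_def scaleR_conv_of_real divide_inverse mult.commute)
    qed
    show "AE x in lborel. norm (d n x) \<le> C * indicator (cball 0 (R + 1)) x" for n
    proof (rule AE_I2)
      fix x
      show "norm (d n x) \<le> C * indicator (cball 0 (R + 1)) x"
      proof (cases "x \<in> cball 0 (R + 1)")
        case True
        have "norm (u (x + t n *\<^sub>R b) - u x) \<le> C * t n"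
          using C(2)[of "x + t n *\<^sub>R b" x] t[of n] assms(2) by simp
        then show ?thesis using True t[of n] by (simp add: d_def norm_divide divide_le_eq)
      next
        case False
        have "R < norm (x + t n *\<^sub>R b)"
          using norm_triangle_ineq2[of x "- t n *\<^sub>R b"] t[of n] assms(2) False by simp
        then have "x + t n *\<^sub>R b \<notin> K" "x \<notin> K" using R[of x] R[of "x + t n *\<^sub>R b"] False by auto
        then show ?thesis using K(2) False by (simp add: d_def)
      qed
    qed
  qed
  moreover have "(\<integral>x. d n x \<partial>lborel) = 0" for n
  proof -
    have "(\<integral>x. u (x + t n *\<^sub>R b) \<partial>lborel) = (\<integral>x. u x \<partial>lborel)"
      using integral_distr[of "\<lambda>x. t n *\<^sub>R b + x" lborel borel u]
      unfolding lborel_distr_plus by (simp add: add.commute)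
    moreover have "integrable lborel (\<lambda>x. u (x + t n *\<^sub>R b))"
      using integrable_distr[of "\<lambda>x. t n *\<^sub>R b + x" lborel borel u] ui
      unfolding lborel_distr_plus by (simp add: add.commute)
    ultimately show ?thesis using ui by (simp add: d_def)
  qed
  ultimately have "(\<integral>x. partial b u x \<partial>lborel) = 0"
    by (simp add: LIMSEQ_const_iff)
  then show ?thesis
    using smooth_continuous[OF smooth_partial[OF sm assms(2)], of UNIV]
    by (subst integral_completion) (auto simp: borel_measurable_continuous_onI)
qed

section \<open>Multiplication operators\<close>

lemma square_integrable_cutoff:
  assumes \<Omega>: "\<Omega> \<in> sets lebesgue" and m: "m \<in> Linf \<Omega>" and u: "square_integrable u"
  shows "square_integrable (\<lambda>x. if x \<in> \<Omega> then complex_of_real (m x) * u x else 0)"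
proof -
  obtain C where C: "AE x in lebesgue_on \<Omega>. \<bar>m x\<bar> \<le> C" using m by (auto simp: Linf_def)
  have mm: "(\<lambda>x. if x \<in> \<Omega> then m x else 0) \<in> borel_measurable lebesgue"
    using m \<Omega> by (auto simp: Linf_def borel_measurable_if)
  have "(\<lambda>x. complex_of_real (if x \<in> \<Omega> then m x else 0) * u x) \<in> borel_measurable lebesgue"
    using mm square_integrable_measurable[OF u] by measurable
  also have "(\<lambda>x. complex_of_real (if x \<in> \<Omega> then m x else 0) * u x)
      = (\<lambda>x. if x \<in> \<Omega> then complex_of_real (m x) * u x else 0)" by auto
  finally show ?thesis
  proof (rule square_integrable_AE_bound[OF square_integrable_mult[OF u, of "of_real C"]])
    have "AE x in lebesgue. x \<in> \<Omega> \<longrightarrow> \<bar>m x\<bar> \<le> C"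
      using C \<Omega> by (simp add: AE_restrict_space_iff)
    then show "AE x in lebesgue. norm (if x \<in> \<Omega> then complex_of_real (m x) * u x else 0)
        \<le> norm (complex_of_real C * u x)"
      by eventually_elim (auto simp: norm_mult intro: mult_right_mono)
  qed
qed

lemma one_Linf: "(\<lambda>_. 1) \<in> Linf \<Omega>"
  by (auto simp: Linf_def)

lemma rep_mult_on:
  assumes "\<Omega> \<in> sets lebesgue" "m \<in> Linf \<Omega>"
  shows "AE x in lebesgue. rep_L2 (mult_on \<Omega> m f) x = (if x \<in> \<Omega> then complex_of_real (m x) * rep_L2 f x else 0)"
  unfolding mult_on_def by (intro rep_abs_L2 square_integrable_cutoff assms square_integrable_rep)

lemma rep_chi:
  assumes "\<Omega> \<in> sets lebesgue"
  shows "AE x in lebesgue. rep_L2 (chi \<Omega> f) x = (if x \<in> \<Omega> then rep_L2 f x else 0)"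
  using rep_mult_on[OF assms one_Linf, of f] by (simp cong: if_cong)

lemma chi_abs_L2:
  assumes "\<Omega> \<in> sets lebesgue" "square_integrable u"
  shows "chi \<Omega> (abs_L2 u) = abs_L2 (\<lambda>x. if x \<in> \<Omega> then u x else 0)"
    and "square_integrable (\<lambda>x. if x \<in> \<Omega> then u x else 0)"
proof -
  show s: "square_integrable (\<lambda>x. if x \<in> \<Omega> then u x else 0)"
    using square_integrable_cutoff[OF assms(1) one_Linf assms(2)] by (simp cong: if_cong)
  show "chi \<Omega> (abs_L2 u) = abs_L2 (\<lambda>x. if x \<in> \<Omega> then u x else 0)"
    unfolding mult_on_def
    using rep_abs_L2[OF assms(2)] square_integrable_cutoff[OF assms(1) one_Linf]
    by (intro abs_L2_eqI s) (auto elim!: eventually_mono)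
qed

lemma mult_on_add:
  assumes "\<Omega> \<in> sets lebesgue" "m \<in> Linf \<Omega>"
  shows "mult_on \<Omega> m (f + g) = mult_on \<Omega> m f + mult_on \<Omega> m g"
  unfolding L2_eq_iff
  using rep_mult_on[OF assms, of "f + g"] rep_mult_on[OF assms, of f] rep_mult_on[OF assms, of g]
    rep_L2_add[of f g] rep_L2_add[of "mult_on \<Omega> m f" "mult_on \<Omega> m g"]
  by eventually_elim (auto simp: distrib_left)

lemma mult_on_scaleC:
  assumes "\<Omega> \<in> sets lebesgue" "m \<in> Linf \<Omega>"
  shows "mult_on \<Omega> m (c *\<^sub>C f) = c *\<^sub>C mult_on \<Omega> m f"
  unfolding L2_eq_iff
  using rep_mult_on[OF assms, of "c *\<^sub>C f"] rep_mult_on[OF assms, of f]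
    rep_L2_scaleC[of c f] rep_L2_scaleC[of c "mult_on \<Omega> m f"]
  by eventually_elim auto

lemma cinner_mult_on:
  assumes "\<Omega> \<in> sets lebesgue" "m \<in> Linf \<Omega>"
  shows "cinner (mult_on \<Omega> m f) g = cinner f (mult_on \<Omega> m g)"
  unfolding cinner_rep
proof (rule integral_cong_AE)
  show "AE x in lebesgue. rep_L2 (mult_on \<Omega> m f) x * cnj (rep_L2 g x) =
      rep_L2 f x * cnj (rep_L2 (mult_on \<Omega> m g) x)"
    using rep_mult_on[OF assms, of f] rep_mult_on[OF assms, of g] by eventually_elim auto
qed (auto intro!: borel_measurable_integrable integrable_mult_cnj)

lemma norm_AE_mono:
  assumes "AE x in lebesgue. norm (rep_L2 f x) \<le> C * norm (rep_L2 g x)" "0 \<le> C"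
  shows "norm f \<le> C * norm g"
proof -
  have e: "(norm h)\<^sup>2 = (\<integral>x. (norm (rep_L2 h x))\<^sup>2 \<partial>lebesgue)" for h :: "'a L2"
    using norm_abs_L2[OF square_integrable_rep[of h]] by simp
  have i: "integrable lebesgue (\<lambda>x. (norm (rep_L2 h x))\<^sup>2)" for h :: "'a L2"
    using square_integrable_rep[of h] by (simp add: square_integrable_def)
  have "(norm f)\<^sup>2 \<le> (\<integral>x. C\<^sup>2 * (norm (rep_L2 g x))\<^sup>2 \<partial>lebesgue)"
    unfolding e[of f]
  proof (rule integral_mono_AE)
    show "AE x in lebesgue. (norm (rep_L2 f x))\<^sup>2 \<le> C\<^sup>2 * (norm (rep_L2 g x))\<^sup>2"
      using assms(1)
    proof eventually_elim
      case (elim x)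
      then have "(norm (rep_L2 f x))\<^sup>2 \<le> (C * norm (rep_L2 g x))\<^sup>2" by (intro power_mono) auto
      then show ?case by (simp add: power_mult_distrib)
    qed
  qed (auto intro: i)
  also have "\<dots> = (C * norm g)\<^sup>2" by (simp add: e power_mult_distrib)
  finally show ?thesis using assms(2) by (simp add: power2_le_iff_abs_le)
qed

lemma norm_mult_on_bounded:
  assumes "\<Omega> \<in> sets lebesgue" "m \<in> Linf \<Omega>"
  shows "\<exists>C\<ge>0. \<forall>f. norm (mult_on \<Omega> m f) \<le> C * norm f"
proof -
  obtain C where C: "AE x in lebesgue_on \<Omega>. \<bar>m x\<bar> \<le> C" using assms by (auto simp: Linf_def)
  then have AE: "AE x in lebesgue. x \<in> \<Omega> \<longrightarrow> \<bar>m x\<bar> \<le> \<bar>C\<bar>"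
    using assms(1) by (auto simp: AE_restrict_space_iff elim: eventually_mono)
  have "norm (mult_on \<Omega> m f) \<le> \<bar>C\<bar> * norm f" for f
  proof (rule norm_AE_mono)
    show "AE x in lebesgue. norm (rep_L2 (mult_on \<Omega> m f) x) \<le> \<bar>C\<bar> * norm (rep_L2 f x)"
      using rep_mult_on[OF assms, of f] AE
      by eventually_elim (auto simp: norm_mult intro: mult_right_mono)
  qed simp
  then show ?thesis by (intro exI[of _ "\<bar>C\<bar>"]) auto
qed

lemma norm_chi:
  assumes "\<Omega> \<in> sets lebesgue" shows "norm (chi \<Omega> f) \<le> norm f"
proof -
  have "AE x in lebesgue. norm (rep_L2 (chi \<Omega> f) x) \<le> 1 * norm (rep_L2 f x)"
    using rep_chi[OF assms, of f] by eventually_elim auto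
  from norm_AE_mono[OF this] show ?thesis by simp
qed

lemma bounded_linear_L2I:
  assumes "\<And>f g. T (f + g) = T f + T g" "\<And>c f. T (c *\<^sub>C f) = c *\<^sub>C T f"
    "\<And>f. norm (T f) \<le> C * norm f"
  shows "bounded_linear T"
proof (rule bounded_linear_intro[where K=C])
  show "T (r *\<^sub>R f) = r *\<^sub>R T f" for r f
    using assms(2)[of "of_real r" f] by (simp add: scaleC_of_real)
qed (use assms in \<open>auto simp: mult.commute\<close>)

lemma bounded_linear_mult_on:
  assumes "\<Omega> \<in> sets lebesgue" "m \<in> Linf \<Omega>"
  shows "bounded_linear (mult_on \<Omega> m)"
proof -
  obtain C where "\<forall>f. norm (mult_on \<Omega> m f) \<le> C * norm f" using norm_mult_on_bounded[OF assms] by blast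
  then show ?thesis by (intro bounded_linear_L2I[where C=C]) (auto simp: mult_on_add mult_on_scaleC assms)
qed

lemmas bounded_linear_chi = bounded_linear_mult_on[OF _ one_Linf]

lemma L2_on_iff: "f \<in> L2_on \<Omega> \<longleftrightarrow> (AE x in lebesgue. x \<notin> \<Omega> \<longrightarrow> rep_L2 f x = 0)"
proof -
  have "vanishes_outside \<Omega> (abs_L2 (rep_L2 f)) \<longleftrightarrow> (AE x in lebesgue. x \<notin> \<Omega> \<longrightarrow> rep_L2 f x = 0)"
    by (rule vanishes_outside.abs_eq) (simp add: l2_rel_def)
  then show ?thesis by (simp add: L2_on_def)
qed

lemma abs_L2_in_L2_on: "square_integrable u \<Longrightarrow> (\<And>x. x \<notin> \<Omega> \<Longrightarrow> u x = 0) \<Longrightarrow> abs_L2 u \<in> L2_on \<Omega>"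
  unfolding L2_on_def by (simp add: vanishes_outside.abs_eq l2_rel_def)

lemma L2_on_iff_chi:
  assumes "\<Omega> \<in> sets lebesgue" shows "f \<in> L2_on \<Omega> \<longleftrightarrow> chi \<Omega> f = f"
proof
  assume "f \<in> L2_on \<Omega>"
  then show "chi \<Omega> f = f"
    unfolding L2_eq_iff L2_on_iff using rep_chi[OF assms, of f] by (auto elim: eventually_elim2)
next
  assume "chi \<Omega> f = f"
  then show "f \<in> L2_on \<Omega>"
    unfolding L2_on_iff using rep_chi[OF assms, of f] by (auto elim: eventually_mono)
qed

lemma mult_on_in_L2_on:
  "\<Omega> \<in> sets lebesgue \<Longrightarrow> m \<in> Linf \<Omega> \<Longrightarrow> mult_on \<Omega> m f \<in> L2_on \<Omega>"
  unfolding L2_on_iff using rep_mult_on[of \<Omega> m f] by (auto elim: eventually_mono)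

lemma L2_on_add: "f \<in> L2_on \<Omega> \<Longrightarrow> g \<in> L2_on \<Omega> \<Longrightarrow> f + g \<in> L2_on \<Omega>"
  unfolding L2_on_iff using rep_L2_add[of f g] by (auto elim: eventually_elim2)

lemma L2_on_scaleC: "f \<in> L2_on \<Omega> \<Longrightarrow> c *\<^sub>C f \<in> L2_on \<Omega>"
  unfolding L2_on_iff using rep_L2_scaleC[of c f] by (auto elim: eventually_elim2)

lemma L2_on_zero: "0 \<in> L2_on \<Omega>"
  unfolding L2_on_iff using rep_L2_zero by (auto elim: eventually_mono)

lemma L2_on_minus: "f \<in> L2_on \<Omega> \<Longrightarrow> - f \<in> L2_on \<Omega>"
  by (simp add: uminus_L2_def L2_on_scaleC)

lemma L2_on_diff: "f \<in> L2_on \<Omega> \<Longrightarrow> g \<in> L2_on \<Omega> \<Longrightarrow> f - g \<in> L2_on \<Omega>"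
  by (simp only: diff_conv_add_uminus L2_on_add L2_on_minus)

lemma L2_on_scaleR: "f \<in> L2_on \<Omega> \<Longrightarrow> r *\<^sub>R f \<in> L2_on \<Omega>"
  by (simp add: scaleR_L2_def L2_on_scaleC)

lemma L2_on_mono: "f \<in> L2_on \<Omega> \<Longrightarrow> \<Omega> \<subseteq> \<Omega>' \<Longrightarrow> f \<in> L2_on \<Omega>'"
  unfolding L2_on_iff by (auto elim: eventually_mono)

lemma closed_L2_on: "\<Omega> \<in> sets lebesgue \<Longrightarrow> closed (L2_on \<Omega>)"
  using L2_on_iff_chi[of \<Omega>] continuous_on_eq_continuous_at
  by (subst set_eqI[of "L2_on \<Omega>" "{f. chi \<Omega> f = f}"])
     (auto intro!: closed_Collect_eq linear_continuous_on bounded_linear_chi continuous_on_id)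

lemma test_function_in_L2_on: "test_function \<Omega> \<phi> \<Longrightarrow> abs_L2 \<phi> \<in> L2_on \<Omega>"
  by (intro abs_L2_in_L2_on test_function_square_integrable test_function_vanishes)

section \<open>Density of test functions\<close>

text \<open>Every open set is a countable union of boxes, so partial sums of such functions become
  positive, one box after the other, on all of the set.\<close>

lemma elementary_box:
  "\<exists>\<rho>. elementary \<rho> \<and> (\<forall>x. 0 \<le> \<rho> x) \<and> {x. 0 < \<rho> x} = box l (u :: 'a::euclidean_space)"
proof (intro exI conjI allI)
  let ?\<rho> = "\<lambda>x. \<Prod>b\<in>Basis. flat 0 (x \<bullet> b - l \<bullet> b) * flat 0 (u \<bullet> b - x \<bullet> b)"
  show "elementary ?\<rho>"
    by (intro elementary_prod elementary.mult elementary.flat elementary_diff elementary.inner elementary.const)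
  show "0 \<le> ?\<rho> x" for x by (intro prod_nonneg mult_nonneg_nonneg flat_nonneg)
  have "0 < ?\<rho> x \<longleftrightarrow> x \<in> box l u" for x
  proof
    assume "x \<in> box l u"
    then show "0 < ?\<rho> x" by (intro prod_pos) (auto simp: flat_pos_iff box_def)
  next
    assume "0 < ?\<rho> x"
    then have ne: "?\<rho> x \<noteq> 0" by (rule less_imp_neq[THEN not_sym])
    show "x \<in> box l u"
      unfolding box_def
    proof (intro CollectI ballI)
      fix b :: 'a assume b: "b \<in> Basis"
      have "flat 0 (x \<bullet> b - l \<bullet> b) * flat 0 (u \<bullet> b - x \<bullet> b) \<noteq> 0"
      proof
        assume "flat 0 (x \<bullet> b - l \<bullet> b) * flat 0 (u \<bullet> b - x \<bullet> b) = 0"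
        with b have "\<exists>a\<in>Basis. flat 0 (x \<bullet> a - l \<bullet> a) * flat 0 (u \<bullet> a - x \<bullet> a) = 0" by (rule bexI[rotated])
        from prod_zero[OF finite_Basis this] ne show False by (rule notE[rotated])
      qed
      then show "l \<bullet> b < x \<bullet> b \<and> x \<bullet> b < u \<bullet> b"
        by (auto simp: flat_def split: if_splits)
    qed
  qed
  then show "{x. 0 < ?\<rho> x} = box l u" by blast
qed

text \<open>The set is exhausted by boxes, and a smooth step function is applied to multiples of the
  partial sums of their bump functions. The results stay below 1 and tend to 1 at every point of
  \<open>W\<close>.\<close>

lemma indicator_in_closure_test_functions:
  fixes W :: "'a::euclidean_space set"
  assumes W: "open W" "emeasure lebesgue W < \<infinity>"
  shows "abs_L2 (\<lambda>x. c * indicator W x) \<in> closure {abs_L2 \<phi> |\<phi>. test_function W \<phi>}"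
proof -
  obtain \<D> where D: "countable \<D>" "\<And>X. X \<in> \<D> \<Longrightarrow> \<exists>a b. X = box a b" "\<Union>\<D> = W"
    using open_countable_Union_open_box[OF W(1)] by metis
  \<comment> \<open>The empty box is added so that there is something to enumerate even if
    \<open>W\<close> is empty.\<close>
  define \<D>' where "\<D>' = insert {} \<D>"
  define X where "X = from_nat_into \<D>'"
  have rX: "range X = \<D>'"
    unfolding X_def \<D>'_def using D(1) by (intro range_from_nat_into) auto
  have "{} = box 0 (0::'a)" by simp
  then have "\<exists>a b. X n = box a b" for n
    using rX D(2) unfolding \<D>'_def by (metis insert_iff rangeI)
  then have "\<exists>\<rho>. elementary \<rho> \<and> (\<forall>x. 0 \<le> \<rho> x) \<and> {x. 0 < \<rho> x} = X n \<and> bounded (X n)" for n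
    using elementary_box bounded_box by metis
  then obtain \<rho> where \<rho>: "\<And>n. elementary (\<rho> n)" "\<And>n x. 0 \<le> \<rho> n x" "\<And>n. {x. 0 < \<rho> n x} = X n"
      "\<And>n. bounded (X n)"
    by metis
  define \<psi> where "\<psi> n x = (\<Sum>i<n. \<rho> i x)" for n :: nat and x
  have \<psi>el: "elementary (\<psi> n)" for n unfolding \<psi>_def by (intro elementary_sum \<rho>)
  have \<psi>pos: "\<exists>i<n. x \<in> X i" if "0 < \<psi> n x" for n x
  proof (rule ccontr)
    assume "\<not> ?thesis"
    then have "\<rho> i x = 0" if "i < n" for i using \<rho>(2)[of i x] \<rho>(3)[of i] that by force
    then show False using that by (simp add: \<psi>_def)
  qed
  have XW: "X i \<subseteq> W" for i using rX D(3) unfolding \<D>'_def by blast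
  \<comment> \<open>Subtracting 1 confines the support to the compact set where n
    \<open>\<psi> n\<close> is at least 1, which lies inside the first n boxes. The factor n lifts
    every point of \<open>W\<close> above this threshold eventually.\<close>
  define \<phi> where "\<phi> n x = complex_of_real (flat 0 (real n * \<psi> n x - 1)) * c" for n x
  have \<phi>0: "\<phi> n x = 0" if "x \<notin> W" for n x
  proof -
    have "\<not> 0 < \<psi> n x" using \<psi>pos XW that by blast
    then have "real n * \<psi> n x \<le> 0" by (intro mult_nonneg_nonpos) auto
    then show ?thesis by (simp add: \<phi>_def flat_def)
  qed
  have test: "test_function W (\<phi> n)" for n
  proof (rule test_functionI)
    show "smooth (\<phi> n)"
      unfolding \<phi>_def
      by (intro smooth_mult smooth_elementary smooth_const elementary.flat elementary_diff
          elementary.mult elementary.const \<psi>el)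
    let ?K = "{x. 1 \<le> real n * \<psi> n x}"
    have sub: "?K \<subseteq> (\<Union>i<n. X i)"
    proof
      fix x assume x: "x \<in> ?K"
      then have "0 < real n * \<psi> n x" by simp
      then have "0 < \<psi> n x" by (simp add: zero_less_mult_iff)
      then show "x \<in> (\<Union>i<n. X i)" using \<psi>pos by blast
    qed
    then show "?K \<subseteq> W" using XW by blast
    have "bounded ?K" by (rule bounded_subset[OF _ sub]) (auto intro: \<rho>)
    moreover have "closed ?K"
      by (intro closed_Collect_le continuous_intros elementary_continuous \<psi>el)
    ultimately show "compact ?K" by (simp add: compact_eq_bounded_closed)
    show "\<phi> n x = 0" if "x \<notin> ?K" for x using that by (simp add: \<phi>_def flat_def)
  qed
  have "(\<lambda>n. abs_L2 (\<phi> n)) \<longlonglongrightarrow> abs_L2 (\<lambda>x. c * indicator W x)"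
  proof (rule tendsto_abs_L2)
    show si: "square_integrable (\<lambda>x. c * indicator W x)"
      using W by (intro square_integrable_indicator) auto
    show "(\<lambda>x. c * indicator W x) \<in> borel_measurable lebesgue"
      by (rule square_integrable_measurable[OF si])
    show "\<phi> n \<in> borel_measurable lebesgue" for n
      by (intro smooth_measurable test_function_smooth[OF test])
    show "AE x in lebesgue. norm (\<phi> n x) \<le> norm (c * indicator W x)" for n
    proof (rule AE_I2)
      fix x
      have "norm (\<phi> n x) \<le> norm c"
        using mult_left_le_one_le[OF norm_ge_zero[of c] flat_nonneg flat_0_le_1, of "real n * \<psi> n x - 1"]
        by (simp add: \<phi>_def norm_mult flat_nonneg)
      then show "norm (\<phi> n x) \<le> norm (c * indicator W x)"
        using \<phi>0[of x n] by (cases "x \<in> W") auto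
    qed
    show "AE x in lebesgue. (\<lambda>n. \<phi> n x) \<longlonglongrightarrow> c * indicator W x"
    proof (rule AE_I2)
      fix x show "(\<lambda>n. \<phi> n x) \<longlonglongrightarrow> c * indicator W x"
      proof (cases "x \<in> W")
        case True
        then have "x \<in> \<Union>(range X)" using D(3) unfolding rX \<D>'_def by simp
        then obtain i where "x \<in> X i" by blast
        then have i: "0 < \<rho> i x" using \<rho>(3)[of i] by blast
        have "filterlim (\<lambda>n. real n * \<rho> i x - 1) at_top sequentially"
          using i by real_asymp
        moreover have "\<forall>\<^sub>F n in sequentially. real n * \<rho> i x - 1 \<le> real n * \<psi> n x - 1"
        proof (rule eventually_sequentiallyI[of "Suc i"])
          fix n assume "Suc i \<le> n"
          then have "\<rho> i x \<le> \<psi> n x"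
            unfolding \<psi>_def using \<rho>(2) by (intro member_le_sum) auto
          then show "real n * \<rho> i x - 1 \<le> real n * \<psi> n x - 1" by (simp add: mult_left_mono)
        qed
        ultimately have "filterlim (\<lambda>n. real n * \<psi> n x - 1) at_top sequentially"
          by (rule filterlim_at_top_mono)
        from filterlim_compose[OF flat_0_tendsto this]
        have "(\<lambda>n. complex_of_real (flat 0 (real n * \<psi> n x - 1)) * c) \<longlonglongrightarrow> of_real 1 * c"
          by (intro tendsto_intros)
        then show ?thesis using True by (simp add: \<phi>_def)
      next
        case False
        then show ?thesis using \<phi>0 by simp
      qed
    qed
  qed
  then show ?thesis
    unfolding closure_sequential using test by (intro exI[of _ "\<lambda>n. abs_L2 (\<phi> n)"]) auto
qed

theorem test_functions_dense:
  fixes \<Omega> :: "'a::euclidean_space set"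
  assumes \<Omega>: "open \<Omega>" and f: "f \<in> L2_on \<Omega>"
  shows "f \<in> closure {abs_L2 \<phi> |\<phi>. test_function \<Omega> \<phi>}"
proof -
  let ?C = "closure {abs_L2 \<phi> |\<phi>. test_function \<Omega> \<phi>}"
  have \<Omega>s: "\<Omega> \<in> sets lebesgue" using \<Omega> by auto
  obtain B :: "'a set set" where B: "countable B" "topological_basis B"
    using ex_countable_basis by auto
  have Cadd: "f + g \<in> ?C" if "f \<in> ?C" "g \<in> ?C" for f g
  proof -
    from that obtain a b where "\<And>n. a n \<in> {abs_L2 \<phi> |\<phi>. test_function \<Omega> \<phi>}" "a \<longlonglongrightarrow> f"
       "\<And>n. b n \<in> {abs_L2 \<phi> |\<phi>. test_function \<Omega> \<phi>}" "b \<longlonglongrightarrow> g"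
      unfolding closure_sequential by auto
    moreover have "a n + b n \<in> {abs_L2 \<phi> |\<phi>. test_function \<Omega> \<phi>}" for n
    proof -
      obtain \<phi> \<psi> where "a n = abs_L2 \<phi>" "b n = abs_L2 \<psi>" "test_function \<Omega> \<phi>" "test_function \<Omega> \<psi>"
        using calculation(1,3)[of n] by auto
      then show ?thesis
        by (auto simp: abs_L2_add test_function_square_integrable intro!: test_function_add)
    qed
    ultimately show ?thesis unfolding closure_sequential
      by (intro exI[of _ "\<lambda>n. a n + b n"]) (auto intro: tendsto_add)
  qed
  \<comment> \<open>The generation principle for the whole space concerns all classes, so it is
    applied to the preimage of the closure under the projection \<open>chi \<Omega>\<close>. For an
    indicator, the projection is the indicator of an intersection of open sets.\<close>
  have "{g. chi \<Omega> g \<in> ?C} = UNIV"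
  proof (rule closed_subset_L2_eq_UNIV[OF _ _ _ B])
    have "closed (chi \<Omega> -` ?C)"
      by (intro closed_vimage closed_closure linear_continuous_on bounded_linear_chi \<Omega>s)
    then show "closed {g. chi \<Omega> g \<in> ?C}" by (simp add: vimage_def)
    have "test_function \<Omega> (\<lambda>x. 0)" by (rule test_functionI[of _ "{}"]) (auto intro: smooth_const)
    then have "0 \<in> {abs_L2 \<phi> |\<phi>. test_function \<Omega> \<phi>}" unfolding zero_L2_def by blast
    then have "0 \<in> ?C" by (rule subsetD[OF closure_subset])
    then show "0 \<in> {g. chi \<Omega> g \<in> ?C}"
      using linear_0[OF bounded_linear.linear[OF bounded_linear_chi[OF \<Omega>s]]] by simp
    show "f + g \<in> {g. chi \<Omega> g \<in> ?C}" if "f \<in> {g. chi \<Omega> g \<in> ?C}" "g \<in> {g. chi \<Omega> g \<in> ?C}" for f g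
      using that by (simp add: mult_on_add[OF \<Omega>s one_Linf] Cadd)
    fix c :: complex and F
    assume F: "finite F" "F \<subseteq> B" "emeasure lebesgue (\<Union>F) < \<infinity>"
    have op: "open (\<Union>F)" using F(2) topological_basis_open[OF B(2)] by auto
    have sq: "square_integrable (\<lambda>x. c * indicator (\<Union>F) x)"
      using op F(3) by (intro square_integrable_indicator) auto
    have "emeasure lebesgue (\<Union>F \<inter> \<Omega>) < \<infinity>"
      using op \<Omega> by (intro le_less_trans[OF emeasure_mono F(3)]) auto
    then have "abs_L2 (\<lambda>x. c * indicator (\<Union>F \<inter> \<Omega>) x)
        \<in> closure {abs_L2 \<phi> |\<phi>. test_function (\<Union>F \<inter> \<Omega>) \<phi>}"
      using op \<Omega> by (intro indicator_in_closure_test_functions) auto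
    also have "closure {abs_L2 \<phi> |\<phi>. test_function (\<Union>F \<inter> \<Omega>) \<phi>} \<subseteq> ?C"
      by (intro closure_mono) (auto intro: test_function_mono)
    also have "(\<lambda>x. c * indicator (\<Union>F \<inter> \<Omega>) x) = (\<lambda>x. if x \<in> \<Omega> then c * indicator (\<Union>F) x else 0)"
      by (auto simp: indicator_def)
    finally show "abs_L2 (\<lambda>x. c * indicator (\<Union>F) x) \<in> {g. chi \<Omega> g \<in> ?C}"
      using chi_abs_L2[OF \<Omega>s sq] by simp
  qed
  then have "chi \<Omega> f \<in> ?C" by blast
  then show ?thesis using f L2_on_iff_chi[OF \<Omega>s] by simp
qed

section \<open>Weak derivatives\<close>

lemma eq_0_if_orthogonal_to_test_functions:
  assumes "open \<Omega>" "f \<in> L2_on \<Omega>" "\<And>\<phi>. test_function \<Omega> \<phi> \<Longrightarrow> cinner f (abs_L2 \<phi>) = 0"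
  shows "f = 0"
proof -
  obtain p where p: "\<And>n. p n \<in> {abs_L2 \<phi> |\<phi>. test_function \<Omega> \<phi>}" "p \<longlonglongrightarrow> f"
    using test_functions_dense[OF assms(1,2)] unfolding closure_sequential by auto
  have "(\<lambda>n. cinner f (p n)) \<longlonglongrightarrow> cinner f f" by (rule tendsto_cinner_right[OF p(2)])
  moreover have "cinner f (p n) = 0" for n using p(1)[of n] assms(3) by auto
  ultimately have "cinner f f = 0" by (simp add: LIMSEQ_const_iff)
  then show ?thesis using cinner_self(3)[of f] by simp
qed

lemma has_weak_derivative_unique:
  assumes "open \<Omega>" "has_weak_derivative \<Omega> b f g" "has_weak_derivative \<Omega> b f h"
  shows "g = h"
proof -
  have "g - h = 0"
    using assms(2,3)
    by (intro eq_0_if_orthogonal_to_test_functions[OF assms(1)])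
       (auto simp: has_weak_derivative_def cinner_simps intro: L2_on_diff)
  then show ?thesis by simp
qed

lemma weak_derivative_eqI:
  "open \<Omega> \<Longrightarrow> has_weak_derivative \<Omega> b f g \<Longrightarrow> weak_derivative \<Omega> b f = g"
  unfolding weak_derivative_def by (blast intro: has_weak_derivative_unique)

lemma has_weak_derivative_add:
  "has_weak_derivative \<Omega> b f g \<Longrightarrow> has_weak_derivative \<Omega> b f' g' \<Longrightarrow> has_weak_derivative \<Omega> b (f + f') (g + g')"
  by (auto simp: has_weak_derivative_def cinner_simps intro: L2_on_add)

lemma has_weak_derivative_scaleC:
  "has_weak_derivative \<Omega> b f g \<Longrightarrow> has_weak_derivative \<Omega> b (c *\<^sub>C f) (c *\<^sub>C g)"
  by (auto simp: has_weak_derivative_def cinner_simps intro: L2_on_scaleC)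

lemma has_weak_derivative_diff:
  "has_weak_derivative \<Omega> b f g \<Longrightarrow> has_weak_derivative \<Omega> b f' g' \<Longrightarrow> has_weak_derivative \<Omega> b (f - f') (g - g')"
  by (auto simp: has_weak_derivative_def cinner_simps intro: L2_on_diff)

lemma has_weak_derivative_limit:
  assumes \<Omega>: "\<Omega> \<in> sets lebesgue" and wd: "\<And>n. has_weak_derivative \<Omega> b (f n) (g n)"
    and lim: "f \<longlonglongrightarrow> F" "g \<longlonglongrightarrow> G"
  shows "has_weak_derivative \<Omega> b F G"
  unfolding has_weak_derivative_def
proof (intro conjI allI impI)
  show "F \<in> L2_on \<Omega>" "G \<in> L2_on \<Omega>"
    using closed_sequentially[OF closed_L2_on[OF \<Omega>]] wd lim
    by (auto simp: has_weak_derivative_def)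
  fix \<phi> assume \<phi>: "test_function \<Omega> \<phi>"
  have "(\<lambda>n. cinner (f n) (abs_L2 (partial b \<phi>))) \<longlonglongrightarrow> cinner F (abs_L2 (partial b \<phi>))"
    by (rule tendsto_cinner_left[OF lim(1)])
  moreover have "(\<lambda>n. - cinner (g n) (abs_L2 \<phi>)) \<longlonglongrightarrow> - cinner G (abs_L2 \<phi>)"
    by (intro tendsto_minus tendsto_cinner_left[OF lim(2)])
  moreover have "cinner (f n) (abs_L2 (partial b \<phi>)) = - cinner (g n) (abs_L2 \<phi>)" for n
    using wd \<phi> by (simp add: has_weak_derivative_def)
  ultimately show "cinner F (abs_L2 (partial b \<phi>)) = - cinner G (abs_L2 \<phi>)"
    by (simp add: LIMSEQ_unique)
qed

lemma test_function_has_weak_derivative: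
  assumes \<phi>: "test_function \<Omega> \<phi>" and b: "b \<in> Basis"
  shows "has_weak_derivative \<Omega> b (abs_L2 \<phi>) (abs_L2 (partial b \<phi>))"
  unfolding has_weak_derivative_def
proof (intro conjI allI impI)
  note \<phi>' = test_function_partial[OF \<phi> b]
  show "abs_L2 \<phi> \<in> L2_on \<Omega>" "abs_L2 (partial b \<phi>) \<in> L2_on \<Omega>"
    using \<phi> \<phi>' by (auto intro: test_function_in_L2_on)
  fix \<psi> assume \<psi>: "test_function \<Omega> \<psi>"
  note \<psi>' = test_function_partial[OF \<psi> b]
  note sq = test_function_square_integrable
  have sm: "smooth \<phi>" "smooth (\<lambda>x. cnj (\<psi> x))"
    using \<phi> \<psi> by (auto intro: smooth_cnj test_function_smooth)
  \<comment> \<open>Integration by parts: by the product rule, the derivative of this product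
    consists of the two integrands to be compared.\<close>
  have "test_function UNIV (\<lambda>x. cnj (\<psi> x) * \<phi> x)"
    by (rule test_function_mono[OF test_function_mult[OF \<phi> sm(2)]]) simp
  from integral_partial_eq_0[OF this b]
  have "(\<integral>x. cnj (\<psi> x) * partial b \<phi> x + cnj (partial b \<psi> x) * \<phi> x \<partial>lebesgue) = 0"
    by (simp add: partial_mult[OF sm(2,1)] fun_cong[OF partial_cnj[OF test_function_smooth[OF \<psi>]]])
  moreover have "integrable lebesgue (\<lambda>x. partial b \<phi> x * cnj (\<psi> x))"
    "integrable lebesgue (\<lambda>x. \<phi> x * cnj (partial b \<psi> x))"
    by (intro integrable_mult_cnj sq[OF \<phi>] sq[OF \<psi>] sq[OF \<phi>'] sq[OF \<psi>'])+
  ultimately have "(\<integral>x. partial b \<phi> x * cnj (\<psi> x) \<partial>lebesgue) + (\<integral>x. \<phi> x * cnj (partial b \<psi> x) \<partial>lebesgue) = 0"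
    by (simp add: mult.commute)
  then show "cinner (abs_L2 \<phi>) (abs_L2 (partial b \<psi>)) = - cinner (abs_L2 (partial b \<phi>)) (abs_L2 \<psi>)"
    by (simp add: cinner_abs_L2 sq[OF \<phi>] sq[OF \<psi>] sq[OF \<phi>'] sq[OF \<psi>'] add_eq_0_iff)
qed

section \<open>Sobolev spaces\<close>

lemma H1_iff: "f \<in> H1 \<Omega> \<longleftrightarrow> f \<in> L2_on \<Omega> \<and> (\<exists>g. \<forall>b\<in>Basis. has_weak_derivative \<Omega> b f (g b))"
  unfolding H1_def by (auto simp: bchoice_iff)

lemma H1_has_weak_derivative:
  "open \<Omega> \<Longrightarrow> f \<in> H1 \<Omega> \<Longrightarrow> b \<in> Basis \<Longrightarrow> has_weak_derivative \<Omega> b f (weak_derivative \<Omega> b f)"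
  unfolding H1_def using weak_derivative_eqI by blast

lemma H1_norm_components:
  fixes f :: "'a::euclidean_space L2"
  shows "norm f \<le> H1_norm \<Omega> f" "b \<in> Basis \<Longrightarrow> norm (weak_derivative \<Omega> b f) \<le> H1_norm \<Omega> f"
    and "H1_norm \<Omega> f \<le> norm f + (\<Sum>b\<in>Basis. norm (weak_derivative \<Omega> b f))"
proof -
  show "norm f \<le> H1_norm \<Omega> f"
    unfolding H1_norm_def by (intro real_le_rsqrt) (auto intro: sum_nonneg)
  show "norm (weak_derivative \<Omega> b f) \<le> H1_norm \<Omega> f" if "b \<in> Basis" for b
    unfolding H1_norm_def using that
    by (intro real_le_rsqrt add_increasing member_le_sum) auto
  have "H1_norm \<Omega> f \<le> sqrt ((norm f)\<^sup>2) + sqrt (\<Sum>b\<in>Basis. (norm (weak_derivative \<Omega> b f))\<^sup>2)"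
    unfolding H1_norm_def by (intro sqrt_add_le_add_sqrt) (auto intro: sum_nonneg)
  also have "sqrt (\<Sum>b\<in>Basis. (norm (weak_derivative \<Omega> b f))\<^sup>2) \<le> (\<Sum>b\<in>Basis. norm (weak_derivative \<Omega> b f))"
    using L2_set_le_sum[of Basis "\<lambda>b. norm (weak_derivative \<Omega> b f)"] by (simp add: L2_set_def)
  finally show "H1_norm \<Omega> f \<le> norm f + (\<Sum>b\<in>Basis. norm (weak_derivative \<Omega> b f))" by simp
qed

text \<open>Says that \<open>f\<close> is in \<open>H1_0\<close> with weak derivatives
  \<open>g\<close>, but with the derivatives as a separate argument. Extensions and restrictions can
  thus be approximated together with their expected derivatives before those are known to be weak
  derivatives.\<close>

definition H1_limit_of_test_functions ::
    "'a::euclidean_space set \<Rightarrow> 'a L2 \<Rightarrow> ('a \<Rightarrow> 'a L2) \<Rightarrow> bool" where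
  "H1_limit_of_test_functions \<Omega> f g \<longleftrightarrow>
     (\<forall>\<epsilon>>0. \<exists>\<phi>. test_function \<Omega> \<phi> \<and> norm (f - abs_L2 \<phi>) < \<epsilon> \<and>
        (\<forall>b\<in>Basis. norm (g b - abs_L2 (partial b \<phi>)) < \<epsilon>))"

lemma H1_limit_has_weak_derivative:
  assumes \<Omega>: "\<Omega> \<in> sets lebesgue" and P: "H1_limit_of_test_functions \<Omega> f g" and b: "b \<in> Basis"
  shows "has_weak_derivative \<Omega> b f (g b)"
proof -
  have "\<exists>\<phi>. test_function \<Omega> \<phi> \<and> norm (f - abs_L2 \<phi>) < inverse (real (Suc n)) \<and>
      norm (g b - abs_L2 (partial b \<phi>)) < inverse (real (Suc n))" for n
    using P[unfolded H1_limit_of_test_functions_def, rule_format, of "inverse (real (Suc n))"] b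
    by force
  then obtain \<phi> where \<phi>: "\<And>n. test_function \<Omega> (\<phi> n)"
    "\<And>n. norm (f - abs_L2 (\<phi> n)) < inverse (real (Suc n))"
    "\<And>n. norm (g b - abs_L2 (partial b (\<phi> n))) < inverse (real (Suc n))" by metis
  have lim: "h \<longlonglongrightarrow> k" if "\<And>n. norm (k - h n) < inverse (real (Suc n))" for h :: "nat \<Rightarrow> 'a L2" and k
  proof -
    have "(\<lambda>n. norm (h n - k)) \<longlonglongrightarrow> 0"
      by (rule tendsto_sandwich[OF _ _ tendsto_const LIMSEQ_inverse_real_of_nat])
         (auto simp: norm_minus_commute simp del: of_nat_Suc intro!: always_eventually less_imp_le[OF that])
    then show ?thesis using Lim_null tendsto_norm_zero_iff by blast
  qed
  show ?thesis
    by (rule has_weak_derivative_limit[OF \<Omega> test_function_has_weak_derivative[OF \<phi>(1) b] lim lim])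
       (rule \<phi>)+
qed

lemma H1_0_imp_limit:
  assumes \<Omega>: "open \<Omega>" and f: "f \<in> H1_0 \<Omega>"
  shows "H1_limit_of_test_functions \<Omega> f (\<lambda>b. weak_derivative \<Omega> b f)"
  unfolding H1_limit_of_test_functions_def
proof (intro allI impI)
  fix \<epsilon> :: real assume "0 < \<epsilon>"
  then obtain \<phi> where \<phi>: "test_function \<Omega> \<phi>" "H1_norm \<Omega> (f - abs_L2 \<phi>) < \<epsilon>"
    using f by (auto simp: H1_0_def)
  have H: "f \<in> H1 \<Omega>" using f by (simp add: H1_0_def)
  have w: "weak_derivative \<Omega> b (f - abs_L2 \<phi>) = weak_derivative \<Omega> b f - abs_L2 (partial b \<phi>)"
    if "b \<in> Basis" for b
    by (intro weak_derivative_eqI[OF \<Omega>] has_weak_derivative_diff H1_has_weak_derivative[OF \<Omega> H]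
        test_function_has_weak_derivative \<phi> that)
  have "norm (f - abs_L2 \<phi>) < \<epsilon>"
    by (rule le_less_trans[OF H1_norm_components(1) \<phi>(2)])
  moreover have "norm (weak_derivative \<Omega> b f - abs_L2 (partial b \<phi>)) < \<epsilon>" if "b \<in> Basis" for b
    using le_less_trans[OF H1_norm_components(2)[OF that] \<phi>(2)] w[OF that] by simp
  ultimately show "\<exists>\<phi>. test_function \<Omega> \<phi> \<and> norm (f - abs_L2 \<phi>) < \<epsilon> \<and>
      (\<forall>b\<in>Basis. norm (weak_derivative \<Omega> b f - abs_L2 (partial b \<phi>)) < \<epsilon>)"
    using \<phi>(1) by blast
qed

lemma H1_0I:
  fixes \<Omega> :: "'a::euclidean_space set"
  assumes \<Omega>: "open \<Omega>" and g: "H1_limit_of_test_functions \<Omega> f g"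
  shows "f \<in> H1_0 \<Omega>"
proof -
  note wd = H1_limit_has_weak_derivative[OF _ g]
  have \<Omega>s: "\<Omega> \<in> sets lebesgue" using \<Omega> by auto
  obtain b0 :: 'a where "b0 \<in> Basis" using nonempty_Basis by blast
  then have "f \<in> L2_on \<Omega>" using wd[OF \<Omega>s] by (auto simp: has_weak_derivative_def)
  then have H: "f \<in> H1 \<Omega>"
    unfolding H1_iff using wd[OF \<Omega>s] by blast
  show "f \<in> H1_0 \<Omega>"
    unfolding H1_0_def
  proof (intro CollectI conjI allI impI H)
    fix \<epsilon> :: real assume \<epsilon>: "0 < \<epsilon>"
    \<comment> \<open>The \<open>H1_norm\<close> is at most a sum of \<open>1 + DIM('a)\<close>
      norms, each of which is made smaller than \<open>d\<close>.\<close>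
    define d where "d = \<epsilon> / (1 + real DIM('a))"
    have "0 < d" using \<epsilon> by (simp add: d_def)
    then obtain \<phi> where \<phi>: "test_function \<Omega> \<phi>" "norm (f - abs_L2 \<phi>) < d"
      "\<And>b. b \<in> Basis \<Longrightarrow> norm (g b - abs_L2 (partial b \<phi>)) < d"
      using g unfolding H1_limit_of_test_functions_def by blast
    have w: "weak_derivative \<Omega> b (f - abs_L2 \<phi>) = g b - abs_L2 (partial b \<phi>)" if "b \<in> Basis" for b
      by (intro weak_derivative_eqI[OF \<Omega>] has_weak_derivative_diff wd[OF \<Omega>s]
          test_function_has_weak_derivative \<phi> that)
    have "H1_norm \<Omega> (f - abs_L2 \<phi>)
        \<le> norm (f - abs_L2 \<phi>) + (\<Sum>b\<in>Basis. norm (weak_derivative \<Omega> b (f - abs_L2 \<phi>)))"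
      by (rule H1_norm_components)
    also have "\<dots> < d + (\<Sum>b\<in>(Basis::'a set). d)"
      using \<phi> w by (intro add_less_le_mono sum_mono) (auto intro: less_imp_le)
    also have "\<dots> = d * (1 + real DIM('a))" by (simp add: algebra_simps)
    also have "\<dots> = \<epsilon>" unfolding d_def using DIM_positive[where 'a='a] by simp
    finally show "\<exists>\<phi>. test_function \<Omega> \<phi> \<and> H1_norm \<Omega> (f - abs_L2 \<phi>) < \<epsilon>" using \<phi>(1) by blast
  qed
qed

section \<open>Uniqueness of semigroups\<close>

lemma C0_semigroup_onD:
  assumes "C0_semigroup_on X U"
  shows "0 \<le> t \<Longrightarrow> f \<in> X \<Longrightarrow> U t f \<in> X"
    and "0 \<le> t \<Longrightarrow> f \<in> X \<Longrightarrow> g \<in> X \<Longrightarrow> U t (f + g) = U t f + U t g"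
    and "0 \<le> t \<Longrightarrow> f \<in> X \<Longrightarrow> U t (c *\<^sub>C f) = c *\<^sub>C U t f"
    and "0 \<le> t \<Longrightarrow> \<exists>C. \<forall>f\<in>X. norm (U t f) \<le> C * norm f"
    and "f \<in> X \<Longrightarrow> U 0 f = f"
    and "0 \<le> s \<Longrightarrow> 0 \<le> t \<Longrightarrow> f \<in> X \<Longrightarrow> U (s + t) f = U s (U t f)"
    and "f \<in> X \<Longrightarrow> ((\<lambda>t. U t f) \<longlongrightarrow> f) (at_right 0)"
  using assms unfolding C0_semigroup_on_def by blast+

section \<open>Boundedness, continuity and differentiability of the orbits of a strongly continuous
  semigroup\<close>

locale L2_semigroup =
  fixes \<Omega> :: "'a::euclidean_space set" and U :: "real \<Rightarrow> 'a L2 \<Rightarrow> 'a L2"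
  assumes \<Omega>: "\<Omega> \<in> sets lebesgue" and C0: "C0_semigroup_on (L2_on \<Omega>) U"
begin

lemmas semigroup = C0_semigroup_onD[OF C0]

lemma chi_in: "chi \<Omega> f \<in> L2_on \<Omega>"
  by (rule mult_on_in_L2_on[OF \<Omega> one_Linf])

lemma chi_id: "f \<in> L2_on \<Omega> \<Longrightarrow> chi \<Omega> f = f"
  using L2_on_iff_chi[OF \<Omega>] by blast

text \<open>The semigroup is only specified on \<open>L2_on \<Omega>\<close>. Precomposed with the
  projection \<open>chi \<Omega>\<close>, it becomes an operator on the whole type, to which the
  results on bounded linear maps apply.\<close>

lemma bounded_linear_U:
  assumes "0 \<le> t" shows "bounded_linear (\<lambda>f. U t (chi \<Omega> f))"
proof -
  obtain C where C: "\<forall>f\<in>L2_on \<Omega>. norm (U t f) \<le> C * norm f" using semigroup(4)[OF assms] by blast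
  have "norm (U t (chi \<Omega> f)) \<le> \<bar>C\<bar> * norm f" for f
  proof -
    have "norm (U t (chi \<Omega> f)) \<le> C * norm (chi \<Omega> f)" using C chi_in by blast
    also have "\<dots> \<le> \<bar>C\<bar> * norm f" by (intro mult_mono norm_chi \<Omega>) auto
    finally show ?thesis .
  qed
  then show ?thesis
    by (rule bounded_linear_L2I[rotated 2])
       (simp_all add: mult_on_add[OF \<Omega> one_Linf] mult_on_scaleC[OF \<Omega> one_Linf]
          semigroup(2,3)[OF assms] chi_in)
qed

lemma U_diff:
  assumes "0 \<le> t" "f \<in> L2_on \<Omega>" "g \<in> L2_on \<Omega>" shows "U t (f - g) = U t f - U t g"
  using linear_diff[OF bounded_linear.linear[OF bounded_linear_U[OF assms(1)]], of f g] assms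
  by (simp add: chi_id L2_on_diff)

lemma U_scaleR:
  assumes "0 \<le> t" "f \<in> L2_on \<Omega>" shows "U t (r *\<^sub>R f) = r *\<^sub>R U t f"
  unfolding scaleR_L2_def using semigroup(3) assms by blast

lemma U_tendsto:
  assumes "0 \<le> t" "(f \<longlongrightarrow> g) F" "\<forall>\<^sub>F x in F. f x \<in> L2_on \<Omega>" "g \<in> L2_on \<Omega>"
  shows "((\<lambda>x. U t (f x)) \<longlongrightarrow> U t g) F"
proof -
  have "((\<lambda>x. U t (chi \<Omega> (f x))) \<longlongrightarrow> U t (chi \<Omega> g)) F"
    by (rule bounded_linear.tendsto[OF bounded_linear_U[OF assms(1)] assms(2)])
  moreover have "\<forall>\<^sub>F x in F. U t (chi \<Omega> (f x)) = U t (f x)"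
    using assms(3) by eventually_elim (simp add: chi_id)
  ultimately show ?thesis
    using assms(4) by (simp add: chi_id) (rule Lim_transform_eventually)
qed

text \<open>Otherwise the operators at some times tending to 0 would have unbounded norms, although
  strong continuity at 0 bounds them on every single vector; this contradicts uniform
  boundedness.\<close>

lemma bounded_near_0:
  "\<exists>\<delta>>0. \<exists>M. \<forall>t\<in>{0..\<delta>}. \<forall>f\<in>L2_on \<Omega>. norm (U t f) \<le> M * norm f"
proof (rule ccontr)
  assume "\<not> ?thesis"
  then have "\<exists>t\<in>{0..inverse (real (Suc n))}. \<exists>f\<in>L2_on \<Omega>. real (Suc n) * norm f < norm (U t f)" for n
    by (meson inverse_positive_iff_positive linorder_not_le of_nat_0_less_iff zero_less_Suc)
  then obtain t f where t: "\<And>n. t n \<in> {0..inverse (real (Suc n))}" and f: "\<And>n. f n \<in> L2_on \<Omega>"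
    and big: "\<And>n. real (Suc n) * norm (f n) < norm (U (t n) (f n))" by metis
  \<comment> \<open>Strong continuity is stated along \<open>at_right 0\<close>, which excludes the
    time 0 itself. There the operator is the identity and cannot have been selected.\<close>
  have t0: "0 < t n" for n
  proof (rule ccontr)
    assume "\<not> 0 < t n"
    then have "t n = 0" using t[of n] by auto
    then have "real (Suc n) * norm (f n) < norm (f n)" using big[of n] semigroup(5)[OF f] by simp
    then show False using mult_right_mono[of 1 "real (Suc n)" "norm (f n)"] by simp
  qed
  have "t \<longlonglongrightarrow> 0"
    by (rule tendsto_sandwich[OF _ _ tendsto_const LIMSEQ_inverse_real_of_nat])
       (use t in \<open>auto simp del: of_nat_Suc\<close>)
  then have tl: "filterlim t (at_right 0) sequentially"
    using t0 less_imp_neq[OF t0, THEN not_sym] by (auto simp: filterlim_at)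
  have "\<exists>M. \<forall>n. norm (U (t n) (chi \<Omega> x)) \<le> M" for x
  proof -
    have "(\<lambda>n. U (t n) (chi \<Omega> x)) \<longlonglongrightarrow> chi \<Omega> x"
      by (rule filterlim_compose[OF semigroup(7)[OF chi_in] tl])
    then have "Bseq (\<lambda>n. U (t n) (chi \<Omega> x))" by (intro convergent_imp_Bseq convergentI)
    then show ?thesis by (auto simp: Bseq_def)
  qed
  then obtain M where M: "\<And>n x. norm (U (t n) (chi \<Omega> x)) \<le> M * norm x"
    using uniform_boundedness_L2[of "\<lambda>n f. U (t n) (chi \<Omega> f)", OF bounded_linear_U] t0
    by (meson less_imp_le)
  obtain n where n: "M \<le> real n" using real_arch_simple by blast
  have "real (Suc n) * norm (f n) < M * norm (f n)"
    using big[of n] M[of n "f n"] by (simp add: chi_id f)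
  also have "\<dots> \<le> real (Suc n) * norm (f n)" using n by (intro mult_right_mono) auto
  finally show False by simp
qed

text \<open>By the semigroup law, a time up to \<open>a\<close> is reached in a fixed number of
  steps of length at most \<delta>, each of which costs a factor \<bar>M\<bar>.\<close>

lemma locally_bounded:
  "\<exists>M\<ge>0. \<forall>t\<in>{0..a}. \<forall>f\<in>L2_on \<Omega>. norm (U t f) \<le> M * norm f"
proof -
  obtain \<delta> M where \<delta>: "0 < \<delta>" and M: "\<And>t f. t \<in> {0..\<delta>} \<Longrightarrow> f \<in> L2_on \<Omega> \<Longrightarrow> norm (U t f) \<le> M * norm f"
    using bounded_near_0 by blast
  have M': "norm (U t f) \<le> \<bar>M\<bar> * norm f" if "t \<in> {0..\<delta>}" "f \<in> L2_on \<Omega>" for t f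
    using M[OF that] by (rule order_trans) (auto intro: mult_right_mono)
  have *: "norm (U t f) \<le> \<bar>M\<bar> ^ n * norm f" if "t \<in> {0..real n * \<delta>}" "f \<in> L2_on \<Omega>" for n t f
    using that(1)
  proof (induction n arbitrary: t)
    case 0
    then show ?case using semigroup(5)[OF that(2)] by simp
  next
    case (Suc n)
    define s where "s = min t \<delta>"
    have s: "s \<in> {0..\<delta>}" "t - s \<in> {0..real n * \<delta>}"
      using Suc.prems \<delta> by (auto simp: s_def min_def algebra_simps)
    have "U t f = U s (U (t - s) f)"
      using semigroup(6)[of s "t - s" f] s that(2) by simp
    also have "norm \<dots> \<le> \<bar>M\<bar> * norm (U (t - s) f)"
      using s by (intro M' semigroup(1) that(2)) auto
    also have "\<dots> \<le> \<bar>M\<bar> * (\<bar>M\<bar> ^ n * norm f)" by (intro mult_left_mono Suc.IH s) auto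
    finally show ?case by (simp add: mult.assoc)
  qed
  obtain n where "a / \<delta> \<le> real n" using real_arch_simple by blast
  then have "a \<le> real n * \<delta>" using \<delta> by (simp add: divide_le_eq)
  then show ?thesis using * by (intro exI[of _ "\<bar>M\<bar> ^ n"]) auto
qed

lemma U_tendsto_abs:
  assumes "f \<in> L2_on \<Omega>" shows "((\<lambda>h. U \<bar>h\<bar> f) \<longlongrightarrow> f) (at 0)"
proof -
  have "filterlim (\<lambda>h::real. \<bar>h\<bar>) (at_right 0) (at 0)"
    unfolding filterlim_at by (auto simp: eventually_at_filter intro!: tendsto_eq_intros)
  then show ?thesis by (rule filterlim_compose[OF semigroup(7)[OF assms]])
qed

text \<open>Pulling out the operator at the smaller time reduces the difference to one at time 0.
  Continuity from the right at 0 thereby yields continuity from both sides everywhere.\<close>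

lemma U_diff_bound:
  assumes M: "\<And>t g. t \<in> {0..a} \<Longrightarrow> g \<in> L2_on \<Omega> \<Longrightarrow> norm (U t g) \<le> M * norm g"
    and st: "0 \<le> s" "s \<le> a" "0 \<le> t" "t \<le> a" and f: "f \<in> L2_on \<Omega>"
  shows "norm (U t f - U s f) \<le> M * norm (U \<bar>t - s\<bar> f - f)"
proof -
  have 1: "norm (U t f - U s f) \<le> M * norm (U \<bar>t - s\<bar> f - f)" if "0 \<le> s" "s \<le> t" "s \<le> a" for s t
  proof -
    have "U t f = U s (U \<bar>t - s\<bar> f)" using semigroup(6)[of s "\<bar>t - s\<bar>" f] that f by simp
    then have "U t f - U s f = U s (U \<bar>t - s\<bar> f - f)"
      using that f by (simp add: U_diff semigroup(1))
    then show ?thesis using M[of s] that f by (simp add: L2_on_diff semigroup(1))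
  qed
  show ?thesis
  proof (cases "s \<le> t")
    case True then show ?thesis using 1[of s t] st by simp
  next
    case False then show ?thesis using 1[of t s] st by (simp add: norm_minus_commute abs_minus_commute)
  qed
qed

lemma U_continuous:
  assumes f: "f \<in> L2_on \<Omega>" shows "continuous_on {0..a} (\<lambda>t. U t f)"
  unfolding continuous_on_def
proof
  fix t assume t: "t \<in> {0..a}"
  obtain M where M: "\<And>t g. t \<in> {0..a} \<Longrightarrow> g \<in> L2_on \<Omega> \<Longrightarrow> norm (U t g) \<le> M * norm g"
    using locally_bounded by blast
  have sh: "filterlim (\<lambda>s. s - t) (at 0) (at t within {0..a})"
    unfolding filterlim_at by (auto simp: eventually_at_filter intro!: tendsto_eq_intros)
  have "((\<lambda>s. U \<bar>s - t\<bar> f - f) \<longlongrightarrow> f - f) (at t within {0..a})"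
    by (intro tendsto_diff filterlim_compose[OF U_tendsto_abs[OF f] sh] tendsto_const)
  then have "((\<lambda>s. M * norm (U \<bar>s - t\<bar> f - f)) \<longlongrightarrow> M * norm (f - f)) (at t within {0..a})"
    by (intro tendsto_mult tendsto_const tendsto_norm)
  then have lim: "((\<lambda>s. M * norm (U \<bar>s - t\<bar> f - f)) \<longlongrightarrow> 0) (at t within {0..a})"
    by simp
  have "((\<lambda>s. norm (U s f - U t f)) \<longlongrightarrow> 0) (at t within {0..a})"
  proof (rule tendsto_sandwich[OF _ _ tendsto_const lim])
    show "\<forall>\<^sub>F s in at t within {0..a}. norm (U s f - U t f) \<le> M * norm (U \<bar>s - t\<bar> f - f)"
      unfolding eventually_at_filter
      by (intro always_eventually allI impI U_diff_bound[OF M _ _ _ _ f]) (use t in auto)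
  qed auto
  then show "((\<lambda>t. U t f) \<longlongrightarrow> U t f) (at t within {0..a})"
    by (simp add: Lim_null[of _ "U t f"] tendsto_norm_zero_iff)
qed

lemma generator_in: "(f, g) \<in> generator (L2_on \<Omega>) U \<Longrightarrow> f \<in> L2_on \<Omega> \<and> g \<in> L2_on \<Omega>"
  by (simp add: generator_def)

lemma quotient_in: "f \<in> L2_on \<Omega> \<Longrightarrow> 0 \<le> h \<Longrightarrow> r *\<^sub>R (U h f - f) \<in> L2_on \<Omega>"
  by (intro L2_on_scaleR L2_on_diff semigroup(1))

lemma generator_invariant:
  assumes fg: "(f, g) \<in> generator (L2_on \<Omega>) U" and t: "0 \<le> t"
  shows "(U t f, U t g) \<in> generator (L2_on \<Omega>) U"
proof -
  have f: "f \<in> L2_on \<Omega>" "g \<in> L2_on \<Omega>" using generator_in[OF fg] by auto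
  have ev: "\<forall>\<^sub>F h in at_right 0. (1 / h) *\<^sub>R (U h f - f) \<in> L2_on \<Omega>"
    by (auto simp: eventually_at_filter intro!: always_eventually quotient_in f)
  have "((\<lambda>h. U t ((1 / h) *\<^sub>R (U h f - f))) \<longlongrightarrow> U t g) (at_right 0)"
    by (rule U_tendsto[OF t _ ev f(2)]) (use fg in \<open>simp add: generator_def\<close>)
  moreover have "\<forall>\<^sub>F h in at_right 0. U t ((1 / h) *\<^sub>R (U h f - f)) = (1 / h) *\<^sub>R (U h (U t f) - U t f)"
  proof -
    have "U t ((1 / h) *\<^sub>R (U h f - f)) = (1 / h) *\<^sub>R (U h (U t f) - U t f)" if h: "0 < h" for h
      using h t f semigroup(6)[of t h f] semigroup(6)[of h t f]
      by (simp add: U_scaleR U_diff L2_on_diff semigroup(1) add.commute)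
    then show ?thesis by (auto simp: eventually_at_filter)
  qed
  ultimately have "((\<lambda>h. (1 / h) *\<^sub>R (U h (U t f) - U t f)) \<longlongrightarrow> U t g) (at_right 0)"
    by (rule Lim_transform_eventually)
  then show ?thesis using f t by (simp add: generator_def semigroup(1))
qed

lemma generator_diff:
  assumes "(f, g) \<in> generator (L2_on \<Omega>) U" "(f', g') \<in> generator (L2_on \<Omega>) U"
  shows "(f - f', g - g') \<in> generator (L2_on \<Omega>) U"
proof -
  have f: "f \<in> L2_on \<Omega>" "g \<in> L2_on \<Omega>" "f' \<in> L2_on \<Omega>" "g' \<in> L2_on \<Omega>"
    using generator_in[OF assms(1)] generator_in[OF assms(2)] by auto
  have "((\<lambda>h. (1 / h) *\<^sub>R (U h f - f) - (1 / h) *\<^sub>R (U h f' - f')) \<longlongrightarrow> g - g') (at_right 0)"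
    using assms by (intro tendsto_diff) (auto simp: generator_def)
  moreover have "\<forall>\<^sub>F h in at_right 0. (1 / h) *\<^sub>R (U h f - f) - (1 / h) *\<^sub>R (U h f' - f')
      = (1 / h) *\<^sub>R (U h (f - f') - (f - f'))"
    using f by (auto simp: eventually_at_filter U_diff scaleR_diff_right[symmetric] intro!: always_eventually)
  ultimately have "((\<lambda>h. (1 / h) *\<^sub>R (U h (f - f') - (f - f'))) \<longlongrightarrow> g - g') (at_right 0)"
    by (rule Lim_transform_eventually)
  then show ?thesis using f by (simp add: generator_def L2_on_diff)
qed

text \<open>The generator controls only forward differences at time 0. The error \<open>r\<close> of
  such a difference is transported along the orbit: from \<open>t\<close> if \<open>h\<close> is
  positive, and from the earlier time \<open>t + h\<close> if it is negative. The latter gives the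
  derivative at \<open>t + h\<close>, which continuity of the orbit of \<open>g\<close> replaces by
  the one at \<open>t\<close>.\<close>

lemma U_has_vector_derivative:
  assumes fg: "(f, g) \<in> generator (L2_on \<Omega>) U" and t: "0 < t"
  shows "((\<lambda>t. U t f) has_vector_derivative U t g) (at t)"
proof -
  have f: "f \<in> L2_on \<Omega>" "g \<in> L2_on \<Omega>" using generator_in[OF fg] by auto
  obtain M where M0: "0 \<le> M" and M: "\<And>s g. s \<in> {0..t + 1} \<Longrightarrow> g \<in> L2_on \<Omega> \<Longrightarrow> norm (U s g) \<le> M * norm g"
    using locally_bounded by blast
  have ab: "filterlim (\<lambda>h::real. \<bar>h\<bar>) (at_right 0) (at 0)"
    unfolding filterlim_at by (auto simp: eventually_at_filter intro!: tendsto_eq_intros)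
  define e where "e h = norm ((1 / \<bar>h\<bar>) *\<^sub>R (U \<bar>h\<bar> f - f) - g)" for h
  have "((\<lambda>h. (1 / h) *\<^sub>R (U h f - f)) \<longlongrightarrow> g) (at_right 0)" using fg by (simp add: generator_def)
  from filterlim_compose[OF this ab]
  have "((\<lambda>h. (1 / \<bar>h\<bar>) *\<^sub>R (U \<bar>h\<bar> f - f) - g) \<longlongrightarrow> g - g) (at 0)"
    by (intro tendsto_diff tendsto_const)
  then have e: "(e \<longlongrightarrow> 0) (at 0)"
    unfolding e_def by (simp add: tendsto_norm_zero_iff)
  have "continuous (at t) (\<lambda>s. U s g)"
    using U_continuous[OF f(2), of "t + 1"] t
    by (intro continuous_on_interior[of "{0..t+1}"]) (auto simp: interior_atLeastAtMost_real)
  then have "((\<lambda>h. U (t + h) g - U t g) \<longlongrightarrow> 0) (at 0)"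
    unfolding isCont_def by (intro LIM_zero LIM_offset_zero)
  then have b: "((\<lambda>h. M * e h + norm (U (t + h) g - U t g)) \<longlongrightarrow> M * 0 + 0) (at 0)"
    by (intro tendsto_intros e tendsto_norm_zero)
  have bound: "norm (U (t + h) f - U t f - h *\<^sub>R U t g) / \<bar>h\<bar> \<le> M * e h + norm (U (t + h) g - U t g)"
    if h: "h \<noteq> 0" "\<bar>h\<bar> < min t 1" for h
  proof -
    define k where "k = \<bar>h\<bar>"
    have k: "0 < k" using h by (simp add: k_def)
    define r where "r = (1 / k) *\<^sub>R (U k f - f) - g"
    have rin: "r \<in> L2_on \<Omega>" unfolding r_def using k f by (intro L2_on_diff quotient_in) auto
    have Ur: "U s (k *\<^sub>R r) = U (s + k) f - U s f - k *\<^sub>R U s g" if "0 \<le> s" for s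
    proof -
      have "k *\<^sub>R r = (U k f - f) - k *\<^sub>R g" using k by (simp add: r_def scaleR_diff_right)
      then show ?thesis
        using that k f by (simp add: U_diff U_scaleR L2_on_diff L2_on_scaleR semigroup(1,6))
    qed
    have nr: "norm (U s (k *\<^sub>R r)) \<le> k * (M * e h)" if "s \<in> {0..t + 1}" for s
      using M[OF that L2_on_scaleR[OF rin, of k]] k by (simp add: e_def r_def k_def mult_ac)
    have "norm (U (t + h) f - U t f - h *\<^sub>R U t g) \<le> k * (M * e h + norm (U (t + h) g - U t g))"
    proof (cases "0 < h")
      case True
      then have "norm (U (t + h) f - U t f - h *\<^sub>R U t g) \<le> k * (M * e h)"
        using Ur[of t] nr[of t] t by (simp add: k_def)
      also have "\<dots> \<le> k * (M * e h + norm (U (t + h) g - U t g))" using k by (intro mult_left_mono) auto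
      finally show ?thesis .
    next
      case False
      then have kh: "k = - h" "0 \<le> t + h" "t + h \<le> t + 1" using h by (auto simp: k_def)
      have "U (t + h) f - U t f - h *\<^sub>R U t g = - U (t + h) (k *\<^sub>R r) - k *\<^sub>R (U (t + h) g - U t g)"
        using Ur[of "t + h"] kh by (simp add: algebra_simps)
      also have "norm \<dots> \<le> k * (M * e h) + k * norm (U (t + h) g - U t g)"
        using nr[of "t + h"] kh k by (intro norm_triangle_le_diff add_mono) auto
      finally show ?thesis by (simp add: algebra_simps)
    qed
    then show ?thesis using k h by (simp add: k_def divide_le_eq mult.commute)
  qed
  have "((\<lambda>h. norm (U (t + h) f - U t f - h *\<^sub>R U t g) / norm h) \<longlongrightarrow> 0) (at 0)"
  proof (rule tendsto_sandwich[OF _ _ tendsto_const])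
    show "\<forall>\<^sub>F h in at 0. norm (U (t + h) f - U t f - h *\<^sub>R U t g) / norm h
        \<le> M * e h + norm (U (t + h) g - U t g)"
      unfolding eventually_at using t by (intro exI[of _ "min t 1"]) (auto intro!: bound)
    show "((\<lambda>h. M * e h + norm (U (t + h) g - U t g)) \<longlongrightarrow> 0) (at 0)" using b by simp
  qed auto
  then show ?thesis
    by (simp add: has_vector_derivative_def has_derivative_at bounded_linear_scaleR_left)
qed

end

text \<open>An energy estimate: the difference \<open>w\<close> of two orbits starting in the domain
  solves the evolution equation with initial value 0, and dissipativity makes exp(-2cs) times its
  squared norm nonincreasing. Density of the domain and boundedness of the operators do the
  rest.\<close>

theorem generator_determines_semigroup:
  fixes \<Omega> :: "'a::euclidean_space set"
  assumes \<Omega>: "\<Omega> \<in> sets lebesgue"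
    and U: "C0_semigroup_on (L2_on \<Omega>) U" and W: "C0_semigroup_on (L2_on \<Omega>) W"
    and gen: "generator (L2_on \<Omega>) W = generator (L2_on \<Omega>) U"
    and diss: "\<And>f g. (f, g) \<in> generator (L2_on \<Omega>) U \<Longrightarrow> inner g f \<le> c * (norm f)\<^sup>2"
    and dense: "L2_on \<Omega> \<subseteq> closure (fst ` generator (L2_on \<Omega>) U)"
    and t: "0 \<le> t" and f: "f \<in> L2_on \<Omega>"
  shows "W t f = U t f"
proof -
  interpret U: L2_semigroup \<Omega> U by unfold_locales (rule \<Omega> U)+
  interpret W: L2_semigroup \<Omega> W by unfold_locales (rule \<Omega> W)+
  have dom: "W t f = U t f" if fg: "(f, g) \<in> generator (L2_on \<Omega>) U" for f g
  proof -
    have f: "f \<in> L2_on \<Omega>" using U.generator_in[OF fg] by blast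
    define w where "w s = U s f - W s f" for s
    define w' where "w' s = U s g - W s g" for s
    define q where "q s = exp (- 2 * c * s) * inner (w s) (w s)" for s
    have ww: "(w s, w' s) \<in> generator (L2_on \<Omega>) U" if "0 \<le> s" for s
      unfolding w_def w'_def using that fg gen W.generator_invariant
      by (intro U.generator_diff U.generator_invariant) auto
    have dw: "(w has_vector_derivative w' s) (at s)" if "0 < s" for s
      unfolding w_def[abs_def] w'_def using that fg gen
      by (intro has_vector_derivative_diff U.U_has_vector_derivative W.U_has_vector_derivative) auto
    have "q 0 \<ge> q t"
    proof (rule DERIV_nonpos_imp_decreasing_open[OF t])
      fix s assume s: "0 < s" "s < t"
      have "(w has_derivative (\<lambda>h. h *\<^sub>R w' s)) (at s)" using dw[OF s(1)] by (simp add: has_vector_derivative_def)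
      from has_derivative_inner[OF this this]
      have "((\<lambda>s. inner (w s) (w s)) has_real_derivative 2 * inner (w' s) (w s)) (at s)"
        by (simp add: has_field_derivative_def inner_commute algebra_simps mult_commute_abs)
      then have "(q has_real_derivative exp (- 2 * c * s) * (2 * inner (w' s) (w s))
          + exp (- 2 * c * s) * (- 2 * c) * inner (w s) (w s)) (at s)"
        unfolding q_def[abs_def] by (auto intro!: derivative_eq_intros)
      moreover have "exp (- 2 * c * s) * (2 * inner (w' s) (w s))
          + exp (- 2 * c * s) * (- 2 * c) * inner (w s) (w s)
          = 2 * exp (- 2 * c * s) * (inner (w' s) (w s) - c * (norm (w s))\<^sup>2)"
        by (simp add: power2_norm_eq_inner algebra_simps)
      moreover have "2 * exp (- 2 * c * s) * (inner (w' s) (w s) - c * (norm (w s))\<^sup>2) \<le> 0"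
        using diss[OF ww, of s] s by (intro mult_nonneg_nonpos) auto
      ultimately show "\<exists>y. DERIV q s :> y \<and> y \<le> 0" by metis
    next
      show "continuous_on {0..t} q"
        unfolding q_def w_def by (intro continuous_intros U.U_continuous W.U_continuous f)
    qed
    moreover have "q 0 = 0" by (simp add: q_def w_def U.semigroup(5) W.semigroup(5) f)
    ultimately have "inner (w t) (w t) \<le> 0" by (simp add: q_def mult_le_0_iff)
    then have "w t = 0" by (metis inner_eq_zero_iff inner_ge_zero order_antisym)
    then show ?thesis by (simp add: w_def)
  qed
  \<comment> \<open>Orbits from the domain agree already; an arbitrary initial value is a limit of
    such ones.\<close>
  obtain p where p: "\<And>n. p n \<in> fst ` generator (L2_on \<Omega>) U" "p \<longlonglongrightarrow> f"
    using subsetD[OF dense f] unfolding closure_sequential by blast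
  have pin: "p n \<in> L2_on \<Omega>" for n using p(1)[of n] U.generator_in by auto
  have "(\<lambda>n. U t (p n)) \<longlonglongrightarrow> U t f" "(\<lambda>n. W t (p n)) \<longlonglongrightarrow> W t f"
    by (intro U.U_tendsto W.U_tendsto t p f always_eventually allI pin)+
  moreover have "W t (p n) = U t (p n)" for n using p(1)[of n] dom by auto
  ultimately show ?thesis by (simp add: LIMSEQ_unique)
qed

section \<open>Schroedinger operators\<close>

lemma form_domain_in_H1: "f \<in> form_domain bc \<Omega> \<Longrightarrow> f \<in> H1 \<Omega>"
  by (cases bc) (auto simp: H1_0_def)

lemma test_function_in_form_domain:
  assumes "open \<Omega>" "test_function \<Omega> \<phi>" shows "abs_L2 \<phi> \<in> form_domain bc \<Omega>"
proof (cases bc)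
  case Neumann
  then show ?thesis
    using assms test_function_has_weak_derivative[OF assms(2)]
    by (auto simp: H1_def test_function_in_L2_on)
next
  case Dirichlet
  have "H1_limit_of_test_functions \<Omega> (abs_L2 \<phi>) (\<lambda>b. abs_L2 (partial b \<phi>))"
    unfolding H1_limit_of_test_functions_def using assms(2) by (intro allI impI exI[of _ \<phi>]) auto
  then show ?thesis using Dirichlet H1_0I[OF assms(1)] by simp
qed

text \<open>Makes the operator densely defined. The value \<open>h\<close> is the classical one,
  potential term minus Laplacian, because the weak derivatives of \<open>g\<close> may be tested
  against the partial derivatives of \<phi>, whichever boundary condition \<open>g\<close>
  satisfies.\<close>

lemma test_function_in_domain:
  fixes \<Omega> :: "'a::euclidean_space set"
  assumes \<Omega>: "open \<Omega>" and V: "V \<in> Linf \<Omega>" and \<phi>: "test_function \<Omega> \<phi>"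
  shows "\<exists>h. (abs_L2 \<phi>, h) \<in> schroedinger_operator bc \<Omega> V"
proof -
  have \<Omega>s: "\<Omega> \<in> sets lebesgue" using \<Omega> by auto
  define h where "h = mult_on \<Omega> V (abs_L2 \<phi>) - abs_L2 (\<lambda>x. \<Sum>b\<in>Basis. partial b (partial b \<phi>) x)"
  have tt: "test_function \<Omega> (partial b (partial b \<phi>))" if "b \<in> Basis" for b
    by (intro test_function_partial \<phi> that)
  have sum: "test_function \<Omega> (\<lambda>x. \<Sum>b\<in>S. partial b (partial b \<phi>) x) \<and>
     abs_L2 (\<lambda>x. \<Sum>b\<in>S. partial b (partial b \<phi>) x) = (\<Sum>b\<in>S. abs_L2 (partial b (partial b \<phi>)))"
    if "finite S" "S \<subseteq> Basis" for S
    using that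
  proof (induction S)
    case empty
    have "test_function \<Omega> (\<lambda>x. 0)" by (rule test_functionI[of _ "{}"]) (auto intro: smooth_const)
    then show ?case by (simp flip: zero_L2_def)
  next
    case (insert b S)
    then show ?case
      using tt[of b] by (auto simp: abs_L2_add[symmetric] test_function_square_integrable intro: test_function_add)
  qed
  have h: "h \<in> L2_on \<Omega>"
    unfolding h_def using sum[of Basis]
    by (intro L2_on_diff mult_on_in_L2_on \<Omega>s V test_function_in_L2_on) auto
  have "schroedinger_form \<Omega> V (abs_L2 \<phi>) g = cinner h g" if g: "g \<in> form_domain bc \<Omega>" for g
  proof -
    have "cinner (weak_derivative \<Omega> b (abs_L2 \<phi>)) (weak_derivative \<Omega> b g)
        = - cinner (abs_L2 (partial b (partial b \<phi>))) g" if b: "b \<in> Basis" for b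
    proof -
      have "weak_derivative \<Omega> b (abs_L2 \<phi>) = abs_L2 (partial b \<phi>)"
        by (intro weak_derivative_eqI \<Omega> test_function_has_weak_derivative \<phi> b)
      moreover have "has_weak_derivative \<Omega> b g (weak_derivative \<Omega> b g)"
        by (intro H1_has_weak_derivative \<Omega> b form_domain_in_H1[OF g])
      then have "cinner g (abs_L2 (partial b (partial b \<phi>)))
          = - cinner (weak_derivative \<Omega> b g) (abs_L2 (partial b \<phi>))"
        using test_function_partial[OF \<phi> b] by (simp add: has_weak_derivative_def)
      ultimately show ?thesis
        by (metis add.inverse_inverse cinner_commute complex_cnj_minus)
    qed
    then show ?thesis
      using sum[of Basis]
      by (simp add: schroedinger_form_def h_def cinner_diff_left cinner_sum_left sum_negf)
  qed
  then show ?thesis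
    using h test_function_in_form_domain[OF \<Omega> \<phi>] by (auto simp: schroedinger_operator_def)
qed

text \<open>The gradient part of the form is nonnegative, so only the bounded potential can make the
  form negative. For the generator, which is minus the operator, this is dissipativity.\<close>

lemma schroedinger_operator_lower_bound:
  assumes \<Omega>: "\<Omega> \<in> sets lebesgue" and V: "V \<in> Linf \<Omega>"
  shows "\<exists>c. \<forall>(f, h) \<in> schroedinger_operator bc \<Omega> V. - inner h f \<le> c * (norm f)\<^sup>2"
proof -
  obtain C where C: "0 \<le> C" "\<And>f. norm (mult_on \<Omega> V f) \<le> C * norm f"
    using norm_mult_on_bounded[OF \<Omega> V] by blast
  have "- inner h f \<le> C * (norm f)\<^sup>2" if "(f, h) \<in> schroedinger_operator bc \<Omega> V" for f h
  proof -
    have "inner h f = Re (schroedinger_form \<Omega> V f f)"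
      using that by (auto simp: schroedinger_operator_def inner_L2_def)
    also have "\<dots> = (\<Sum>b\<in>Basis. (norm (weak_derivative \<Omega> b f))\<^sup>2) + Re (cinner (mult_on \<Omega> V f) f)"
      by (simp add: schroedinger_form_def norm_eq_cinner)
    also have "\<dots> \<ge> - (C * (norm f)\<^sup>2)"
    proof -
      have "norm (cinner (mult_on \<Omega> V f) f) \<le> C * norm f * norm f"
        by (rule order_trans[OF cinner_bound mult_right_mono[OF C(2)]]) simp
      then have "- (C * norm f * norm f) \<le> Re (cinner (mult_on \<Omega> V f) f)"
        using abs_Re_le_cmod[of "cinner (mult_on \<Omega> V f) f"] by linarith
      moreover have "0 \<le> (\<Sum>b\<in>Basis. (norm (weak_derivative \<Omega> b f))\<^sup>2)" by (intro sum_nonneg) simp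
      ultimately show ?thesis by (simp add: power2_eq_square mult.assoc)
    qed
    finally show ?thesis by simp
  qed
  then show ?thesis by blast
qed

text \<open>Used in two ways: to identify the semigroup selected in \<open>exp_semigroup\<close>
  with an explicit one, and to turn symmetries of the operator into symmetries of its
  semigroup.\<close>

theorem schroedinger_semigroup_unique:
  assumes \<Omega>: "open \<Omega>" and V: "V \<in> Linf \<Omega>"
    and U: "is_exp_semigroup (L2_on \<Omega>) (schroedinger_operator bc \<Omega> V) U"
    and W: "is_exp_semigroup (L2_on \<Omega>) (schroedinger_operator bc \<Omega> V) W"
    and t: "0 \<le> t" and f: "f \<in> L2_on \<Omega>"
  shows "W t f = U t f"
proof -
  have \<Omega>s: "\<Omega> \<in> sets lebesgue" using \<Omega> by auto
  obtain c where c: "\<And>f h. (f, h) \<in> schroedinger_operator bc \<Omega> V \<Longrightarrow> - inner h f \<le> c * (norm f)\<^sup>2"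
    using schroedinger_operator_lower_bound[OF \<Omega>s V] by blast
  have gU: "generator (L2_on \<Omega>) U = {(f, - h) |f h. (f, h) \<in> schroedinger_operator bc \<Omega> V}"
    using U by (simp add: is_exp_semigroup_def)
  show ?thesis
  proof (rule generator_determines_semigroup[OF \<Omega>s _ _ _ _ _ t f])
    show "C0_semigroup_on (L2_on \<Omega>) U" "C0_semigroup_on (L2_on \<Omega>) W"
      "generator (L2_on \<Omega>) W = generator (L2_on \<Omega>) U"
      using U W by (auto simp: is_exp_semigroup_def)
    show "inner g f \<le> c * (norm f)\<^sup>2" if "(f, g) \<in> generator (L2_on \<Omega>) U" for f g
      using that c unfolding gU by auto
    show "L2_on \<Omega> \<subseteq> closure (fst ` generator (L2_on \<Omega>) U)"
    proof
      fix f assume "f \<in> L2_on \<Omega>"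
      from test_functions_dense[OF \<Omega> this]
      have "f \<in> closure {abs_L2 \<phi> |\<phi>. test_function \<Omega> \<phi>}" .
      also have "\<dots> \<subseteq> closure (fst ` generator (L2_on \<Omega>) U)"
        unfolding gU using test_function_in_domain[OF \<Omega> V, of _ bc]
        by (intro closure_mono) (force simp: image_iff)
      finally show "f \<in> closure (fst ` generator (L2_on \<Omega>) U)" .
    qed
  qed
qed

section \<open>Reflection in a hyperplane\<close>

text \<open>The reflection in the hyperplane orthogonal to \<open>n\<close> is \<open>x \<mapsto> x - (x \<bullet> n) n\<close> because of the
  normalization \<open>|n|\<^sup>2 = 2\<close>; it permutes the standard basis for \<open>n = e\<^sub>i - e\<^sub>j\<close>.\<close>

locale hyperplane_reflection =
  fixes n :: "'a::euclidean_space" and Q :: "'a set"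
  assumes norm_n: "n \<bullet> n = 2"
    and permutes_Basis: "\<And>b. b \<in> Basis \<Longrightarrow> b - (b \<bullet> n) *\<^sub>R n \<in> Basis"
    and open_Q: "open Q"
    and reflected_Q: "\<And>x. x \<in> Q \<Longrightarrow> x - (x \<bullet> n) *\<^sub>R n \<in> Q"
begin

definition \<sigma> :: "'a \<Rightarrow> 'a" where "\<sigma> x = x - (x \<bullet> n) *\<^sub>R n"

definition T :: "'a set" where "T = {x \<in> Q. 0 < x \<bullet> n}"

section \<open>The reflection as a map of points, and the invariance of Lebesgue measure\<close>

lemma linear_\<sigma>: "linear \<sigma>"
  by (rule linearI) (simp_all add: \<sigma>_def algebra_simps)

lemma \<sigma>_n [simp]: "\<sigma> x \<bullet> n = - (x \<bullet> n)"
  by (simp add: \<sigma>_def inner_diff_left norm_n)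

lemma \<sigma>_\<sigma> [simp]: "\<sigma> (\<sigma> x) = x"
proof -
  have "\<sigma> (\<sigma> x) = \<sigma> x - (\<sigma> x \<bullet> n) *\<^sub>R n" by (simp only: \<sigma>_def[of "\<sigma> x"])
  also have "\<dots> = \<sigma> x + (x \<bullet> n) *\<^sub>R n" by (simp only: \<sigma>_n scaleR_minus_left diff_minus_eq_add)
  finally show ?thesis by (simp add: \<sigma>_def[of x])
qed

lemma inner_\<sigma>: "\<sigma> x \<bullet> y = x \<bullet> \<sigma> y"
  by (simp add: \<sigma>_def inner_diff_left inner_diff_right inner_commute)

lemma \<sigma>_Basis: "b \<in> Basis \<Longrightarrow> \<sigma> b \<in> Basis"
  using permutes_Basis by (simp add: \<sigma>_def)

lemma \<sigma>_Q [simp]: "\<sigma> x \<in> Q \<longleftrightarrow> x \<in> Q"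
proof -
  have "\<sigma> y \<in> Q" if "y \<in> Q" for y using reflected_Q[OF that] by (simp add: \<sigma>_def)
  from this[of x] this[of "\<sigma> x"] show ?thesis by auto
qed

lemma bij_betw_\<sigma>_Basis: "bij_betw \<sigma> Basis Basis"
  by (rule bij_betwI[of _ _ _ \<sigma>]) (auto intro: \<sigma>_Basis)

lemma sum_Basis_\<sigma>: "(\<Sum>b\<in>Basis. f (\<sigma> b)) = (\<Sum>b\<in>Basis. f b)"
  by (rule sum.reindex_bij_betw[OF bij_betw_\<sigma>_Basis])

lemma \<sigma>_minus: "x - \<sigma> x = (x \<bullet> n) *\<^sub>R n"
  by (simp add: \<sigma>_def)

lemma open_T: "open T"
proof -
  have "T = Q \<inter> {x. 0 < x \<bullet> n}" by (auto simp: T_def)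
  then show ?thesis by (auto intro!: open_Int open_Q open_Collect_less continuous_intros)
qed

lemma T_sub_Q: "T \<subseteq> Q"
  by (auto simp: T_def)

lemma Q_sets [measurable]: "Q \<in> sets lebesgue" and T_sets [measurable]: "T \<in> sets lebesgue"
  using open_Q open_T by auto

lemma \<sigma>_borel [measurable]: "\<sigma> \<in> borel_measurable borel"
  by (intro borel_measurable_continuous_onI linear_continuous_on) (simp add: linear_\<sigma> linear_conv_bounded_linear[symmetric])

text \<open>As \<sigma> permutes the basis, the preimage of a box is a box with the same edge
  lengths in another order, and Lebesgue measure is determined by its values on boxes.\<close>

lemma distr_lborel_\<sigma>: "distr lborel borel \<sigma> = lborel"
proof (rule lborel_eqI[symmetric])
  fix l u :: 'a assume lu: "\<And>b. b \<in> Basis \<Longrightarrow> l \<bullet> b \<le> u \<bullet> b"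
  have "\<sigma> -` box l u = box (\<sigma> l) (\<sigma> u)"
  proof (intro set_eqI)
    fix x
    have "(\<forall>b\<in>Basis. l \<bullet> b < \<sigma> x \<bullet> b \<and> \<sigma> x \<bullet> b < u \<bullet> b) \<longleftrightarrow>
        (\<forall>b\<in>\<sigma> ` Basis. l \<bullet> b < \<sigma> x \<bullet> b \<and> \<sigma> x \<bullet> b < u \<bullet> b)"
      using bij_betw_\<sigma>_Basis by (simp add: bij_betw_def)
    then show "x \<in> \<sigma> -` box l u \<longleftrightarrow> x \<in> box (\<sigma> l) (\<sigma> u)"
      by (simp add: box_def inner_\<sigma>)
  qed
  then have "emeasure (distr lborel borel \<sigma>) (box l u) = emeasure lborel (box (\<sigma> l) (\<sigma> u))"
    by (simp add: emeasure_distr)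
  also have "\<dots> = (\<Prod>b\<in>Basis. (\<sigma> u - \<sigma> l) \<bullet> b)"
    using lu \<sigma>_Basis by (intro emeasure_lborel_box) (simp add: inner_\<sigma>)
  also have "(\<Prod>b\<in>Basis. (\<sigma> u - \<sigma> l) \<bullet> b) = (\<Prod>b\<in>Basis. (u - l) \<bullet> \<sigma> b)"
    by (simp add: inner_diff_left inner_\<sigma>)
  also have "\<dots> = (\<Prod>b\<in>Basis. (u - l) \<bullet> b)"
    by (rule prod.reindex_bij_betw[OF bij_betw_\<sigma>_Basis])
  finally show "emeasure (distr lborel borel \<sigma>) (box l u) = ennreal (\<Prod>b\<in>Basis. (u - l) \<bullet> b)" .
qed simp

lemma \<sigma>_lebesgue [measurable]: "\<sigma> \<in> lebesgue \<rightarrow>\<^sub>M lebesgue"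
  and distr_lebesgue_\<sigma>: "distr lebesgue lebesgue \<sigma> = lebesgue"
proof -
  have d: "distr lborel lborel \<sigma> = lborel"
    using distr_lborel_\<sigma> by (simp cong: distr_cong)
  have m: "\<sigma> \<in> lborel \<rightarrow>\<^sub>M lborel" by simp
  have e: "distr lebesgue lborel \<sigma> = lborel" using distr_completion[OF m] d by simp
  show "\<sigma> \<in> lebesgue \<rightarrow>\<^sub>M lebesgue"
    by (rule completion.measurable_completion2) (use m e in \<open>auto intro: measurable_completion\<close>)
  have "completion (distr lebesgue lborel \<sigma>) = distr lebesgue lebesgue \<sigma>"
    by (rule completion.completion_distr_eq) (use m e in \<open>auto intro: measurable_completion\<close>)
  then show "distr lebesgue lebesgue \<sigma> = lebesgue" using e by simp
qed

lemma AE_\<sigma>: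
  assumes "AE x in lebesgue. P x" shows "AE x in lebesgue. P (\<sigma> x)"
  by (rule AE_distrD[OF \<sigma>_lebesgue]) (simp only: distr_lebesgue_\<sigma> assms)

lemma square_integrable_\<sigma>:
  assumes "square_integrable u" shows "square_integrable (\<lambda>x. u (\<sigma> x))"
proof -
  have um [measurable]: "u \<in> borel_measurable lebesgue" by (rule square_integrable_measurable[OF assms])
  have "integrable (distr lebesgue lebesgue \<sigma>) (\<lambda>x. (norm (u x))\<^sup>2)"
    using assms by (simp add: distr_lebesgue_\<sigma> square_integrable_def)
  then have "integrable lebesgue (\<lambda>x. (norm (u (\<sigma> x)))\<^sup>2)"
    by (subst (asm) integrable_distr_eq) auto
  moreover have "(\<lambda>x. u (\<sigma> x)) \<in> borel_measurable lebesgue"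
    by (rule measurable_compose[OF \<sigma>_lebesgue um])
  ultimately show ?thesis by (simp add: square_integrable_def)
qed

section \<open>The reflection as an operator on square-integrable classes\<close>

definition reflect :: "'a L2 \<Rightarrow> 'a L2" where
  "reflect f = abs_L2 (\<lambda>x. rep_L2 f (\<sigma> x))"

lemma rep_refl: "AE x in lebesgue. rep_L2 (reflect f) x = rep_L2 f (\<sigma> x)"
  unfolding reflect_def by (intro rep_abs_L2 square_integrable_\<sigma> square_integrable_rep)

lemma refl_abs_L2:
  assumes "square_integrable u" shows "reflect (abs_L2 u) = abs_L2 (\<lambda>x. u (\<sigma> x))"
  unfolding reflect_def
  by (intro abs_L2_eqI square_integrable_\<sigma> square_integrable_rep assms AE_\<sigma>[OF rep_abs_L2[OF assms]])

lemma refl_add: "reflect (f + g) = reflect f + reflect g"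
  unfolding L2_eq_iff
  using rep_refl[of "f + g"] rep_refl[of f] rep_refl[of g] AE_\<sigma>[OF rep_L2_add[of f g]]
    rep_L2_add[of "reflect f" "reflect g"]
  by eventually_elim simp

lemma refl_scaleC: "reflect (c *\<^sub>C f) = c *\<^sub>C reflect f"
  unfolding L2_eq_iff
  using rep_refl[of "c *\<^sub>C f"] rep_refl[of f] AE_\<sigma>[OF rep_L2_scaleC[of c f]] rep_L2_scaleC[of c "reflect f"]
  by eventually_elim simp

lemma refl_refl [simp]: "reflect (reflect f) = f"
  unfolding L2_eq_iff using rep_refl[of "reflect f"] AE_\<sigma>[OF rep_refl[of f]]
  by eventually_elim simp

lemma refl_scaleR: "reflect (r *\<^sub>R f) = r *\<^sub>R reflect f"
  by (simp add: scaleR_L2_def refl_scaleC)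

lemma refl_minus: "reflect (- f) = - reflect f"
  by (simp add: uminus_L2_def refl_scaleC)

lemma refl_diff: "reflect (f - g) = reflect f - reflect g"
  by (simp only: diff_conv_add_uminus refl_add refl_minus)

lemma cinner_refl: "cinner (reflect f) g = cinner f (reflect g)"
proof -
  have "cinner (reflect f) g = (\<integral>x. rep_L2 f (\<sigma> x) * cnj (rep_L2 (reflect g) (\<sigma> x)) \<partial>lebesgue)"
    unfolding cinner_rep
  proof (rule integral_cong_AE)
    show "AE x in lebesgue. rep_L2 (reflect f) x * cnj (rep_L2 g x) = rep_L2 f (\<sigma> x) * cnj (rep_L2 (reflect g) (\<sigma> x))"
      using rep_refl[of f] AE_\<sigma>[OF rep_refl[of g]] by eventually_elim simp
  qed (auto intro!: borel_measurable_integrable integrable_mult_cnj square_integrable_\<sigma>)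
  also have "\<dots> = (\<integral>x. rep_L2 f x * cnj (rep_L2 (reflect g) x) \<partial>distr lebesgue lebesgue \<sigma>)"
    by (rule integral_distr[symmetric])
       (auto intro!: borel_measurable_integrable integrable_mult_cnj)
  finally show ?thesis by (simp add: distr_lebesgue_\<sigma> cinner_rep)
qed

lemma norm_refl [simp]: "norm (reflect f) = norm f"
proof -
  have "(norm (reflect f))\<^sup>2 = (norm f)\<^sup>2" by (simp add: norm_eq_cinner cinner_refl)
  then show ?thesis by simp
qed

lemma refl_in_L2_on_Q: "f \<in> L2_on Q \<Longrightarrow> reflect f \<in> L2_on Q"
  unfolding L2_on_iff using rep_refl[of f] AE_\<sigma>[of "\<lambda>x. x \<notin> Q \<longrightarrow> rep_L2 f x = 0"]
  by (auto elim: eventually_elim2)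

lemma chi_T_refl:
  assumes "f \<in> L2_on T" shows "chi T (reflect f) = 0"
  unfolding L2_eq_iff
  using rep_chi[OF T_sets, of "reflect f"] rep_refl[of f] AE_\<sigma>[OF assms[unfolded L2_on_iff]] rep_L2_zero
proof eventually_elim
  case (elim x)
  then show ?case by (auto simp: T_def)
qed

lemma AE_off_hyperplane: "AE x in lebesgue. x \<bullet> n \<noteq> 0"
proof -
  have "n \<noteq> 0" using norm_n by auto
  then have "negligible {x. n \<bullet> x = 0}" by (intro negligible_hyperplane) auto
  then show ?thesis
    by (auto simp: negligible_iff_null_sets inner_commute dest!: AE_not_in)
qed

text \<open>Off the hyperplane, which is a null set, a point of \<open>Q\<close> lies in exactly one
  of \<open>T\<close> and its mirror image. The two summands are the restrictions of
  \<open>F\<close> to these halves.\<close>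

lemma decompose_Q:
  assumes "F \<in> L2_on Q" shows "chi T F + reflect (chi T (reflect F)) = F"
  unfolding L2_eq_iff
  using rep_L2_add[of "chi T F" "reflect (chi T (reflect F))"] rep_chi[OF T_sets, of F]
    rep_refl[of "chi T (reflect F)"] AE_\<sigma>[OF rep_chi[OF T_sets, of "reflect F"]] AE_\<sigma>[OF rep_refl[of F]]
    assms[unfolded L2_on_iff] AE_off_hyperplane
proof eventually_elim
  case (elim x)
  then show ?case by (auto simp: T_def)
qed

section \<open>Reflection and cutoff of test functions\<close>

lemma smooth_\<sigma>: "smooth \<phi> \<Longrightarrow> smooth (\<lambda>x. \<phi> (\<sigma> x))"
  unfolding smooth_def using C_k_compose_linear[OF linear_\<sigma> \<sigma>_Basis] by blast

lemma test_function_\<sigma>: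
  assumes "test_function Q \<phi>" shows "test_function Q (\<lambda>x. \<phi> (\<sigma> x))"
proof -
  obtain K where K: "compact K" "K \<subseteq> Q" "\<And>x. x \<notin> K \<Longrightarrow> \<phi> x = 0"
    by (rule test_functionE[OF assms]) blast
  show ?thesis
  proof (rule test_functionI[of _ "\<sigma> ` K"])
    show "compact (\<sigma> ` K)"
      by (intro compact_continuous_image K linear_continuous_on)
         (simp add: linear_\<sigma> linear_conv_bounded_linear[symmetric])
    show "\<sigma> ` K \<subseteq> Q" using K(2) by auto
    show "\<phi> (\<sigma> x) = 0" if "x \<notin> \<sigma> ` K" for x
      using that K(3)[of "\<sigma> x"] \<sigma>_\<sigma>[of x] by (metis imageI)
  qed (intro smooth_\<sigma> test_function_smooth[OF assms])
qed

lemma partial_\<sigma>: "smooth \<phi> \<Longrightarrow> partial b (\<lambda>x. \<phi> (\<sigma> x)) = (\<lambda>x. partial (\<sigma> b) \<phi> (\<sigma> x))"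
  by (rule partial_compose_linear[OF _ linear_\<sigma>])

lemma \<sigma>_has_derivative: "(\<sigma> has_derivative \<sigma>) (at x)"
  by (simp add: bounded_linear_imp_has_derivative linear_conv_bounded_linear[symmetric] linear_\<sigma>)

lemma flat_0_has_derivative: "(flat 0 has_real_derivative flat 2 s) (at s)"
  using flat_has_derivative[of 0 s] by (simp add: numeral_2_eq_2)

lemma abs_L2_diff_refl:
  "square_integrable u \<Longrightarrow> square_integrable v \<Longrightarrow>
    abs_L2 (\<lambda>x. u x - v (\<sigma> x)) = abs_L2 u - reflect (abs_L2 v)"
  by (simp add: refl_abs_L2 abs_L2_diff square_integrable_\<sigma>)

text \<open>For positive k it vanishes wherever \<open>x \<bullet> n\<close> is at most 1/k, and it
  tends to 1 on \<open>T\<close> as k grows. Multiplication by it turns test functions on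
  \<open>Q\<close> into test functions on \<open>T\<close>.\<close>

definition cutoff :: "nat \<Rightarrow> 'a \<Rightarrow> real" where
  "cutoff k x = flat 0 (real k * (x \<bullet> n) - 1)"

lemma smooth_cutoff: "smooth (\<lambda>x. complex_of_real (cutoff k x))"
  unfolding cutoff_def
  by (intro smooth_elementary elementary.flat elementary_diff elementary.mult elementary.const elementary.inner)

lemma partial_cutoff:
  "partial b (\<lambda>x. complex_of_real (cutoff k x))
    = (\<lambda>x. of_real (real k * (b \<bullet> n) * flat 2 (real k * (x \<bullet> n) - 1)))"
proof (intro ext partial_eqI)
  fix x
  have "((\<lambda>x. real k * (x \<bullet> n) - 1) has_derivative (\<lambda>h. real k * (h \<bullet> n))) (at x)"
    by (auto intro!: derivative_eq_intros)
  from has_derivative_compose[OF this flat_0_has_derivative[unfolded has_field_derivative_def]]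
  have "(cutoff k has_derivative (\<lambda>h. real k * (h \<bullet> n) * flat 2 (real k * (x \<bullet> n) - 1))) (at x)"
    unfolding cutoff_def[abs_def] by (simp add: mult.commute)
  then show "((\<lambda>x. complex_of_real (cutoff k x)) has_derivative
      (\<lambda>h. of_real (real k * (h \<bullet> n) * flat 2 (real k * (x \<bullet> n) - 1)))) (at x)"
    by (rule has_derivative_of_real)
qed

lemma test_function_cutoff:
  assumes "test_function Q \<phi>" shows "test_function T (\<lambda>x. of_real (cutoff k x) * \<phi> x)"
proof -
  obtain K where K: "compact K" "K \<subseteq> Q" "\<And>x. x \<notin> K \<Longrightarrow> \<phi> x = 0"
    by (rule test_functionE[OF assms]) blast
  show ?thesis
  proof (rule test_functionI[of _ "K \<inter> {x. 1 \<le> real k * (x \<bullet> n)}"])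
    show "compact (K \<inter> {x. 1 \<le> real k * (x \<bullet> n)})"
      by (intro compact_Int_closed K closed_Collect_le continuous_intros)
    have "0 < x \<bullet> n" if "1 \<le> real k * (x \<bullet> n)" for x
    proof -
      have "0 < real k * (x \<bullet> n)" using that by simp
      then show ?thesis by (simp add: zero_less_mult_iff)
    qed
    then show "K \<inter> {x. 1 \<le> real k * (x \<bullet> n)} \<subseteq> T" using K(2) by (auto simp: T_def)
    show "of_real (cutoff k x) * \<phi> x = 0" if "x \<notin> K \<inter> {x. 1 \<le> real k * (x \<bullet> n)}" for x
      using that K(3)[of x] by (auto simp: cutoff_def flat_def)
  qed (intro smooth_mult smooth_cutoff test_function_smooth[OF assms])
qed

lemma cutoff_tendsto:
  assumes u: "square_integrable u" "\<And>x. x \<notin> Q \<Longrightarrow> u x = 0"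
  shows "(\<lambda>k. abs_L2 (\<lambda>x. of_real (cutoff k x) * u x)) \<longlonglongrightarrow> chi T (abs_L2 u)"
  unfolding chi_abs_L2[OF T_sets u(1)]
proof (rule tendsto_abs_L2(2)[OF u(1)])
  note [measurable] = square_integrable_measurable[OF u(1)] smooth_measurable[OF smooth_cutoff]
  show "(\<lambda>x. of_real (cutoff k x) * u x) \<in> borel_measurable lebesgue" for k by measurable
  show "(\<lambda>x. if x \<in> T then u x else 0) \<in> borel_measurable lebesgue"
    by (rule square_integrable_measurable[OF chi_abs_L2(2)[OF T_sets u(1)]])
  show "AE x in lebesgue. norm (of_real (cutoff k x) * u x) \<le> norm (u x)" for k
    by (rule AE_I2) (simp add: norm_mult cutoff_def flat_nonneg flat_0_le_1 mult_left_le_one_le)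
  show "AE x in lebesgue. (\<lambda>k. of_real (cutoff k x) * u x) \<longlonglongrightarrow> (if x \<in> T then u x else 0)"
  proof (rule AE_I2)
    fix x show "(\<lambda>k. of_real (cutoff k x) * u x) \<longlonglongrightarrow> (if x \<in> T then u x else 0)"
    proof (cases "0 < x \<bullet> n")
      case True
      then have "filterlim (\<lambda>k. real k * (x \<bullet> n) - 1) at_top sequentially" by real_asymp
      from filterlim_compose[OF flat_0_tendsto this]
      have "(\<lambda>k. complex_of_real (cutoff k x) * u x) \<longlonglongrightarrow> of_real 1 * u x"
        unfolding cutoff_def by (intro tendsto_mult tendsto_of_real tendsto_const)
      then show ?thesis using True u(2)[of x] by (auto simp: T_def)
    next
      case False
      have "cutoff k x = 0" for k
        using mult_nonneg_nonpos[of "real k" "x \<bullet> n"] False by (auto simp: cutoff_def flat_def)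
      then show ?thesis using False by (auto simp: T_def)
    qed
  qed
qed

text \<open>The derivative of the cutoff is of size \<open>k\<close> on a strip of width \<open>1/k\<close>; this is
  compensated by the vanishing of \<open>a\<close> on the hyperplane.\<close>

lemma cutoff_error_tendsto:
  assumes a: "test_function Q a" and C: "\<And>x. norm (a x) \<le> C * \<bar>x \<bullet> n\<bar>"
  shows "(\<lambda>k. abs_L2 (\<lambda>x. of_real (real k * c * flat 2 (real k * (x \<bullet> n) - 1)) * a x)) \<longlonglongrightarrow> 0"
proof -
  obtain K where K: "compact K" "K \<subseteq> Q" "\<And>x. x \<notin> K \<Longrightarrow> a x = 0"
    by (rule test_functionE[OF a]) blast
  let ?w = "\<lambda>x. complex_of_real (3 * C * \<bar>c\<bar>) * indicator K x"
  show ?thesis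
    unfolding zero_L2_def
  proof (rule tendsto_abs_L2(2))
    show "square_integrable ?w"
      using lmeasurable_compact[OF K(1)] by (intro square_integrable_indicator) (auto simp: fmeasurable_def)
    have "smooth (\<lambda>x. complex_of_real (real k * c * flat 2 (real k * (x \<bullet> n) - 1)))" for k
      by (intro smooth_elementary elementary.flat elementary_diff elementary.mult elementary.const elementary.inner)
    then show "(\<lambda>x. of_real (real k * c * flat 2 (real k * (x \<bullet> n) - 1)) * a x) \<in> borel_measurable lebesgue" for k
      by (intro smooth_measurable smooth_mult test_function_smooth[OF a])
    show "AE x in lebesgue. norm (of_real (real k * c * flat 2 (real k * (x \<bullet> n) - 1)) * a x) \<le> norm (?w x)" for k
    proof (rule AE_I2)
      fix x
      show "norm (of_real (real k * c * flat 2 (real k * (x \<bullet> n) - 1)) * a x) \<le> norm (?w x)"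
      proof (cases "x \<in> K \<and> 1 < real k * (x \<bullet> n)")
        case True
        define u where "u = real k * (x \<bullet> n) - 1"
        have u: "0 < u" using True by (simp add: u_def)
        have "0 < real k * (x \<bullet> n)" using True by linarith
        then have xn: "0 < x \<bullet> n" by (simp add: zero_less_mult_iff)
        have k: "real k * \<bar>x \<bullet> n\<bar> = u + 1"
          using xn by (simp add: u_def)
        \<comment> \<open>The origin of the constant 3: the product of k and the distance to the
          hyperplane is \<open>u + 1\<close>, and one power of \<open>u\<close> lowers the index of
          \<open>flat\<close>, which leaves the uniform bounds 1! and 2!.\<close>
        have "(u + 1) * flat 2 u = flat 1 u + flat 2 u"
          using u by (simp add: flat_def algebra_simps power2_eq_square)
        also have "\<dots> \<le> 3" using flat_bound[of 1 u 0] flat_bound[of 2 u 0] by (simp add: fact_2)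
        finally have 3: "(u + 1) * flat 2 u \<le> 3" .
        have "norm (of_real (real k * c * flat 2 u) * a x) = real k * \<bar>c\<bar> * flat 2 u * norm (a x)"
          by (simp add: norm_mult abs_mult flat_nonneg)
        also have "\<dots> \<le> real k * \<bar>c\<bar> * flat 2 u * (C * \<bar>x \<bullet> n\<bar>)"
          by (intro mult_left_mono C) (auto simp: flat_nonneg)
        also have "\<dots> = \<bar>c\<bar> * C * ((real k * \<bar>x \<bullet> n\<bar>) * flat 2 u)" by (simp add: mult_ac)
        also have "\<dots> = \<bar>c\<bar> * C * ((u + 1) * flat 2 u)" by (simp only: k)
        also have "\<dots> \<le> \<bar>c\<bar> * C * 3"
        proof (intro mult_left_mono 3 mult_nonneg_nonneg)
          have "0 \<le> C * \<bar>x \<bullet> n\<bar>" by (rule order_trans[OF norm_ge_zero C])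
          then show "0 \<le> C" using xn by (simp add: zero_le_mult_iff)
        qed auto
        also have "\<dots> \<le> norm (?w x)"
          using True by (auto simp: norm_mult abs_mult mult_ac intro!: mult_right_mono)
        finally show ?thesis by (simp add: u_def)
      next
        case False
        then show ?thesis using K(3)[of x] by (auto simp: flat_def)
      qed
    qed
    show "AE x in lebesgue. (\<lambda>k. of_real (real k * c * flat 2 (real k * (x \<bullet> n) - 1)) * a x) \<longlonglongrightarrow> 0"
    proof (rule AE_I2)
      fix x
      have "(\<lambda>k. real k * c * flat 2 (real k * (x \<bullet> n) - 1)) \<longlonglongrightarrow> 0"
      proof (cases "0 < x \<bullet> n")
        case True
        define s where "s = x \<bullet> n"
        have s: "0 < s" using True by (simp add: s_def)
        \<comment> \<open>At a fixed point of the half-space the factor k is harmless, because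
          \<open>flat 2\<close> is at most the inverse square of its argument. The vanishing of
          \<open>a\<close> on the hyperplane is needed for the majorant only.\<close>
        have "(\<lambda>k. real k * flat 2 (real k * s - 1)) \<longlonglongrightarrow> 0"
        proof (rule tendsto_sandwich[OF _ _ tendsto_const])
          show "(\<lambda>k. real k * inverse (real k * s - 1) ^ 2) \<longlonglongrightarrow> 0" using s by real_asymp
          show "\<forall>\<^sub>F k in sequentially. real k * flat 2 (real k * s - 1) \<le> real k * inverse (real k * s - 1) ^ 2"
            by (auto simp: flat_def mult_left_le intro!: always_eventually mult_left_mono)
        qed (auto simp: flat_nonneg)
        from tendsto_mult[OF this tendsto_const[of c]] show ?thesis by (simp add: s_def mult_ac)
      next
        case False
        have "flat 2 (real k * (x \<bullet> n) - 1) = 0" for k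
          using mult_nonneg_nonpos[of "real k" "x \<bullet> n"] False by (auto simp: flat_def)
        then show ?thesis by simp
      qed
      from tendsto_mult[OF tendsto_of_real[OF this] tendsto_const]
      show "(\<lambda>k. of_real (real k * c * flat 2 (real k * (x \<bullet> n) - 1)) * a x) \<longlonglongrightarrow> 0" by simp
    qed
  qed simp
qed

text \<open>A point differs from its mirror image by \<open>(x \<bullet> n) *\<^sub>R n\<close>, so
  the Lipschitz constant of \<phi> makes the antisymmetric difference vanish to first order on the
  hyperplane, as the cutoff error requires.\<close>

lemma test_function_antisymmetric:
  assumes \<phi>: "test_function Q \<phi>"
  shows "test_function Q (\<lambda>x. \<phi> x - \<phi> (\<sigma> x))"
    and "\<exists>C. \<forall>x. norm (\<phi> x - \<phi> (\<sigma> x)) \<le> C * \<bar>x \<bullet> n\<bar>"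
proof -
  have "test_function Q (\<lambda>x. \<phi> x + (-1) * \<phi> (\<sigma> x))"
    by (intro test_function_add test_function_cmult test_function_\<sigma> \<phi>)
  then show "test_function Q (\<lambda>x. \<phi> x - \<phi> (\<sigma> x))" by simp
  obtain C where "\<forall>x y. norm (\<phi> x - \<phi> y) \<le> C * norm (x - y)" using test_function_lipschitz[OF \<phi>] by blast
  then have "norm (\<phi> x - \<phi> (\<sigma> x)) \<le> C * norm n * \<bar>x \<bullet> n\<bar>" for x
    by (metis \<sigma>_minus norm_scaleR mult.assoc mult.commute)
  then show "\<exists>C. \<forall>x. norm (\<phi> x - \<phi> (\<sigma> x)) \<le> C * \<bar>x \<bullet> n\<bar>" by blast
qed

lemma antisymmetric_partial:
  assumes "smooth \<phi>"
  shows "partial b (\<lambda>x. \<phi> x - \<phi> (\<sigma> x)) = (\<lambda>x. partial b \<phi> x - partial (\<sigma> b) \<phi> (\<sigma> x))"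
proof (intro ext partial_eqI)
  fix x
  have "((\<lambda>x. \<phi> (\<sigma> x)) has_derivative (\<lambda>h. frechet_derivative \<phi> (at (\<sigma> x)) (\<sigma> h))) (at x)"
    by (rule has_derivative_compose[OF \<sigma>_has_derivative smooth_has_derivative[OF assms]])
  then show "((\<lambda>x. \<phi> x - \<phi> (\<sigma> x)) has_derivative
      (\<lambda>h. frechet_derivative \<phi> (at x) h - frechet_derivative \<phi> (at (\<sigma> x)) (\<sigma> h))) (at x)"
    by (intro has_derivative_diff smooth_has_derivative assms)
qed

lemma partial_cutoff_mult:
  assumes "smooth \<phi>"
  shows "partial b (\<lambda>x. of_real (cutoff k x) * \<phi> x) =
    (\<lambda>x. of_real (cutoff k x) * partial b \<phi> x + of_real (real k * (b \<bullet> n) * flat 2 (real k * (x \<bullet> n) - 1)) * \<phi> x)"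
  unfolding partial_mult[OF smooth_cutoff assms] fun_cong[OF partial_cutoff] ..

lemma chi_sub: "f \<in> L2_on T \<Longrightarrow> cinner f (chi T g) = cinner f g"
  using cinner_mult_on[OF T_sets one_Linf, of f g] L2_on_iff_chi[OF T_sets, of f] by simp

section \<open>Extension and restriction of Sobolev functions\<close>

lemma has_weak_derivative_refl:
  assumes wd: "has_weak_derivative Q b F G" and b: "b \<in> Basis"
  shows "has_weak_derivative Q (\<sigma> b) (reflect F) (reflect G)"
  unfolding has_weak_derivative_def
proof (intro conjI allI impI)
  show "reflect F \<in> L2_on Q" "reflect G \<in> L2_on Q"
    using wd by (auto simp: has_weak_derivative_def intro: refl_in_L2_on_Q)
  fix \<phi> assume \<phi>: "test_function Q \<phi>"
  note sq = test_function_square_integrable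
  have "cinner (reflect F) (abs_L2 (partial (\<sigma> b) \<phi>)) = cinner F (abs_L2 (partial b (\<lambda>x. \<phi> (\<sigma> x))))"
    by (simp only: cinner_refl refl_abs_L2[OF sq[OF test_function_partial[OF \<phi> \<sigma>_Basis[OF b]]]]
        partial_\<sigma>[OF test_function_smooth[OF \<phi>]])
  also have "\<dots> = - cinner G (abs_L2 (\<lambda>x. \<phi> (\<sigma> x)))"
    using wd test_function_\<sigma>[OF \<phi>] by (simp add: has_weak_derivative_def)
  also have "\<dots> = - cinner (reflect G) (abs_L2 \<phi>)"
    by (simp add: cinner_refl refl_abs_L2 sq[OF \<phi>])
  finally show "cinner (reflect F) (abs_L2 (partial (\<sigma> b) \<phi>)) = - cinner (reflect G) (abs_L2 \<phi>)" .
qed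

lemma has_weak_derivative_restrict:
  assumes wd: "has_weak_derivative Q b F G" and b: "b \<in> Basis"
  shows "has_weak_derivative T b (chi T F) (chi T G)"
  unfolding has_weak_derivative_def
proof (intro conjI allI impI mult_on_in_L2_on T_sets one_Linf)
  fix \<phi> assume \<phi>: "test_function T \<phi>"
  have "chi T (abs_L2 \<psi>) = abs_L2 \<psi>" if "test_function T \<psi>" for \<psi>
    using test_function_in_L2_on[OF that] L2_on_iff_chi[OF T_sets] by blast
  then show "cinner (chi T F) (abs_L2 (partial b \<phi>)) = - cinner (chi T G) (abs_L2 \<phi>)"
    using wd \<phi> test_function_partial[OF \<phi> b] test_function_mono[OF \<phi> T_sub_Q]
    by (simp add: cinner_mult_on[OF T_sets one_Linf] has_weak_derivative_def)
qed

text \<open>Testing the extension against a derivative of \<phi> amounts to testing \<open>f\<close>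
  on \<open>T\<close> against derivatives of \<phi> and of its reflection \<psi>, in the directions
  \<open>b\<close> and \<open>\<sigma> b\<close>. Neither vanishes near the hyperplane, so both are
  cut off. The two directions have opposite components along \<open>n\<close>, so the derivatives of
  the cutoff combine to a multiple of \<phi> - \<psi>, which is antisymmetric; this error
  \<open>E k\<close> tends to 0.\<close>

lemma has_weak_derivative_even_extension:
  assumes wd: "\<And>b. b \<in> Basis \<Longrightarrow> has_weak_derivative T b f (g b)" and b: "b \<in> Basis"
  shows "has_weak_derivative Q b (f + reflect f) (g b + reflect (g (\<sigma> b)))"
  unfolding has_weak_derivative_def
proof (intro conjI allI impI)
  have in_T: "f \<in> L2_on T" "\<And>b. b \<in> Basis \<Longrightarrow> g b \<in> L2_on T"
    using wd b by (auto simp: has_weak_derivative_def)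
  have in_Q: "f \<in> L2_on Q" "\<And>b. b \<in> Basis \<Longrightarrow> g b \<in> L2_on Q"
    using in_T L2_on_mono[OF _ T_sub_Q] by blast+
  show "f + reflect f \<in> L2_on Q" "g b + reflect (g (\<sigma> b)) \<in> L2_on Q"
    using in_Q b \<sigma>_Basis by (auto intro!: L2_on_add refl_in_L2_on_Q)
  fix \<phi> assume \<phi>: "test_function Q \<phi>"
  define \<psi> where "\<psi> = (\<lambda>x. \<phi> (\<sigma> x))"
  have \<psi>: "test_function Q \<psi>" unfolding \<psi>_def by (rule test_function_\<sigma>[OF \<phi>])
  note sq = test_function_square_integrable
  note sm = test_function_smooth
  note d\<phi> = test_function_partial[OF \<phi> b] and d\<psi> = test_function_partial[OF \<psi> \<sigma>_Basis[OF b]]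
  have p\<psi>: "partial (\<sigma> b) \<psi> = (\<lambda>x. partial b \<phi> (\<sigma> x))"
    unfolding \<psi>_def by (simp add: partial_\<sigma>[OF sm[OF \<phi>]])
  define d where "d = (\<lambda>x. partial b \<phi> x + partial (\<sigma> b) \<psi> x)"
  define a where "a = (\<lambda>x. \<phi> x - \<phi> (\<sigma> x))"
  have d: "test_function Q d" unfolding d_def by (intro test_function_add d\<phi> d\<psi>)
  have a: "test_function Q a" unfolding a_def by (rule test_function_antisymmetric[OF \<phi>])
  obtain C where C: "\<And>x. norm (a x) \<le> C * \<bar>x \<bullet> n\<bar>"
    using test_function_antisymmetric(2)[OF \<phi>] unfolding a_def by blast
  define E where "E k = (\<lambda>x. complex_of_real (real k * (b \<bullet> n) * flat 2 (real k * (x \<bullet> n) - 1)) * a x)" for k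
  have Esq: "square_integrable (E k)" for k
    unfolding E_def
    by (intro sq[OF test_function_mult[OF a]] smooth_elementary elementary.flat elementary_diff
        elementary.mult elementary.const elementary.inner)
  have \<sigma>bn: "\<sigma> b \<bullet> n = - (b \<bullet> n)" by simp
  have key: "cinner f (abs_L2 (\<lambda>x. of_real (cutoff k x) * d x)) + cinner f (abs_L2 (E k))
     = - cinner (g b) (abs_L2 (\<lambda>x. of_real (cutoff k x) * \<phi> x))
       - cinner (g (\<sigma> b)) (abs_L2 (\<lambda>x. of_real (cutoff k x) * \<psi> x))" for k
  proof -
    note c\<phi> = test_function_cutoff[OF \<phi>, of k] and c\<psi> = test_function_cutoff[OF \<psi>, of k]
    have "abs_L2 (\<lambda>x. of_real (cutoff k x) * d x) + abs_L2 (E k)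
       = abs_L2 (\<lambda>x. of_real (cutoff k x) * d x + E k x)"
      by (intro abs_L2_add Esq sq[OF test_function_cutoff[OF d]])
    also have "(\<lambda>x. of_real (cutoff k x) * d x + E k x)
       = (\<lambda>x. partial b (\<lambda>x. of_real (cutoff k x) * \<phi> x) x + partial (\<sigma> b) (\<lambda>x. of_real (cutoff k x) * \<psi> x) x)"
      unfolding fun_cong[OF partial_cutoff_mult[OF sm[OF \<phi>]]]
        fun_cong[OF partial_cutoff_mult[OF sm[OF \<psi>]]] \<sigma>bn d_def E_def a_def
      unfolding \<psi>_def by (intro ext) (simp add: algebra_simps)
    also have "abs_L2 \<dots> = abs_L2 (partial b (\<lambda>x. of_real (cutoff k x) * \<phi> x))
        + abs_L2 (partial (\<sigma> b) (\<lambda>x. of_real (cutoff k x) * \<psi> x))"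
      by (intro abs_L2_add[symmetric] sq[OF test_function_partial[OF c\<phi> b]]
          sq[OF test_function_partial[OF c\<psi> \<sigma>_Basis[OF b]]])
    finally have "cinner f (abs_L2 (\<lambda>x. of_real (cutoff k x) * d x) + abs_L2 (E k))
       = cinner f (abs_L2 (partial b (\<lambda>x. of_real (cutoff k x) * \<phi> x)))
        + cinner f (abs_L2 (partial (\<sigma> b) (\<lambda>x. of_real (cutoff k x) * \<psi> x)))"
      by (simp only: cinner_add_right)
    moreover have "cinner f (abs_L2 (partial b (\<lambda>x. of_real (cutoff k x) * \<phi> x)))
       = - cinner (g b) (abs_L2 (\<lambda>x. of_real (cutoff k x) * \<phi> x))"
      using wd[OF b] c\<phi> unfolding has_weak_derivative_def by blast
    moreover have "cinner f (abs_L2 (partial (\<sigma> b) (\<lambda>x. of_real (cutoff k x) * \<psi> x)))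
       = - cinner (g (\<sigma> b)) (abs_L2 (\<lambda>x. of_real (cutoff k x) * \<psi> x))"
      using wd[OF \<sigma>_Basis[OF b]] c\<psi> unfolding has_weak_derivative_def by blast
    ultimately show ?thesis by (simp only: cinner_add_right diff_conv_add_uminus)
  qed
  have lim: "(\<lambda>k. cinner h (abs_L2 (\<lambda>x. of_real (cutoff k x) * u x))) \<longlonglongrightarrow> cinner h (abs_L2 u)"
    if "test_function Q u" "h \<in> L2_on T" for u h
    using tendsto_cinner_right[OF cutoff_tendsto[OF sq[OF that(1)] test_function_vanishes[OF that(1)]], of h]
    by (simp add: chi_sub[OF that(2)])
  have "(\<lambda>k. cinner f (abs_L2 (\<lambda>x. of_real (cutoff k x) * d x)) + cinner f (abs_L2 (E k)))
      \<longlonglongrightarrow> cinner f (abs_L2 d) + cinner f 0"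
    unfolding E_def
    by (intro tendsto_add lim d in_T tendsto_cinner_right cutoff_error_tendsto[OF a C])
  moreover have "(\<lambda>k. - cinner (g b) (abs_L2 (\<lambda>x. of_real (cutoff k x) * \<phi> x))
       - cinner (g (\<sigma> b)) (abs_L2 (\<lambda>x. of_real (cutoff k x) * \<psi> x)))
      \<longlonglongrightarrow> - cinner (g b) (abs_L2 \<phi>) - cinner (g (\<sigma> b)) (abs_L2 \<psi>)"
    by (intro tendsto_diff tendsto_minus lim \<phi> \<psi> in_T b \<sigma>_Basis)
  ultimately have "cinner f (abs_L2 d) = - cinner (g b) (abs_L2 \<phi>) - cinner (g (\<sigma> b)) (abs_L2 \<psi>)"
    unfolding key by (auto dest: LIMSEQ_unique)
  moreover have "abs_L2 d = abs_L2 (partial b \<phi>) + abs_L2 (\<lambda>x. partial b \<phi> (\<sigma> x))"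
    unfolding d_def fun_cong[OF p\<psi>]
    by (rule abs_L2_add[symmetric, OF sq[OF d\<phi>] square_integrable_\<sigma>[OF sq[OF d\<phi>]]])
  ultimately show "cinner (f + reflect f) (abs_L2 (partial b \<phi>)) = - cinner (g b + reflect (g (\<sigma> b))) (abs_L2 \<phi>)"
    by (simp add: cinner_simps cinner_refl refl_abs_L2 sq[OF \<phi>] sq[OF d\<phi>] \<psi>_def)
qed

text \<open>The support of a test function on \<open>T\<close> stays away from the hyperplane, so
  subtracting its reflection gives a test function on \<open>Q\<close> without any cutoff.\<close>

lemma H1_limit_odd_extension:
  assumes "H1_limit_of_test_functions T f g"
  shows "H1_limit_of_test_functions Q (f - reflect f) (\<lambda>b. g b - reflect (g (\<sigma> b)))"
  unfolding H1_limit_of_test_functions_def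
proof (intro allI impI)
  fix \<epsilon> :: real assume "0 < \<epsilon>"
  then obtain \<phi> where \<phi>: "test_function T \<phi>" "norm (f - abs_L2 \<phi>) < \<epsilon> / 2"
    "\<And>b. b \<in> Basis \<Longrightarrow> norm (g b - abs_L2 (partial b \<phi>)) < \<epsilon> / 2"
    using assms unfolding H1_limit_of_test_functions_def by (meson half_gt_zero)
  note \<phi>Q = test_function_mono[OF \<phi>(1) T_sub_Q]
  note sq = test_function_square_integrable
  show "\<exists>\<phi>. test_function Q \<phi> \<and> norm (f - reflect f - abs_L2 \<phi>) < \<epsilon> \<and>
      (\<forall>b\<in>Basis. norm (g b - reflect (g (\<sigma> b)) - abs_L2 (partial b \<phi>)) < \<epsilon>)"
  proof (intro exI[of _ "\<lambda>x. \<phi> x - \<phi> (\<sigma> x)"] conjI ballI)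
    show "test_function Q (\<lambda>x. \<phi> x - \<phi> (\<sigma> x))" by (rule test_function_antisymmetric[OF \<phi>Q])
    have tri: "norm (p - reflect q - (r - reflect s)) < \<epsilon>" if "norm (p - r) < \<epsilon> / 2" "norm (q - s) < \<epsilon> / 2" for p q r s
    proof -
      have "p - reflect q - (r - reflect s) = (p - r) - reflect (q - s)" by (simp add: refl_diff)
      also have "norm \<dots> \<le> norm (p - r) + norm (reflect (q - s))" by (rule norm_triangle_ineq4)
      finally show ?thesis using that by simp
    qed
    have "abs_L2 (\<lambda>x. \<phi> x - \<phi> (\<sigma> x)) = abs_L2 \<phi> - reflect (abs_L2 \<phi>)"
      by (rule abs_L2_diff_refl[OF sq[OF \<phi>Q] sq[OF \<phi>Q]])
    then show "norm (f - reflect f - abs_L2 (\<lambda>x. \<phi> x - \<phi> (\<sigma> x))) < \<epsilon>" using tri \<phi>(2) by simp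
    fix b :: 'a assume b: "b \<in> Basis"
    have "abs_L2 (partial b (\<lambda>x. \<phi> x - \<phi> (\<sigma> x))) = abs_L2 (partial b \<phi>) - reflect (abs_L2 (partial (\<sigma> b) \<phi>))"
      unfolding antisymmetric_partial[OF test_function_smooth[OF \<phi>Q]]
      by (rule abs_L2_diff_refl[OF sq[OF test_function_partial[OF \<phi>Q b]]
            sq[OF test_function_partial[OF \<phi>Q \<sigma>_Basis[OF b]]]])
    then show "norm (g b - reflect (g (\<sigma> b)) - abs_L2 (partial b (\<lambda>x. \<phi> x - \<phi> (\<sigma> x)))) < \<epsilon>"
      using tri \<phi>(3)[OF b] \<phi>(3)[OF \<sigma>_Basis[OF b]] by simp
  qed
qed

text \<open>Antisymmetrizing an approximating test function on \<open>Q\<close> makes it vanish on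
  the hyperplane. Its cutoffs are then test functions on \<open>T\<close> that converge to its
  restriction together with their derivatives.\<close>

lemma H1_limit_odd_restriction:
  assumes "H1_limit_of_test_functions Q F G"
  shows "H1_limit_of_test_functions T (chi T (F - reflect F)) (\<lambda>b. chi T (G b - reflect (G (\<sigma> b))))"
  unfolding H1_limit_of_test_functions_def
proof (intro allI impI)
  fix \<epsilon> :: real assume \<epsilon>: "0 < \<epsilon>"
  \<comment> \<open>One quarter each for \<open>F\<close> and for its reflection; the remaining half
    is spent on the cutoff.\<close>
  then have "0 < \<epsilon> / 4" by simp
  then obtain \<phi> where \<phi>: "test_function Q \<phi>" "norm (F - abs_L2 \<phi>) < \<epsilon> / 4"
    "\<And>b. b \<in> Basis \<Longrightarrow> norm (G b - abs_L2 (partial b \<phi>)) < \<epsilon> / 4"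
    using assms unfolding H1_limit_of_test_functions_def by meson
  note sq = test_function_square_integrable
  note blT = bounded_linear.linear[OF bounded_linear_chi[OF T_sets]]
  define a where "a = (\<lambda>x. \<phi> x - \<phi> (\<sigma> x))"
  have a: "test_function Q a" unfolding a_def by (rule test_function_antisymmetric[OF \<phi>(1)])
  obtain C where C: "\<And>x. norm (a x) \<le> C * \<bar>x \<bullet> n\<bar>"
    using test_function_antisymmetric(2)[OF \<phi>(1)] unfolding a_def by blast
  have tri: "norm (chi T (p - reflect q) - chi T (r - reflect s)) < \<epsilon> / 2"
    if "norm (p - r) < \<epsilon> / 4" "norm (q - s) < \<epsilon> / 4" for p q r s
  proof -
    have "chi T (p - reflect q) - chi T (r - reflect s) = chi T ((p - r) - reflect (q - s))"
      by (simp add: linear_diff[OF blT] refl_diff)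
    also have "norm \<dots> \<le> norm ((p - r) - reflect (q - s))" by (rule norm_chi[OF T_sets])
    also have "\<dots> \<le> norm (p - r) + norm (reflect (q - s))" by (rule norm_triangle_ineq4)
    finally show ?thesis using that by simp
  qed
  have A0: "abs_L2 a = abs_L2 \<phi> - reflect (abs_L2 \<phi>)"
    unfolding a_def by (rule abs_L2_diff_refl[OF sq[OF \<phi>(1)] sq[OF \<phi>(1)]])
  have Ab: "abs_L2 (partial b a) = abs_L2 (partial b \<phi>) - reflect (abs_L2 (partial (\<sigma> b) \<phi>))" if b: "b \<in> Basis" for b
    unfolding a_def antisymmetric_partial[OF test_function_smooth[OF \<phi>(1)]]
    by (rule abs_L2_diff_refl[OF sq[OF test_function_partial[OF \<phi>(1) b]]
          sq[OF test_function_partial[OF \<phi>(1) \<sigma>_Basis[OF b]]]])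
  have lim0: "(\<lambda>k. abs_L2 (\<lambda>x. of_real (cutoff k x) * a x)) \<longlonglongrightarrow> chi T (abs_L2 a)"
    by (rule cutoff_tendsto[OF sq[OF a] test_function_vanishes[OF a]])
  have limb: "(\<lambda>k. abs_L2 (partial b (\<lambda>x. of_real (cutoff k x) * a x))) \<longlonglongrightarrow> chi T (abs_L2 (partial b a))"
    if b: "b \<in> Basis" for b
  proof -
    note da = test_function_partial[OF a b]
    have "square_integrable (\<lambda>x. of_real (real k * (b \<bullet> n) * flat 2 (real k * (x \<bullet> n) - 1)) * a x)" for k
      by (intro sq[OF test_function_mult[OF a]] smooth_elementary elementary.flat elementary_diff
          elementary.mult elementary.const elementary.inner)
    then have "abs_L2 (partial b (\<lambda>x. of_real (cutoff k x) * a x))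
        = abs_L2 (\<lambda>x. of_real (cutoff k x) * partial b a x)
        + abs_L2 (\<lambda>x. of_real (real k * (b \<bullet> n) * flat 2 (real k * (x \<bullet> n) - 1)) * a x)" for k
      unfolding partial_cutoff_mult[OF test_function_smooth[OF a]]
      by (intro abs_L2_add[symmetric] sq[OF test_function_cutoff[OF da]])
    moreover have "(\<lambda>k. abs_L2 (\<lambda>x. of_real (cutoff k x) * partial b a x)
        + abs_L2 (\<lambda>x. of_real (real k * (b \<bullet> n) * flat 2 (real k * (x \<bullet> n) - 1)) * a x))
        \<longlonglongrightarrow> chi T (abs_L2 (partial b a)) + 0"
      by (intro tendsto_add cutoff_tendsto[OF sq[OF da] test_function_vanishes[OF da]] cutoff_error_tendsto[OF a C])
    ultimately show ?thesis by simp
  qed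
  have ev: "\<forall>\<^sub>F k in sequentially. norm (chi T (abs_L2 a) - abs_L2 (\<lambda>x. of_real (cutoff k x) * a x)) < \<epsilon> / 2 \<and>
      (\<forall>b\<in>Basis. norm (chi T (abs_L2 (partial b a)) - abs_L2 (partial b (\<lambda>x. of_real (cutoff k x) * a x))) < \<epsilon> / 2)"
  proof (intro eventually_conj eventually_ball_finite finite_Basis ballI)
    show "\<forall>\<^sub>F k in sequentially. norm (chi T (abs_L2 a) - abs_L2 (\<lambda>x. of_real (cutoff k x) * a x)) < \<epsilon> / 2"
      using tendstoD[OF lim0, of "\<epsilon> / 2"] \<epsilon> by (simp add: dist_norm norm_minus_commute)
    show "\<forall>\<^sub>F k in sequentially.
        norm (chi T (abs_L2 (partial b a)) - abs_L2 (partial b (\<lambda>x. of_real (cutoff k x) * a x))) < \<epsilon> / 2"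
      if "b \<in> Basis" for b
      using tendstoD[OF limb[OF that], of "\<epsilon> / 2"] \<epsilon> by (simp add: dist_norm norm_minus_commute)
  qed
  obtain k where k: "norm (chi T (abs_L2 a) - abs_L2 (\<lambda>x. of_real (cutoff k x) * a x)) < \<epsilon> / 2"
      "\<And>b. b \<in> Basis \<Longrightarrow> norm (chi T (abs_L2 (partial b a)) - abs_L2 (partial b (\<lambda>x. of_real (cutoff k x) * a x))) < \<epsilon> / 2"
    using eventually_happens'[OF sequentially_bot ev] by blast
  show "\<exists>\<psi>. test_function T \<psi> \<and> norm (chi T (F - reflect F) - abs_L2 \<psi>) < \<epsilon> \<and>
      (\<forall>b\<in>Basis. norm (chi T (G b - reflect (G (\<sigma> b))) - abs_L2 (partial b \<psi>)) < \<epsilon>)"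
  proof (intro exI[of _ "\<lambda>x. of_real (cutoff k x) * a x"] conjI ballI)
    show "test_function T (\<lambda>x. of_real (cutoff k x) * a x)" by (rule test_function_cutoff[OF a])
    show "norm (chi T (F - reflect F) - abs_L2 (\<lambda>x. of_real (cutoff k x) * a x)) < \<epsilon>"
      using norm_triangle_lt[OF add_strict_mono[OF tri[OF \<phi>(2,2)] k(1)[unfolded A0]]] by simp
    show "norm (chi T (G b - reflect (G (\<sigma> b))) - abs_L2 (partial b (\<lambda>x. of_real (cutoff k x) * a x))) < \<epsilon>"
      if b: "b \<in> Basis" for b
      using norm_triangle_lt[OF add_strict_mono[OF tri[OF \<phi>(3)[OF b] \<phi>(3)[OF \<sigma>_Basis[OF b]]]
            k(2)[OF b, unfolded Ab[OF b]]]] by simp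
  qed
qed

end

section \<open>Extension by reflection\<close>

definition parity :: "boundary_condition \<Rightarrow> real" where
  "parity bc = (case bc of Dirichlet \<Rightarrow> - 1 | Neumann \<Rightarrow> 1)"

lemma parity_square [simp]: "parity bc * parity bc = 1"
  by (cases bc) (simp_all add: parity_def)

lemma abs_parity [simp]: "\<bar>parity bc\<bar> = 1"
  by (cases bc) (simp_all add: parity_def)

lemma scaleC_one: "1 *\<^sub>C f = f"
  using scaleC_of_real[of 1 f] by simp

lemma H1_limit_scaleC:
  assumes "H1_limit_of_test_functions \<Omega> f g"
  shows "H1_limit_of_test_functions \<Omega> (c *\<^sub>C f) (\<lambda>b. c *\<^sub>C g b)"
  unfolding H1_limit_of_test_functions_def
proof (intro allI impI)
  fix \<epsilon> :: real assume \<epsilon>: "0 < \<epsilon>"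
  \<comment> \<open>The summand 1 keeps the denominator positive when \<open>c\<close> is 0.\<close>
  define d where "d = \<epsilon> / (norm c + 1)"
  have d: "0 < d" unfolding d_def using \<epsilon> by (intro divide_pos_pos add_nonneg_pos) auto
  have dc: "norm c * r < \<epsilon>" if "r < d" "0 \<le> r" for r
  proof -
    have "norm c * r \<le> norm c * d" using that by (intro mult_left_mono) auto
    also have "\<dots> < (norm c + 1) * d" using d by simp
    also have "\<dots> = \<epsilon>" unfolding d_def using norm_ge_zero[of c] by (simp add: add_nonneg_eq_0_iff)
    finally show ?thesis .
  qed
  obtain \<phi> where \<phi>: "test_function \<Omega> \<phi>" "norm (f - abs_L2 \<phi>) < d"
    "\<And>b. b \<in> Basis \<Longrightarrow> norm (g b - abs_L2 (partial b \<phi>)) < d"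
    using assms d unfolding H1_limit_of_test_functions_def by meson
  note sq = test_function_square_integrable
  show "\<exists>\<phi>. test_function \<Omega> \<phi> \<and> norm (c *\<^sub>C f - abs_L2 \<phi>) < \<epsilon> \<and>
      (\<forall>b\<in>Basis. norm (c *\<^sub>C g b - abs_L2 (partial b \<phi>)) < \<epsilon>)"
  proof (intro exI[of _ "\<lambda>x. c * \<phi> x"] conjI ballI)
    show "test_function \<Omega> (\<lambda>x. c * \<phi> x)" by (rule test_function_cmult[OF \<phi>(1)])
    show "norm (c *\<^sub>C f - abs_L2 (\<lambda>x. c * \<phi> x)) < \<epsilon>"
      using dc[OF \<phi>(2)] by (simp add: abs_L2_scaleC[OF sq[OF \<phi>(1)], symmetric] scaleC_diff_right[symmetric] norm_scaleC)
    show "norm (c *\<^sub>C g b - abs_L2 (partial b (\<lambda>x. c * \<phi> x))) < \<epsilon>" if b: "b \<in> Basis" for b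
      unfolding partial_cmult[OF test_function_smooth[OF \<phi>(1)]]
      using dc[OF \<phi>(3)[OF b]]
      by (simp add: abs_L2_scaleC[OF sq[OF test_function_partial[OF \<phi>(1) b]], symmetric]
          scaleC_diff_right[symmetric] norm_scaleC)
  qed
qed

lemma form_domain_scaleC:
  assumes \<Omega>: "open \<Omega>" and f: "f \<in> form_domain bc \<Omega>"
  shows "c *\<^sub>C f \<in> form_domain bc \<Omega>"
proof (cases bc)
  case Neumann
  then show ?thesis using f
    by (simp add: H1_def) (blast intro: L2_on_scaleC has_weak_derivative_scaleC)
next
  case Dirichlet
  then show ?thesis using f H1_0I[OF \<Omega> H1_limit_scaleC[OF H1_0_imp_limit[OF \<Omega>]]] by simp
qed

context hyperplane_reflection
begin

definition tau :: "boundary_condition \<Rightarrow> 'a L2 \<Rightarrow> 'a L2" where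
  "tau bc F = parity bc *\<^sub>R reflect F"

text \<open>Left unscaled, so that \<open>res\<close> is its adjoint and
  \<open>res bc (ext bc f)\<close> is \<open>2 *\<^sub>R f\<close>. The factor 1/sqrt 2 that makes
  it an isometry is inserted where norms are compared.\<close>

definition ext :: "boundary_condition \<Rightarrow> 'a L2 \<Rightarrow> 'a L2" where
  "ext bc f = f + tau bc f"

definition res :: "boundary_condition \<Rightarrow> 'a L2 \<Rightarrow> 'a L2" where
  "res bc F = chi T (F + tau bc F)"

lemma tau_add: "tau bc (F + G) = tau bc F + tau bc G"
  by (simp add: tau_def refl_add scaleR_add_right)

lemma tau_scaleC: "tau bc (c *\<^sub>C F) = c *\<^sub>C tau bc F"
  by (simp add: tau_def refl_scaleC scaleR_L2_def scaleC_scaleC mult.commute)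

lemma norm_tau [simp]: "norm (tau bc F) = norm F"
  by (simp add: tau_def)

lemma bounded_linear_tau: "bounded_linear (tau bc)"
  by (rule bounded_linear_L2I[where C=1]) (auto simp: tau_add tau_scaleC)

lemmas tau_linear_simps = tau_add tau_scaleC linear_diff[OF bounded_linear.linear[OF bounded_linear_tau]]
  linear_cmul[OF bounded_linear.linear[OF bounded_linear_tau]]

lemma tau_tau [simp]: "tau bc (tau bc F) = F"
  by (simp add: tau_def refl_scaleR)

lemma cinner_tau: "cinner (tau bc F) G = cinner F (tau bc G)"
  by (simp add: tau_def cinner_simps cinner_refl)

lemma tau_in_L2_on_Q: "F \<in> L2_on Q \<Longrightarrow> tau bc F \<in> L2_on Q"
  by (simp add: tau_def L2_on_scaleR refl_in_L2_on_Q)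

lemma chi_T_add: "chi T (f + g) = chi T f + chi T g"
  by (rule mult_on_add[OF T_sets one_Linf])

lemma chi_T_scaleR: "chi T (r *\<^sub>R f) = r *\<^sub>R chi T f"
  by (rule linear_cmul[OF bounded_linear.linear[OF bounded_linear_chi[OF T_sets]]])

lemma chi_T_id: "f \<in> L2_on T \<Longrightarrow> chi T f = f"
  using L2_on_iff_chi[OF T_sets] by blast

lemma chi_T_in: "chi T F \<in> L2_on T"
  by (rule mult_on_in_L2_on[OF T_sets one_Linf])

lemma chi_T_tau: "f \<in> L2_on T \<Longrightarrow> chi T (tau bc f) = 0"
  by (simp add: tau_def chi_T_scaleR chi_T_refl)

lemma T_in_Q: "f \<in> L2_on T \<Longrightarrow> f \<in> L2_on Q"
  by (rule L2_on_mono[OF _ T_sub_Q])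

lemma ext_in: "f \<in> L2_on T \<Longrightarrow> ext bc f \<in> L2_on Q"
  unfolding ext_def by (intro L2_on_add tau_in_L2_on_Q T_in_Q)

lemma res_in: "res bc F \<in> L2_on T"
  unfolding res_def by (rule chi_T_in)

lemma bounded_linear_ext: "bounded_linear (ext bc)"
  unfolding ext_def[abs_def] by (intro bounded_linear_add bounded_linear_ident bounded_linear_tau)

lemma bounded_linear_res: "bounded_linear (res bc)"
  unfolding res_def[abs_def]
  by (intro bounded_linear_compose[OF bounded_linear_chi[OF T_sets]] bounded_linear_add
      bounded_linear_ident bounded_linear_tau)

lemmas ext_linear = bounded_linear.linear[OF bounded_linear_ext]
lemmas res_linear = bounded_linear.linear[OF bounded_linear_res]

lemma ext_scaleC: "ext bc (c *\<^sub>C f) = c *\<^sub>C ext bc f"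
  by (simp add: ext_def tau_scaleC scaleC_add_right)

lemma res_scaleC: "res bc (c *\<^sub>C F) = c *\<^sub>C res bc F"
  by (simp add: res_def tau_scaleC scaleC_add_right[symmetric] mult_on_scaleC[OF T_sets one_Linf])

lemma tau_ext: "tau bc (ext bc f) = ext bc f"
  by (simp add: ext_def tau_add add.commute)

lemma res_tau: "res bc (tau bc F) = res bc F"
  by (simp add: res_def add.commute)

lemma cinner_ext: "f \<in> L2_on T \<Longrightarrow> cinner (ext bc f) F = cinner f (res bc F)"
  by (simp add: ext_def res_def chi_sub cinner_simps cinner_tau)

lemma res_ext: "f \<in> L2_on T \<Longrightarrow> res bc (ext bc f) = 2 *\<^sub>R f"
  by (simp add: res_def tau_ext chi_T_add scaleR_2)
     (simp add: ext_def chi_T_add chi_T_id chi_T_tau)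

text \<open>Follows by splitting \<open>F\<close> and its reflection over the two halves of
  \<open>Q\<close>. The right-hand side is twice the projection of \<open>F\<close> onto the
  functions fixed by \<open>tau bc\<close>.\<close>

lemma ext_res:
  assumes "F \<in> L2_on Q" shows "ext bc (res bc F) = F + tau bc F"
proof -
  have F: "chi T F + reflect (chi T (reflect F)) = F" by (rule decompose_Q[OF assms])
  have rF: "chi T (reflect F) + reflect (chi T F) = reflect F"
    using decompose_Q[OF refl_in_L2_on_Q[OF assms]] by simp
  have "ext bc (res bc F) = (chi T F + reflect (chi T (reflect F))) + parity bc *\<^sub>R (chi T (reflect F) + reflect (chi T F))"
    by (simp add: ext_def res_def tau_def chi_T_add chi_T_scaleR refl_add refl_scaleR scaleR_add_right)
  then show ?thesis unfolding F rF by (simp add: tau_def)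
qed

lemma norm_ext: "f \<in> L2_on T \<Longrightarrow> norm (ext bc f) = sqrt 2 * norm f"
proof -
  assume f: "f \<in> L2_on T"
  have "(norm (ext bc f))\<^sup>2 = (sqrt 2 * norm f)\<^sup>2"
    by (simp add: norm_eq_cinner cinner_ext[OF f] res_ext[OF f] cinner_simps power_mult_distrib)
  then show ?thesis by (simp add: power2_eq_iff_nonneg)
qed

text \<open>The adjoint of an isometry is a contraction: this is why passing to the half makes no
  control more expensive.\<close>

lemma norm_res_le:
  assumes "F \<in> L2_on Q" shows "norm ((1 / sqrt 2) *\<^sub>R res bc F) \<le> norm F"
proof -
  have "sqrt 2 * norm (res bc F) = norm (F + tau bc F)"
    using norm_ext[OF res_in[of bc F], of bc] ext_res[OF assms] by simp
  also have "\<dots> \<le> 2 * norm F" using norm_triangle_ineq[of F "tau bc F"] by simp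
  finally have "norm (res bc F) \<le> sqrt 2 * norm F"
    by (metis mult_le_cancel_left_pos mult.assoc real_sqrt_gt_0_iff real_sqrt_mult_self abs_numeral zero_less_numeral)
  then show ?thesis by (simp add: field_simps)
qed

lemma H1_limit_refl:
  assumes "H1_limit_of_test_functions Q F G"
  shows "H1_limit_of_test_functions Q (reflect F) (\<lambda>b. reflect (G (\<sigma> b)))"
  unfolding H1_limit_of_test_functions_def
proof (intro allI impI)
  fix \<epsilon> :: real assume "0 < \<epsilon>"
  then obtain \<phi> where \<phi>: "test_function Q \<phi>" "norm (F - abs_L2 \<phi>) < \<epsilon>"
    "\<And>b. b \<in> Basis \<Longrightarrow> norm (G b - abs_L2 (partial b \<phi>)) < \<epsilon>"
    using assms unfolding H1_limit_of_test_functions_def by meson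
  note sq = test_function_square_integrable
  show "\<exists>\<phi>. test_function Q \<phi> \<and> norm (reflect F - abs_L2 \<phi>) < \<epsilon> \<and>
      (\<forall>b\<in>Basis. norm (reflect (G (\<sigma> b)) - abs_L2 (partial b \<phi>)) < \<epsilon>)"
  proof (intro exI[of _ "\<lambda>x. \<phi> (\<sigma> x)"] conjI ballI)
    show "test_function Q (\<lambda>x. \<phi> (\<sigma> x))" by (rule test_function_\<sigma>[OF \<phi>(1)])
    show "norm (reflect F - abs_L2 (\<lambda>x. \<phi> (\<sigma> x))) < \<epsilon>"
      using \<phi>(2) by (simp add: refl_abs_L2[OF sq[OF \<phi>(1)], symmetric] refl_diff[symmetric])
    show "norm (reflect (G (\<sigma> b)) - abs_L2 (partial b (\<lambda>x. \<phi> (\<sigma> x)))) < \<epsilon>" if b: "b \<in> Basis" for b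
      unfolding partial_\<sigma>[OF test_function_smooth[OF \<phi>(1)]]
        refl_abs_L2[OF sq[OF test_function_partial[OF \<phi>(1) \<sigma>_Basis[OF b]]], symmetric]
      using \<phi>(3)[OF \<sigma>_Basis[OF b]] by (simp add: refl_diff[symmetric])
  qed
qed

lemma form_domain_ext:
  assumes f: "f \<in> form_domain bc T"
  shows "ext bc f \<in> form_domain bc Q"
    and "b \<in> Basis \<Longrightarrow> has_weak_derivative Q b (ext bc f)
      (weak_derivative T b f + tau bc (weak_derivative T (\<sigma> b) f))"
proof -
  have "ext bc f \<in> form_domain bc Q \<and> (\<forall>b\<in>Basis. has_weak_derivative Q b (ext bc f)
      (weak_derivative T b f + tau bc (weak_derivative T (\<sigma> b) f)))"
  proof (cases bc)
    case Neumann
    have "has_weak_derivative Q b (ext bc f) (weak_derivative T b f + tau bc (weak_derivative T (\<sigma> b) f))"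
      if "b \<in> Basis" for b
      using has_weak_derivative_even_extension[OF H1_has_weak_derivative[OF open_T form_domain_in_H1[OF f]] that] Neumann
      by (simp add: ext_def tau_def parity_def)
    moreover have "ext bc f \<in> L2_on Q" using form_domain_in_H1[OF f] by (intro ext_in) (simp add: H1_def)
    ultimately show ?thesis using Neumann by (auto simp: H1_def)
  next
    case Dirichlet
    then have "H1_limit_of_test_functions T f (\<lambda>b. weak_derivative T b f)"
      using f H1_0_imp_limit[OF open_T] by simp
    from H1_limit_odd_extension[OF this]
    have l: "H1_limit_of_test_functions Q (ext bc f)
        (\<lambda>b. weak_derivative T b f + tau bc (weak_derivative T (\<sigma> b) f))"
      using Dirichlet by (simp add: ext_def tau_def parity_def)
    show ?thesis using H1_0I[OF open_Q l] H1_limit_has_weak_derivative[OF Q_sets l] Dirichlet by simp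
  qed
  then show "ext bc f \<in> form_domain bc Q" "b \<in> Basis \<Longrightarrow> has_weak_derivative Q b (ext bc f)
      (weak_derivative T b f + tau bc (weak_derivative T (\<sigma> b) f))" by auto
qed

lemma form_domain_tau:
  assumes F: "F \<in> form_domain bc Q"
  shows "tau bc F \<in> form_domain bc Q"
    and "b \<in> Basis \<Longrightarrow> has_weak_derivative Q b (tau bc F) (tau bc (weak_derivative Q (\<sigma> b) F))"
proof -
  show wd: "has_weak_derivative Q b (tau bc F) (tau bc (weak_derivative Q (\<sigma> b) F))" if b: "b \<in> Basis" for b
  proof -
    have "has_weak_derivative Q (\<sigma> b) F (weak_derivative Q (\<sigma> b) F)"
      by (intro H1_has_weak_derivative open_Q form_domain_in_H1[OF F] \<sigma>_Basis b)
    from has_weak_derivative_refl[OF this \<sigma>_Basis[OF b]]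
    have "has_weak_derivative Q b (reflect F) (reflect (weak_derivative Q (\<sigma> b) F))" by simp
    from has_weak_derivative_scaleC[OF this, of "of_real (parity bc)"] show ?thesis
      by (simp add: tau_def scaleC_of_real)
  qed
  show "tau bc F \<in> form_domain bc Q"
  proof (cases bc)
    case Neumann
    have "tau bc F \<in> L2_on Q" using form_domain_in_H1[OF F] by (intro tau_in_L2_on_Q) (simp add: H1_def)
    then show ?thesis using Neumann wd by (auto simp: H1_def)
  next
    case Dirichlet
    then have "reflect F \<in> form_domain bc Q"
      using F H1_0I[OF open_Q H1_limit_refl[OF H1_0_imp_limit[OF open_Q]]] by simp
    from form_domain_scaleC[OF open_Q this, of "of_real (parity bc)"] show ?thesis
      by (simp add: tau_def scaleC_of_real)
  qed
qed

text \<open>In the Neumann case nothing is prescribed on the new face, so restriction is enough. In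
  the Dirichlet case the boundary condition on that face comes from the vanishing of odd functions
  on the hyperplane.\<close>

lemma form_domain_res:
  assumes F: "F \<in> form_domain bc Q"
  shows "res bc F \<in> form_domain bc T"
    and "b \<in> Basis \<Longrightarrow> has_weak_derivative T b (res bc F)
      (chi T (weak_derivative Q b F + tau bc (weak_derivative Q (\<sigma> b) F)))"
proof -
  show wd: "has_weak_derivative T b (res bc F)
      (chi T (weak_derivative Q b F + tau bc (weak_derivative Q (\<sigma> b) F)))" if b: "b \<in> Basis" for b
    unfolding res_def
    by (intro has_weak_derivative_restrict b has_weak_derivative_add form_domain_tau F
        H1_has_weak_derivative open_Q form_domain_in_H1[OF F])
  show "res bc F \<in> form_domain bc T"
  proof (cases bc)
    case Neumann
    then show ?thesis using wd res_in by (auto simp: H1_def)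
  next
    case Dirichlet
    then have "H1_limit_of_test_functions Q F (\<lambda>b. weak_derivative Q b F)"
      using F H1_0_imp_limit[OF open_Q] by simp
    from H1_0I[OF open_T H1_limit_odd_restriction[OF this]] show ?thesis
      using Dirichlet by (simp add: res_def tau_def parity_def)
  qed
qed

section \<open>The reflected Schroedinger operator\<close>

text \<open>The potential is reflected evenly under both boundary conditions, so that multiplication
  by it commutes with \<open>tau bc\<close>. Its values on the hyperplane concern a null
  set.\<close>

definition ext_fun :: "('a \<Rightarrow> real) \<Rightarrow> 'a \<Rightarrow> real" where
  "ext_fun V x = (if x \<in> T then V x else if \<sigma> x \<in> T then V (\<sigma> x) else 0)"

lemma ext_fun_\<sigma>: "ext_fun V (\<sigma> x) = ext_fun V x"
  by (auto simp: ext_fun_def T_def)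

lemma ext_fun_measurable:
  assumes "V \<in> borel_measurable (lebesgue_on T)" shows "ext_fun V \<in> borel_measurable lebesgue"
proof -
  define V0 where "V0 x = (if x \<in> T then V x else 0)" for x
  have V0 [measurable]: "V0 \<in> borel_measurable lebesgue"
    unfolding V0_def[abs_def] using assms by (simp add: borel_measurable_if)
  have [measurable]: "(\<lambda>x. V0 (\<sigma> x)) \<in> borel_measurable lebesgue"
    by (rule measurable_compose[OF \<sigma>_lebesgue V0])
  have "ext_fun V = (\<lambda>x. V0 x + V0 (\<sigma> x))"
    by (auto simp: ext_fun_def V0_def T_def fun_eq_iff)
  also have "\<dots> \<in> borel_measurable lebesgue" by measurable
  finally show ?thesis .
qed

lemma AE_ext_fun:
  "(AE x in lebesgue_on Q. P (ext_fun V x)) \<longleftrightarrow> (AE x in lebesgue_on T. P (V x))"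
proof -
  have "(AE x in lebesgue. x \<in> Q \<longrightarrow> P (ext_fun V x)) \<longleftrightarrow> (AE x in lebesgue. x \<in> T \<longrightarrow> P (V x))"
  proof
    assume "AE x in lebesgue. x \<in> Q \<longrightarrow> P (ext_fun V x)"
    then show "AE x in lebesgue. x \<in> T \<longrightarrow> P (V x)"
      by eventually_elim (auto simp: ext_fun_def T_def)
  next
    assume a: "AE x in lebesgue. x \<in> T \<longrightarrow> P (V x)"
    show "AE x in lebesgue. x \<in> Q \<longrightarrow> P (ext_fun V x)"
      using a AE_\<sigma>[OF a] AE_off_hyperplane
      by eventually_elim (auto simp: ext_fun_def T_def)
  qed
  then show ?thesis by (simp add: AE_restrict_space_iff)
qed

lemma ext_fun_Linf:
  assumes "V \<in> Linf T" shows "ext_fun V \<in> Linf Q"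
proof -
  have "ext_fun V \<in> borel_measurable (lebesgue_on Q)"
    using assms by (intro measurable_restrict_space1[OF ext_fun_measurable]) (simp add: Linf_def)
  then show ?thesis using assms by (auto simp: Linf_def AE_ext_fun[where P="\<lambda>v. \<bar>v\<bar> \<le> _"])
qed

text \<open>By \<open>AE_ext_fun\<close> both functions have the same almost everywhere upper
  bounds. The function \<open>h\<close> covers the two norms in the cost bound, that of the
  potential and that of its negative part.\<close>

lemma esssup_ext_fun:
  assumes V: "V \<in> borel_measurable (lebesgue_on T)" and h: "h \<in> borel_measurable borel"
  shows "esssup (lebesgue_on Q) (\<lambda>x. ereal (h (ext_fun V x))) = esssup (lebesgue_on T) (\<lambda>x. ereal (h (V x)))"
proof -
  have "ext_fun V \<in> borel_measurable (lebesgue_on Q)"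
    by (intro measurable_restrict_space1[OF ext_fun_measurable] V)
  then have "(\<lambda>x. ereal (h (ext_fun V x))) \<in> borel_measurable (lebesgue_on Q)"
    by (intro borel_measurable_ereal measurable_compose[OF _ h])
  moreover have "(\<lambda>x. ereal (h (V x))) \<in> borel_measurable (lebesgue_on T)"
    by (intro borel_measurable_ereal measurable_compose[OF V h])
  ultimately show ?thesis
    by (simp only: esssup_eq_AE AE_ext_fun[where P="\<lambda>v. ereal (h v) \<le> _"])
qed

lemma Linf_norm_ext_fun:
  assumes "V \<in> Linf T"
  shows "Linf_norm Q (ext_fun V) = Linf_norm T V"
    and "Linf_norm Q (\<lambda>x. max (- ext_fun V x) 0) = Linf_norm T (\<lambda>x. max (- V x) 0)"
  using esssup_ext_fun[of V "\<lambda>v. \<bar>v\<bar>"] esssup_ext_fun[of V "\<lambda>v. \<bar>max (- v) 0\<bar>"] assms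
  by (simp_all add: Linf_norm_def Linf_def)

lemma mult_on_ext_fun_refl:
  assumes V: "V \<in> Linf T"
  shows "mult_on Q (ext_fun V) (reflect F) = reflect (mult_on Q (ext_fun V) F)"
  unfolding L2_eq_iff
  using rep_mult_on[OF Q_sets ext_fun_Linf[OF V], of "reflect F"] rep_refl[of F]
    rep_refl[of "mult_on Q (ext_fun V) F"] AE_\<sigma>[OF rep_mult_on[OF Q_sets ext_fun_Linf[OF V], of F]]
  by eventually_elim (simp add: ext_fun_\<sigma>)

lemma mult_on_scaleR:
  "\<Omega> \<in> sets lebesgue \<Longrightarrow> m \<in> Linf \<Omega> \<Longrightarrow> mult_on \<Omega> m (r *\<^sub>R f) = r *\<^sub>R mult_on \<Omega> m f"
  by (simp add: scaleR_L2_def mult_on_scaleC)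

lemma mult_on_ext_fun_tau:
  "V \<in> Linf T \<Longrightarrow> mult_on Q (ext_fun V) (tau bc F) = tau bc (mult_on Q (ext_fun V) F)"
  by (simp add: tau_def mult_on_ext_fun_refl mult_on_scaleR[OF Q_sets ext_fun_Linf])

lemma mult_on_ext_fun_ext:
  assumes V: "V \<in> Linf T" and f: "f \<in> L2_on T"
  shows "mult_on Q (ext_fun V) (ext bc f) = ext bc (mult_on T V f)"
proof -
  have "mult_on Q (ext_fun V) f = mult_on T V f"
    unfolding L2_eq_iff
    using rep_mult_on[OF Q_sets ext_fun_Linf[OF V], of f] rep_mult_on[OF T_sets V, of f] f[unfolded L2_on_iff]
    by eventually_elim (auto simp: ext_fun_def T_def)
  then show ?thesis
    by (simp add: ext_def mult_on_add[OF Q_sets ext_fun_Linf[OF V]] mult_on_ext_fun_tau[OF V])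
qed

lemma weak_derivative_in_T: "f \<in> form_domain bc T \<Longrightarrow> b \<in> Basis \<Longrightarrow> weak_derivative T b f \<in> L2_on T"
  using H1_has_weak_derivative[OF open_T form_domain_in_H1] by (auto simp: has_weak_derivative_def)

lemma form_domain_in_L2_on: "f \<in> form_domain bc \<Omega> \<Longrightarrow> f \<in> L2_on \<Omega>"
  using form_domain_in_H1 by (auto simp: H1_def)

text \<open>A weak derivative of the extension consists of one from \<open>T\<close> and a reflected
  one in direction \<open>\<sigma> b\<close>. Moving \<open>tau\<close> to the other side of the
  inner product and reindexing the sum over the basis by \<sigma> collects the derivatives of
  \<open>res bc F\<close>.\<close>

lemma schroedinger_form_ext:
  assumes V: "V \<in> Linf T" and f: "f \<in> form_domain bc T" and F: "F \<in> form_domain bc Q"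
  shows "schroedinger_form Q (ext_fun V) (ext bc f) F = schroedinger_form T V f (res bc F)"
proof -
  have "(\<Sum>b\<in>Basis. cinner (weak_derivative Q b (ext bc f)) (weak_derivative Q b F))
     = (\<Sum>b\<in>Basis. cinner (weak_derivative T b f) (weak_derivative Q b F)
        + cinner (weak_derivative T (\<sigma> b) f) (tau bc (weak_derivative Q b F)))"
    by (intro sum.cong) (auto simp: weak_derivative_eqI[OF open_Q form_domain_ext(2)[OF f]] cinner_simps cinner_tau)
  also have "\<dots> = (\<Sum>b\<in>Basis. cinner (weak_derivative T b f) (weak_derivative Q b F))
      + (\<Sum>b\<in>Basis. cinner (weak_derivative T (\<sigma> b) f) (tau bc (weak_derivative Q (\<sigma> (\<sigma> b)) F)))"
    by (simp add: sum.distrib)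
  also have "(\<Sum>b\<in>Basis. cinner (weak_derivative T (\<sigma> b) f) (tau bc (weak_derivative Q (\<sigma> (\<sigma> b)) F)))
      = (\<Sum>b\<in>Basis. cinner (weak_derivative T b f) (tau bc (weak_derivative Q (\<sigma> b) F)))"
    by (rule sum_Basis_\<sigma>)
  also have "(\<Sum>b\<in>Basis. cinner (weak_derivative T b f) (weak_derivative Q b F))
      + (\<Sum>b\<in>Basis. cinner (weak_derivative T b f) (tau bc (weak_derivative Q (\<sigma> b) F)))
      = (\<Sum>b\<in>Basis. cinner (weak_derivative T b f) (weak_derivative T b (res bc F)))"
    unfolding sum.distrib[symmetric]
    by (intro sum.cong)
       (auto simp: weak_derivative_eqI[OF open_T form_domain_res(2)[OF F]] chi_sub weak_derivative_in_T[OF f] cinner_simps)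
  finally show ?thesis
    using form_domain_in_L2_on[OF f]
    by (simp add: schroedinger_form_def mult_on_ext_fun_ext[OF V] cinner_ext mult_on_in_L2_on[OF T_sets V])
qed

lemma schroedinger_form_tau:
  assumes V: "V \<in> Linf T" and F: "F \<in> form_domain bc Q" and G: "G \<in> form_domain bc Q"
  shows "schroedinger_form Q (ext_fun V) (tau bc F) G = schroedinger_form Q (ext_fun V) F (tau bc G)"
proof -
  have "(\<Sum>b\<in>Basis. cinner (weak_derivative Q b (tau bc F)) (weak_derivative Q b G))
      = (\<Sum>b\<in>Basis. cinner (weak_derivative Q (\<sigma> b) F) (tau bc (weak_derivative Q (\<sigma> (\<sigma> b)) G)))"
    by (intro sum.cong) (auto simp: weak_derivative_eqI[OF open_Q form_domain_tau(2)[OF F]] cinner_tau)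
  also have "\<dots> = (\<Sum>b\<in>Basis. cinner (weak_derivative Q b F) (tau bc (weak_derivative Q (\<sigma> b) G)))"
    by (rule sum_Basis_\<sigma>)
  also have "\<dots> = (\<Sum>b\<in>Basis. cinner (weak_derivative Q b F) (weak_derivative Q b (tau bc G)))"
    by (intro sum.cong) (auto simp: weak_derivative_eqI[OF open_Q form_domain_tau(2)[OF G]])
  finally show ?thesis by (simp add: schroedinger_form_def mult_on_ext_fun_tau[OF V] cinner_tau)
qed

lemma schroedinger_operator_ext:
  assumes V: "V \<in> Linf T" and f: "f \<in> L2_on T" and h: "h \<in> L2_on T"
  shows "(ext bc f, ext bc h) \<in> schroedinger_operator bc Q (ext_fun V) \<longleftrightarrow>
    (f, h) \<in> schroedinger_operator bc T V"
proof
  assume "(f, h) \<in> schroedinger_operator bc T V"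
  then have fd: "f \<in> form_domain bc T"
    and eq: "\<And>g. g \<in> form_domain bc T \<Longrightarrow> schroedinger_form T V f g = cinner h g"
    by (auto simp: schroedinger_operator_def)
  show "(ext bc f, ext bc h) \<in> schroedinger_operator bc Q (ext_fun V)"
    using form_domain_ext(1)[OF fd] form_domain_res(1) ext_in[OF h]
    by (auto simp: schroedinger_operator_def schroedinger_form_ext[OF V fd] eq cinner_ext[OF h])
next
  assume "(ext bc f, ext bc h) \<in> schroedinger_operator bc Q (ext_fun V)"
  then have fd: "ext bc f \<in> form_domain bc Q"
    and eq: "\<And>g. g \<in> form_domain bc Q \<Longrightarrow> schroedinger_form Q (ext_fun V) (ext bc f) g = cinner (ext bc h) g"
    by (auto simp: schroedinger_operator_def)
  \<comment> \<open>Every form-domain element on \<open>T\<close> is the restriction of one on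
    \<open>Q\<close>, so testing on \<open>Q\<close> suffices for the converse direction.\<close>
  have half: "res bc ((1/2) *\<^sub>C ext bc g) = g" if "g \<in> L2_on T" for g
    using res_ext[OF that] by (simp add: res_scaleC scaleR_L2_def scaleC_scaleC scaleC_one)
  have fT: "f \<in> form_domain bc T"
    using form_domain_res(1)[OF form_domain_scaleC[OF open_Q fd, of "1/2"]] half[OF f] by simp
  have "schroedinger_form T V f g = cinner h g" if g: "g \<in> form_domain bc T" for g
  proof -
    have G: "(1/2) *\<^sub>C ext bc g \<in> form_domain bc Q"
      by (intro form_domain_scaleC open_Q form_domain_ext g)
    have "res bc ((1/2) *\<^sub>C ext bc g) = g" by (rule half[OF form_domain_in_L2_on[OF g]])
    then show ?thesis
      using schroedinger_form_ext[OF V fT G] eq[OF G] cinner_ext[OF h, of bc "(1/2) *\<^sub>C ext bc g"] by simp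
  qed
  then show "(f, h) \<in> schroedinger_operator bc T V"
    using fT h by (simp add: schroedinger_operator_def)
qed

lemma schroedinger_operator_tau:
  assumes V: "V \<in> Linf T" and "(F, K) \<in> schroedinger_operator bc Q (ext_fun V)"
  shows "(tau bc F, tau bc K) \<in> schroedinger_operator bc Q (ext_fun V)"
  using assms(2) form_domain_tau(1) tau_in_L2_on_Q
  by (auto simp: schroedinger_operator_def schroedinger_form_tau[OF V] cinner_tau)

lemma schroedinger_operator_tau_iff:
  assumes V: "V \<in> Linf T"
  shows "(tau bc F, tau bc K) \<in> schroedinger_operator bc Q (ext_fun V) \<longleftrightarrow>
    (F, K) \<in> schroedinger_operator bc Q (ext_fun V)"
  using schroedinger_operator_tau[OF V, of F K bc] schroedinger_operator_tau[OF V, of "tau bc F" "tau bc K" bc]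
  by auto

end

section \<open>Transfer of the semigroup and of controls\<close>

lemma L2_time_mono:
  fixes v w :: "real \<Rightarrow> 'a::euclidean_space L2"
  assumes "v \<in> borel_measurable (lebesgue_on {0<..<t})"
    and w: "integrable (lebesgue_on {0<..<t}) (\<lambda>s. (norm (w s))\<^sup>2)"
    and le: "\<And>s. s \<in> {0<..<t} \<Longrightarrow> norm (v s) \<le> norm (w s)"
  shows "integrable (lebesgue_on {0<..<t}) (\<lambda>s. (norm (v s))\<^sup>2)"
    and "L2_time_norm t v \<le> L2_time_norm t w"
proof -
  note [measurable] = assms(1)
  have sq: "(norm (v s))\<^sup>2 \<le> (norm (w s))\<^sup>2" if "s \<in> {0<..<t}" for s
    using le[OF that] by (intro power_mono) auto
  show i: "integrable (lebesgue_on {0<..<t}) (\<lambda>s. (norm (v s))\<^sup>2)"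
    by (rule Bochner_Integration.integrable_bound[OF w]) (use sq in \<open>auto intro!: AE_I2\<close>)
  show "L2_time_norm t v \<le> L2_time_norm t w"
    unfolding L2_time_norm_def by (intro real_sqrt_le_mono integral_mono i w sq) simp
qed

lemma bounded_linear_measurable:
  assumes "bounded_linear B" "v \<in> borel_measurable M" shows "(\<lambda>s. B (v s)) \<in> borel_measurable M"
  by (rule measurable_compose[OF assms(2) borel_measurable_continuous_onI[OF linear_continuous_on[OF assms(1)]]])

context hyperplane_reflection
begin

text \<open>Conjugating \<open>U\<close> with the involution \<open>tau bc\<close> gives a semigroup
  whose generator is the same, because the operator on \<open>Q\<close> is invariant under
  \<open>tau bc\<close>.\<close>

lemma semigroup_commutes_tau:
  assumes V: "V \<in> Linf T"
    and U: "is_exp_semigroup (L2_on Q) (schroedinger_operator bc Q (ext_fun V)) U"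
    and t: "0 \<le> t" and F: "F \<in> L2_on Q"
  shows "U t (tau bc F) = tau bc (U t F)"
proof -
  let ?H = "schroedinger_operator bc Q (ext_fun V)"
  have C0: "C0_semigroup_on (L2_on Q) U" and gen: "generator (L2_on Q) U = {(f, - h) |f h. (f, h) \<in> ?H}"
    using U by (auto simp: is_exp_semigroup_def)
  interpret U: L2_semigroup Q U by unfold_locales (rule Q_sets C0)+
  define W where "W t F = tau bc (U t (tau bc F))" for t F
  note tin = tau_in_L2_on_Q
  have C0W: "C0_semigroup_on (L2_on Q) W"
    unfolding C0_semigroup_on_def
  proof (intro conjI allI impI ballI)
    fix t :: real assume t: "0 \<le> t"
    show "W t f \<in> L2_on Q" if "f \<in> L2_on Q" for f
      unfolding W_def by (intro tin U.semigroup(1) t that)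
    show "W t (f + g) = W t f + W t g" if "f \<in> L2_on Q" "g \<in> L2_on Q" for f g
      by (simp add: W_def tau_add U.semigroup(2)[OF t] tin that)
    show "W t (c *\<^sub>C f) = c *\<^sub>C W t f" if "f \<in> L2_on Q" for c f
      by (simp add: W_def tau_scaleC U.semigroup(3)[OF t] tin that)
    obtain C where "\<forall>f\<in>L2_on Q. norm (U t f) \<le> C * norm f" using U.semigroup(4)[OF t] by blast
    then have "norm (W t f) \<le> C * norm f" if "f \<in> L2_on Q" for f
      using tin[OF that, of bc] by (force simp: W_def)
    then show "\<exists>C. \<forall>f\<in>L2_on Q. norm (W t f) \<le> C * norm f" by blast
  next
    show "W 0 f = f" if "f \<in> L2_on Q" for f
      by (simp add: W_def U.semigroup(5) tin that)
    show "W (s + t) f = W s (W t f)" if "0 \<le> s" "0 \<le> t" "f \<in> L2_on Q" for s t f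
      by (simp add: W_def U.semigroup(6)[OF that(1,2)] tin that)
    show "((\<lambda>t. W t f) \<longlongrightarrow> f) (at_right 0)" if "f \<in> L2_on Q" for f
      unfolding W_def
      using bounded_linear.tendsto[OF bounded_linear_tau[of bc] U.semigroup(7)[OF tin[OF that, of bc]]] by simp
  qed
  have lim: "((\<lambda>t. (1 / t) *\<^sub>R (W t f - f)) \<longlongrightarrow> g) (at_right 0) \<longleftrightarrow>
      ((\<lambda>t. (1 / t) *\<^sub>R (U t (tau bc f) - tau bc f)) \<longlongrightarrow> tau bc g) (at_right 0)" for f g
  proof -
    have 1: "(1 / t) *\<^sub>R (W t f - f) = tau bc ((1 / t) *\<^sub>R (U t (tau bc f) - tau bc f))" for t
      by (simp add: W_def tau_linear_simps)
    have 2: "(1 / t) *\<^sub>R (U t (tau bc f) - tau bc f) = tau bc ((1 / t) *\<^sub>R (W t f - f))" for t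
      by (simp add: W_def tau_linear_simps)
    show ?thesis
    proof
      assume "((\<lambda>t. (1 / t) *\<^sub>R (W t f - f)) \<longlongrightarrow> g) (at_right 0)"
      then show "((\<lambda>t. (1 / t) *\<^sub>R (U t (tau bc f) - tau bc f)) \<longlongrightarrow> tau bc g) (at_right 0)"
        unfolding 2 by (rule bounded_linear.tendsto[OF bounded_linear_tau])
    next
      assume "((\<lambda>t. (1 / t) *\<^sub>R (U t (tau bc f) - tau bc f)) \<longlongrightarrow> tau bc g) (at_right 0)"
      from bounded_linear.tendsto[OF bounded_linear_tau[of bc] this]
      show "((\<lambda>t. (1 / t) *\<^sub>R (W t f - f)) \<longlongrightarrow> g) (at_right 0)" unfolding 1 by simp
    qed
  qed
  have tiff: "tau bc f \<in> L2_on Q \<longleftrightarrow> f \<in> L2_on Q" for f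
    using tin[of f bc] tin[of "tau bc f" bc] by auto
  have "(f, g) \<in> generator (L2_on Q) W \<longleftrightarrow> (tau bc f, tau bc g) \<in> generator (L2_on Q) U" for f g
    by (simp add: generator_def lim tiff)
  also have "(tau bc f, tau bc g) \<in> generator (L2_on Q) U \<longleftrightarrow> (tau bc f, tau bc (- g)) \<in> ?H" for f g
    unfolding gen by (auto simp: linear_neg[OF bounded_linear.linear[OF bounded_linear_tau]])
       (metis minus_minus)
  finally have "(f, g) \<in> generator (L2_on Q) W \<longleftrightarrow> (f, - g) \<in> ?H" for f g
    by (simp add: schroedinger_operator_tau_iff[OF V])
  then have "generator (L2_on Q) W = {(f, - h) |f h. (f, h) \<in> ?H}"
    by (auto, metis minus_minus)
  then have W: "is_exp_semigroup (L2_on Q) ?H W" using C0W by (simp add: is_exp_semigroup_def)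
  have "W t F = U t F"
    by (rule schroedinger_semigroup_unique[OF open_Q ext_fun_Linf[OF V] U W t F])
  then show ?thesis unfolding W_def by (metis tau_tau)
qed

lemma reflected_semigroup:
  assumes V: "V \<in> Linf T"
    and U: "is_exp_semigroup (L2_on Q) (schroedinger_operator bc Q (ext_fun V)) U"
  shows "is_exp_semigroup (L2_on T) (schroedinger_operator bc T V)
    (\<lambda>t f. (1/2) *\<^sub>R res bc (U t (ext bc f)))"
proof -
  let ?H = "schroedinger_operator bc Q (ext_fun V)"
  have C0: "C0_semigroup_on (L2_on Q) U" and gen: "generator (L2_on Q) U = {(f, - h) |f h. (f, h) \<in> ?H}"
    using U by (auto simp: is_exp_semigroup_def)
  interpret U: L2_semigroup Q U by unfold_locales (rule Q_sets C0)+
  note comm = semigroup_commutes_tau[OF V U]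
  \<comment> \<open>The factor 1/2 is the product of the normalizations 1/sqrt 2 of
    \<open>ext\<close> and \<open>res\<close>.\<close>
  define W where "W t f = (1/2) *\<^sub>R res bc (U t (ext bc f))" for t f
  have Uext: "U t (ext bc f) \<in> L2_on Q" if "0 \<le> t" "f \<in> L2_on T" for t f
    by (intro U.semigroup(1) that ext_in)
  \<comment> \<open>Since \<open>U\<close> commutes with \<open>tau bc\<close>, it preserves the
    functions fixed by \<open>tau bc\<close>, on which \<open>ext\<close> after \<open>res\<close>
    is multiplication by 2. The semigroup law and the generator on \<open>T\<close> can therefore be
    read off on \<open>Q\<close>.\<close>
  have extW: "ext bc (W t f) = U t (ext bc f)" if "0 \<le> t" "f \<in> L2_on T" for t f
  proof -
    have "ext bc (W t f) = (1/2) *\<^sub>R (U t (ext bc f) + tau bc (U t (ext bc f)))"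
      by (simp add: W_def linear_cmul[OF ext_linear] ext_res[OF Uext[OF that]])
    also have "tau bc (U t (ext bc f)) = U t (ext bc f)"
      using comm[OF that(1) ext_in[OF that(2)], of bc] by (simp add: tau_ext)
    finally show ?thesis by (simp add: scaleR_2[symmetric])
  qed
  have Win: "W t f \<in> L2_on T" for t f unfolding W_def by (intro L2_on_scaleR res_in)
  have half: "(1/2) *\<^sub>R res bc (ext bc f) = f" if "f \<in> L2_on T" for f by (simp add: res_ext[OF that])
  have blr: "bounded_linear (\<lambda>F. (1/2) *\<^sub>R res bc F)"
    by (rule bounded_linear_compose[OF bounded_linear_scaleR_right bounded_linear_res])
  have C0W: "C0_semigroup_on (L2_on T) W"
    unfolding C0_semigroup_on_def
  proof (intro conjI allI impI ballI)
    fix t :: real assume t: "0 \<le> t"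
    show "W t f \<in> L2_on T" for f by (rule Win)
    show "W t (f + g) = W t f + W t g" if "f \<in> L2_on T" "g \<in> L2_on T" for f g
      by (simp add: W_def linear_add[OF ext_linear] linear_add[OF res_linear] U.semigroup(2)[OF t] ext_in that scaleR_add_right)
    show "W t (c *\<^sub>C f) = c *\<^sub>C W t f" if "f \<in> L2_on T" for c f
      by (simp add: W_def ext_scaleC res_scaleC U.semigroup(3)[OF t] ext_in that scaleR_L2_def scaleC_scaleC mult.commute)
    obtain C where C: "\<forall>f\<in>L2_on Q. norm (U t f) \<le> C * norm f" using U.semigroup(4)[OF t] by blast
    have "norm (W t f) \<le> C * norm f" if f: "f \<in> L2_on T" for f
    proof -
      have "sqrt 2 * norm (W t f) = norm (U t (ext bc f))" using norm_ext[OF Win] extW[OF t f] by metis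
      also have "\<dots> \<le> C * norm (ext bc f)" using C ext_in[OF f] by blast
      also have "\<dots> = sqrt 2 * (C * norm f)" by (simp add: norm_ext[OF f])
      finally show ?thesis by simp
    qed
    then show "\<exists>C. \<forall>f\<in>L2_on T. norm (W t f) \<le> C * norm f" by blast
  next
    show "W 0 f = f" if "f \<in> L2_on T" for f
      by (simp add: W_def U.semigroup(5) ext_in res_ext that)
    show "W (s + t) f = W s (W t f)" if "0 \<le> s" "0 \<le> t" "f \<in> L2_on T" for s t f
      unfolding W_def[of "s + t"] W_def[of s] extW[OF that(2,3)] U.semigroup(6)[OF that(1,2) ext_in[OF that(3)]] ..
    show "((\<lambda>t. W t f) \<longlongrightarrow> f) (at_right 0)" if "f \<in> L2_on T" for f
      unfolding W_def
      using bounded_linear.tendsto[OF blr U.semigroup(7)[OF ext_in[OF that, of bc]]] half[OF that] by simp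
  qed
  have lim: "((\<lambda>t. (1 / t) *\<^sub>R (W t f - f)) \<longlongrightarrow> g) (at_right 0) \<longleftrightarrow>
      ((\<lambda>t. (1 / t) *\<^sub>R (U t (ext bc f) - ext bc f)) \<longlongrightarrow> ext bc g) (at_right 0)"
    if f: "f \<in> L2_on T" and g: "g \<in> L2_on T" for f g
  proof
    assume "((\<lambda>t. (1 / t) *\<^sub>R (W t f - f)) \<longlongrightarrow> g) (at_right 0)"
    from bounded_linear.tendsto[OF bounded_linear_ext[of bc] this]
    show "((\<lambda>t. (1 / t) *\<^sub>R (U t (ext bc f) - ext bc f)) \<longlongrightarrow> ext bc g) (at_right 0)"
    proof (rule Lim_transform_eventually)
      show "\<forall>\<^sub>F t in at_right 0. ext bc ((1 / t) *\<^sub>R (W t f - f)) = (1 / t) *\<^sub>R (U t (ext bc f) - ext bc f)"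
        using f by (auto simp: eventually_at_filter linear_cmul[OF ext_linear] linear_diff[OF ext_linear] extW
            intro!: always_eventually)
    qed
  next
    assume "((\<lambda>t. (1 / t) *\<^sub>R (U t (ext bc f) - ext bc f)) \<longlongrightarrow> ext bc g) (at_right 0)"
    from bounded_linear.tendsto[OF blr this]
    have l: "((\<lambda>t. (1/2) *\<^sub>R res bc ((1 / t) *\<^sub>R (U t (ext bc f) - ext bc f))) \<longlongrightarrow> g) (at_right 0)"
      by (simp only: half[OF g])
    have "(1/2) *\<^sub>R res bc ((1 / t) *\<^sub>R (U t (ext bc f) - ext bc f)) = (1 / t) *\<^sub>R (W t f - f)" for t
    proof -
      have "(1/2) *\<^sub>R res bc ((1 / t) *\<^sub>R (U t (ext bc f) - ext bc f))
          = (1 / t) *\<^sub>R ((1/2) *\<^sub>R res bc (U t (ext bc f)) - (1/2) *\<^sub>R res bc (ext bc f))"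
        by (simp add: linear_cmul[OF res_linear] linear_diff[OF res_linear] scaleR_diff_right mult.commute)
      then show ?thesis by (simp only: W_def half[OF f])
    qed
    with l show "((\<lambda>t. (1 / t) *\<^sub>R (W t f - f)) \<longlongrightarrow> g) (at_right 0)" by simp
  qed
  have key: "(f, g) \<in> generator (L2_on T) W \<longleftrightarrow> (f, - g) \<in> schroedinger_operator bc T V" for f g
  proof (cases "f \<in> L2_on T \<and> g \<in> L2_on T")
    case True
    then have "(f, g) \<in> generator (L2_on T) W \<longleftrightarrow> (ext bc f, ext bc g) \<in> generator (L2_on Q) U"
      by (simp add: generator_def lim ext_in)
    also have "\<dots> \<longleftrightarrow> (ext bc f, ext bc (- g)) \<in> ?H"
      unfolding gen linear_neg[OF ext_linear] by (auto, metis minus_minus)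
    also have "\<dots> \<longleftrightarrow> (f, - g) \<in> schroedinger_operator bc T V"
      using True by (intro schroedinger_operator_ext V) (auto intro: L2_on_minus)
    finally show ?thesis .
  next
    case False
    then show ?thesis
      using form_domain_in_L2_on[of f bc T] L2_on_minus[of "- g" T]
      by (auto simp: generator_def schroedinger_operator_def)
  qed
  have "generator (L2_on T) W = {(f, - h) |f h. (f, h) \<in> schroedinger_operator bc T V}"
    using key by (auto, metis minus_minus)
  then show ?thesis using C0W unfolding W_def[abs_def] by (simp add: is_exp_semigroup_def)
qed

text \<open>Invariance of the control set lets \<open>chi \<omega>\<close> commute with
  \<open>tau bc\<close>; this is why the control set on the cube has to be symmetric.\<close>

lemma res_chi:
  assumes \<omega>: "\<omega> \<in> sets lebesgue" "\<And>x. \<sigma> x \<in> \<omega> \<longleftrightarrow> x \<in> \<omega>"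
  shows "res bc (chi \<omega> F) = chi (T \<inter> \<omega>) (res bc F)"
proof -
  have T\<omega>: "T \<inter> \<omega> \<in> sets lebesgue" using \<omega> by auto
  have 1: "chi T (chi \<omega> G) = chi (T \<inter> \<omega>) (chi T G)" for G
    unfolding L2_eq_iff
    using rep_chi[OF T_sets, of "chi \<omega> G"] rep_chi[OF \<omega>(1), of G] rep_chi[OF T\<omega>, of "chi T G"] rep_chi[OF T_sets, of G]
    by eventually_elim auto
  have "reflect (chi \<omega> F) = chi \<omega> (reflect F)"
    unfolding L2_eq_iff
    using rep_refl[of "chi \<omega> F"] AE_\<sigma>[OF rep_chi[OF \<omega>(1), of F]] rep_chi[OF \<omega>(1), of "reflect F"] rep_refl[of F]
    by eventually_elim (simp add: \<omega>)
  then have "tau bc (chi \<omega> F) = chi \<omega> (tau bc F)"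
    by (simp add: tau_def mult_on_scaleR[OF \<omega>(1) one_Linf])
  then show ?thesis
    by (simp add: res_def 1[symmetric] mult_on_add[OF \<omega>(1) one_Linf])
qed

text \<open>The scaled \<open>res\<close> intertwines the semigroups, commutes with the cutoffs to
  the control sets and is a contraction. Applied to the control identity on \<open>Q\<close> for the
  extended initial state, it yields the one on \<open>T\<close>.\<close>

lemma transfer_null_controls:
  fixes U :: "real \<Rightarrow> 'a L2 \<Rightarrow> 'a L2" and bc V
  defines "HQ \<equiv> schroedinger_operator bc Q (ext_fun V)" and "HT \<equiv> schroedinger_operator bc T V"
  assumes V: "V \<in> Linf T" and U: "is_exp_semigroup (L2_on Q) HQ U"
    and \<omega>: "\<omega> \<in> sets lebesgue" "\<And>x. \<sigma> x \<in> \<omega> \<longleftrightarrow> x \<in> \<omega>"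
    and t: "0 < t" and u0: "u0 \<in> L2_on T"
    and v: "v \<in> null_controls (L2_on Q) HQ \<omega> t ((1 / sqrt 2) *\<^sub>R ext bc u0)"
  shows "\<exists>w \<in> null_controls (L2_on T) HT (T \<inter> \<omega>) t u0.
    L2_time_norm t (\<lambda>s. chi (T \<inter> \<omega>) (w s)) \<le> L2_time_norm t (\<lambda>s. chi \<omega> (v s))"
proof -
  define UQ where "UQ = exp_semigroup (L2_on Q) HQ"
  define UT where "UT = exp_semigroup (L2_on T) HT"
  have UQ: "is_exp_semigroup (L2_on Q) HQ UQ"
    unfolding UQ_def exp_semigroup_def by (rule someI[of _ U]) (rule U)
  have W: "is_exp_semigroup (L2_on T) HT (\<lambda>t f. (1/2) *\<^sub>R res bc (UQ t (ext bc f)))"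
    using reflected_semigroup[OF V UQ[unfolded HQ_def]] by (simp add: HT_def)
  then have UT: "is_exp_semigroup (L2_on T) HT UT"
    unfolding UT_def exp_semigroup_def by (rule someI[of "is_exp_semigroup (L2_on T) HT"])
  \<comment> \<open>The semigroups in \<open>exp_semigroup\<close> are chosen independently on
    \<open>T\<close> and on \<open>Q\<close>; uniqueness is what relates the two choices.\<close>
  have UT_eq: "UT s f = (1/2) *\<^sub>R res bc (UQ s (ext bc f))" if "0 \<le> s" "f \<in> L2_on T" for s f
    using schroedinger_semigroup_unique[OF open_T V W[unfolded HT_def] UT[unfolded HT_def] that] .
  interpret Q: L2_semigroup Q UQ
    by unfold_locales (use UQ in \<open>auto simp: is_exp_semigroup_def\<close>)
  have T\<omega>: "T \<inter> \<omega> \<in> sets lebesgue" using \<omega> by auto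
  have intertwine: "UT s (res bc F) = res bc (UQ s F)" if s: "0 \<le> s" and F: "F \<in> L2_on Q" for s F
  proof -
    have "UQ s (ext bc (res bc F)) = UQ s F + tau bc (UQ s F)"
      unfolding ext_res[OF F] Q.semigroup(2)[OF s F tau_in_L2_on_Q[OF F]]
        semigroup_commutes_tau[OF V UQ[unfolded HQ_def] s F] ..
    then show ?thesis
      by (simp add: UT_eq[OF s res_in] linear_add[OF res_linear] res_tau scaleR_2[symmetric])
  qed
  define c where "c = 1 / sqrt 2"
  have vin: "v s \<in> L2_on Q" if "s \<in> {0<..<t}" for s
    using v that by (simp add: null_controls_def L2_time_def)
  have vm: "v \<in> borel_measurable (lebesgue_on {0<..<t})"
    and vi: "integrable (lebesgue_on {0<..<t}) (\<lambda>s. (norm (v s))\<^sup>2)"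
    using v by (auto simp: null_controls_def L2_time_def)
  define I where "I s = UQ (t - s) (chi \<omega> (v s))" for s
  have v0: "c *\<^sub>R UQ t (ext bc u0) + (\<integral>s. I s \<partial>lebesgue_on {0<..<t}) = 0"
    using v t by (simp add: null_controls_def UQ_def[symmetric] I_def c_def Q.U_scaleR ext_in[OF u0])
  \<comment> \<open>The factor 1/2 is split as \<open>c * c\<close>: one \<open>c\<close> scales the
    initial state on \<open>Q\<close>, the other belongs to the restriction.\<close>
  have UTu0: "UT t u0 = c *\<^sub>R res bc (c *\<^sub>R UQ t (ext bc u0))"
    using t by (simp add: UT_eq u0 linear_cmul[OF res_linear] c_def)
  have chi_in_Q: "chi \<omega> F \<in> L2_on Q" if "F \<in> L2_on Q" for F
    using that[unfolded L2_on_iff] rep_chi[OF \<omega>(1), of F] unfolding L2_on_iff by eventually_elim auto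
  have blc: "bounded_linear (\<lambda>F. c *\<^sub>R res bc F)"
    by (rule bounded_linear_compose[OF bounded_linear_scaleR_right bounded_linear_res])
  have UTs: "UT (t - s) (chi (T \<inter> \<omega>) (c *\<^sub>R res bc (v s))) = c *\<^sub>R res bc (I s)" if s: "s \<in> {0<..<t}" for s
  proof -
    have "chi (T \<inter> \<omega>) (c *\<^sub>R res bc (v s)) = res bc (chi \<omega> (c *\<^sub>R v s))"
      by (simp add: res_chi[OF \<omega>, symmetric] linear_cmul[OF res_linear, symmetric])
    moreover have "c *\<^sub>R v s \<in> L2_on Q" by (rule L2_on_scaleR[OF vin[OF s]])
    ultimately have "UT (t - s) (chi (T \<inter> \<omega>) (c *\<^sub>R res bc (v s))) = res bc (UQ (t - s) (chi \<omega> (c *\<^sub>R v s)))"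
      using s by (simp add: intertwine chi_in_Q)
    then show ?thesis
      using s vin[OF s]
      by (simp add: I_def mult_on_scaleR[OF \<omega>(1) one_Linf] Q.U_scaleR chi_in_Q linear_cmul[OF res_linear])
  qed
  show ?thesis
  \<comment> \<open>A bounded linear map can be moved into the integral if the integrand is
    integrable, which membership in \<open>null_controls\<close> does not demand explicitly.\<close>
  proof (cases "integrable (lebesgue_on {0<..<t}) I")
    case True
    define w where "w s = c *\<^sub>R res bc (v s)" for s
    have wm: "w \<in> borel_measurable (lebesgue_on {0<..<t})"
      unfolding w_def by (rule bounded_linear_measurable[OF blc vm])
    have "norm (w s) \<le> norm (v s)" if "s \<in> {0<..<t}" for s
      unfolding w_def c_def by (rule norm_res_le[OF vin[OF that]])
    then have "integrable (lebesgue_on {0<..<t}) (\<lambda>s. (norm (w s))\<^sup>2)"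
      by (rule L2_time_mono(1)[OF wm vi])
    then have wL: "w \<in> L2_time t (L2_on T)"
      using wm by (auto simp: L2_time_def w_def intro: L2_on_scaleR res_in)
    have "has_bochner_integral (lebesgue_on {0<..<t}) (\<lambda>s. c *\<^sub>R res bc (I s))
        (c *\<^sub>R res bc (\<integral>s. I s \<partial>lebesgue_on {0<..<t}))"
      by (rule has_bochner_integral_bounded_linear[OF blc has_bochner_integral_integrable[OF True]])
    then have "(\<integral>s. c *\<^sub>R res bc (I s) \<partial>lebesgue_on {0<..<t}) = c *\<^sub>R res bc (\<integral>s. I s \<partial>lebesgue_on {0<..<t})"
      by (rule has_bochner_integral_integral_eq)
    moreover have "(\<integral>s. UT (t - s) (chi (T \<inter> \<omega>) (w s)) \<partial>lebesgue_on {0<..<t})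
        = (\<integral>s. c *\<^sub>R res bc (I s) \<partial>lebesgue_on {0<..<t})"
      by (rule Bochner_Integration.integral_cong) (auto simp: w_def UTs)
    ultimately have "UT t u0 + (\<integral>s. UT (t - s) (chi (T \<inter> \<omega>) (w s)) \<partial>lebesgue_on {0<..<t})
        = c *\<^sub>R res bc (c *\<^sub>R UQ t (ext bc u0) + (\<integral>s. I s \<partial>lebesgue_on {0<..<t}))"
      by (simp add: UTu0 linear_add[OF res_linear] scaleR_add_right)
    also have "\<dots> = 0" unfolding v0 by (simp add: linear_0[OF res_linear])
    finally have "w \<in> null_controls (L2_on T) HT (T \<inter> \<omega>) t u0"
      using wL by (simp add: null_controls_def UT_def)
    moreover have "L2_time_norm t (\<lambda>s. chi (T \<inter> \<omega>) (w s)) \<le> L2_time_norm t (\<lambda>s. chi \<omega> (v s))"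
    proof (rule L2_time_mono(2))
      show "(\<lambda>s. chi (T \<inter> \<omega>) (w s)) \<in> borel_measurable (lebesgue_on {0<..<t})"
        by (rule bounded_linear_measurable[OF bounded_linear_chi[OF T\<omega>] wm])
      show "integrable (lebesgue_on {0<..<t}) (\<lambda>s. (norm (chi \<omega> (v s)))\<^sup>2)"
        by (rule L2_time_mono(1)[OF bounded_linear_measurable[OF bounded_linear_chi[OF \<omega>(1)] vm] vi norm_chi[OF \<omega>(1)]])
      show "norm (chi (T \<inter> \<omega>) (w s)) \<le> norm (chi \<omega> (v s))" if s: "s \<in> {0<..<t}" for s
      proof -
        have "chi (T \<inter> \<omega>) (w s) = c *\<^sub>R res bc (chi \<omega> (v s))"
          by (simp add: w_def mult_on_scaleR[OF T\<omega> one_Linf] res_chi[OF \<omega>])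
        then show ?thesis using norm_res_le[OF chi_in_Q[OF vin[OF s]], of bc] by (simp add: c_def)
      qed
    qed
    ultimately show ?thesis by blast
  next
    case False
    \<comment> \<open>The Bochner integral of a non-integrable function is \<open>0\<close> by convention, so that here
      \<open>u0\<close> is already steered to \<open>0\<close> by the free evolution.\<close>
    have "c *\<^sub>R UQ t (ext bc u0) = 0"
      using v0 by (simp only: not_integrable_integral_eq[OF False] add_0_right)
    then have "UT t u0 = 0"
      by (simp only: UTu0 linear_0[OF res_linear] scaleR_zero_right)
    moreover have "chi (T \<inter> \<omega>) 0 = 0"
      by (rule linear_0[OF bounded_linear.linear[OF bounded_linear_chi[OF T\<omega>]]])
    moreover have "UT s 0 = 0" if "0 \<le> s" for s
      using intertwine[OF that L2_on_zero] Q.U_scaleR[OF that L2_on_zero, of 0] by (simp add: linear_0[OF res_linear])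
    moreover have "(\<integral>s. UT (t - s) 0 \<partial>lebesgue_on {0<..<t}) = (\<integral>s. 0 \<partial>lebesgue_on {0<..<t})"
      using calculation(3) by (intro Bochner_Integration.integral_cong) auto
    ultimately have "(\<lambda>s. 0) \<in> null_controls (L2_on T) HT (T \<inter> \<omega>) t u0"
      by (simp add: null_controls_def L2_time_def UT_def[symmetric] L2_on_zero)
    moreover have "L2_time_norm t (\<lambda>s. chi (T \<inter> \<omega>) (0 :: 'a L2)) \<le> L2_time_norm t (\<lambda>s. chi \<omega> (v s))"
      unfolding \<open>chi (T \<inter> \<omega>) 0 = 0\<close> by (simp add: L2_time_norm_def)
    ultimately show ?thesis by (intro bexI[of _ "\<lambda>s. 0"])
  qed
qed

text \<open>The scaled \<open>ext\<close> maps unit vectors on \<open>T\<close> to unit vectors on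
  \<open>Q\<close>, so the supremum on \<open>T\<close> compares with one over a subset of the unit
  sphere on \<open>Q\<close>, and each infimum is compared by transferring the controls.\<close>

theorem transfer_control_cost:
  assumes V: "V \<in> Linf T" and \<omega>: "\<omega> \<in> sets lebesgue" "\<And>x. \<sigma> x \<in> \<omega> \<longleftrightarrow> x \<in> \<omega>" and t: "0 < t"
    and nc: "null_controllable (L2_on Q) (schroedinger_operator bc Q (ext_fun V)) \<omega> t"
  shows "null_controllable (L2_on T) (schroedinger_operator bc T V) (T \<inter> \<omega>) t"
    and "control_cost (L2_on T) (schroedinger_operator bc T V) (T \<inter> \<omega>) t
      \<le> control_cost (L2_on Q) (schroedinger_operator bc Q (ext_fun V)) \<omega> t"
proof -
  let ?HQ = "schroedinger_operator bc Q (ext_fun V)" and ?HT = "schroedinger_operator bc T V"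
  obtain U where U: "is_exp_semigroup (L2_on Q) ?HQ U" using nc by (auto simp: null_controllable_def)
  note transfer = transfer_null_controls[OF V U \<omega> t]
  have J: "(1 / sqrt 2) *\<^sub>R ext bc u0 \<in> L2_on Q" "norm ((1 / sqrt 2) *\<^sub>R ext bc u0) = norm u0"
    if "u0 \<in> L2_on T" for u0
    using that by (auto simp: norm_ext intro: L2_on_scaleR ext_in)
  show "null_controllable (L2_on T) ?HT (T \<inter> \<omega>) t"
    unfolding null_controllable_def
  proof (intro conjI ballI)
    show "\<exists>U. is_exp_semigroup (L2_on T) ?HT U" using reflected_semigroup[OF V U] by blast
    fix u0 assume u0: "u0 \<in> L2_on T"
    then obtain v where "v \<in> null_controls (L2_on Q) ?HQ \<omega> t ((1 / sqrt 2) *\<^sub>R ext bc u0)"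
      using nc J(1)[OF u0] by (auto simp: null_controllable_def)
    from transfer[OF u0 this] show "null_controls (L2_on T) ?HT (T \<inter> \<omega>) t u0 \<noteq> {}" by blast
  qed
  show "control_cost (L2_on T) ?HT (T \<inter> \<omega>) t \<le> control_cost (L2_on Q) ?HQ \<omega> t"
    unfolding control_cost_def
  proof (rule SUP_least)
    fix u0 assume "u0 \<in> {u0 \<in> L2_on T. norm u0 = 1}"
    then have u0: "u0 \<in> L2_on T" "norm u0 = 1" by auto
    have "(INF v\<in>null_controls (L2_on T) ?HT (T \<inter> \<omega>) t u0. ereal (L2_time_norm t (\<lambda>s. chi (T \<inter> \<omega>) (v s))))
        \<le> (INF v\<in>null_controls (L2_on Q) ?HQ \<omega> t ((1 / sqrt 2) *\<^sub>R ext bc u0). ereal (L2_time_norm t (\<lambda>s. chi \<omega> (v s))))"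
    proof (rule INF_mono)
      fix v assume "v \<in> null_controls (L2_on Q) ?HQ \<omega> t ((1 / sqrt 2) *\<^sub>R ext bc u0)"
      from transfer[OF u0(1) this]
      show "\<exists>w\<in>null_controls (L2_on T) ?HT (T \<inter> \<omega>) t u0. ereal (L2_time_norm t (\<lambda>s. chi (T \<inter> \<omega>) (w s)))
          \<le> ereal (L2_time_norm t (\<lambda>s. chi \<omega> (v s)))" by simp
    qed
    also have "\<dots> \<le> (SUP u0\<in>{u0 \<in> L2_on Q. norm u0 = 1}.
        INF v\<in>null_controls (L2_on Q) ?HQ \<omega> t u0. ereal (L2_time_norm t (\<lambda>s. chi \<omega> (v s))))"
      using J[OF u0(1)] u0(2) by (intro SUP_upper) auto
    finally show "(INF v\<in>null_controls (L2_on T) ?HT (T \<inter> \<omega>) t u0. ereal (L2_time_norm t (\<lambda>s. chi (T \<inter> \<omega>) (v s))))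
        \<le> (SUP u0\<in>{u0 \<in> L2_on Q. norm u0 = 1}.
        INF v\<in>null_controls (L2_on Q) ?HQ \<omega> t u0. ereal (L2_time_norm t (\<lambda>s. chi \<omega> (v s))))" .
  qed
qed

end

section \<open>Halves of cubes\<close>

lemma inner_axis_diff: "x \<bullet> (axis i 1 - axis j 1) = x $ i - (x $ j :: real)"
  by (simp add: inner_diff_right inner_axis)

locale half_cube =
  fixes i j :: "'n::finite" and L :: real
  assumes ij: "i \<noteq> j"
begin

definition cube :: "(real ^ 'n) set" where
  "cube = {x. \<forall>k. 0 < x $ k \<and> x $ k < L}"

definition swap :: "'b ^ 'n \<Rightarrow> 'b ^ 'n" where
  "swap x = (\<chi> k. if k = i then x $ j else if k = j then x $ i else x $ k)"

lemma swap_alt: "(x :: real ^ 'n) - (x \<bullet> (axis i 1 - axis j 1)) *\<^sub>R (axis i 1 - axis j 1) = swap x"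
  unfolding inner_axis_diff using ij by (auto simp: vec_eq_iff swap_def axis_def)

lemma swap_cube: "x \<in> cube \<Longrightarrow> swap x \<in> cube"
  by (auto simp: cube_def swap_def)

lemma swap_axis: "swap (axis k (1::real)) \<in> Basis"
proof -
  have "swap (axis k (1::real)) = axis (if k = i then j else if k = j then i else k) 1"
    using ij by (auto simp: vec_eq_iff swap_def axis_def)
  then show ?thesis by (simp add: axis_in_Basis_iff)
qed

sublocale hyperplane_reflection "axis i 1 - axis j 1 :: real ^ 'n" cube
proof
  show "(axis i 1 - axis j 1 :: real ^ 'n) \<bullet> (axis i 1 - axis j 1) = 2"
    unfolding inner_axis_diff using ij by (simp add: axis_def)
  show "b - (b \<bullet> (axis i 1 - axis j 1)) *\<^sub>R (axis i 1 - axis j 1) \<in> Basis" if "b \<in> Basis" for b :: "real ^ 'n"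
    unfolding swap_alt using that swap_axis by (auto simp: Basis_vec_def)
  have "cube = (\<Inter>k. {x. 0 < x $ k} \<inter> {x. x $ k < L})" by (auto simp: cube_def)
  also have "open \<dots>"
    by (intro open_INT open_Int ballI open_Collect_less continuous_intros finite)
  finally show "open cube" .
  show "x - (x \<bullet> (axis i 1 - axis j 1)) *\<^sub>R (axis i 1 - axis j 1) \<in> cube" if "x \<in> cube" for x
    unfolding swap_alt by (rule swap_cube[OF that])
qed

lemma \<sigma>_swap: "\<sigma> x = swap x"
  by (simp add: \<sigma>_def swap_alt)

lemma T_alt: "T = {x. (\<forall>k. 0 < x $ k \<and> x $ k < L) \<and> x $ j < x $ i}"
  unfolding T_def inner_axis_diff unfolding cube_def by auto

text \<open>Only the part of \<open>S\<close> on the side of \<open>T\<close> is kept, since the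
  control set in the half contains nothing else; on the other side it is replaced by the mirror
  image.\<close>

definition mirrored :: "(real ^ 'n) set \<Rightarrow> (real ^ 'n) set" where
  "mirrored S = {x. x \<in> S \<and> x $ j < x $ i} \<union> {x. swap x \<in> S \<and> x $ i < x $ j}"

lemma swap_nth: "swap x $ i = x $ j" "swap x $ j = x $ i"
  using ij by (auto simp: swap_def)

lemma swap_mirrored: "swap x \<in> mirrored S \<longleftrightarrow> x \<in> mirrored S"
proof -
  have "swap (swap x) = x" using \<sigma>_\<sigma>[of x] by (simp add: \<sigma>_swap)
  then show ?thesis by (auto simp: mirrored_def swap_nth)
qed

lemma mirrored_measurable: "S \<in> sets lebesgue \<Longrightarrow> mirrored S \<in> sets lebesgue"
proof -
  assume S: "S \<in> sets lebesgue"
  have "open {x :: real ^ 'n. x $ j < x $ i}" by (intro open_Collect_less continuous_intros)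
  then have m: "S \<inter> {x. x $ j < x $ i} \<in> sets lebesgue" using S by auto
  have "\<sigma> -` (S \<inter> {x. x $ j < x $ i}) \<in> sets lebesgue"
    using measurable_sets[OF \<sigma>_lebesgue m] by simp
  then have "(S \<inter> {x. x $ j < x $ i}) \<union> \<sigma> -` (S \<inter> {x. x $ j < x $ i}) \<in> sets lebesgue" using m by auto
  also have "(S \<inter> {x. x $ j < x $ i}) \<union> \<sigma> -` (S \<inter> {x. x $ j < x $ i}) = mirrored S"
    by (auto simp: mirrored_def \<sigma>_swap swap_nth)
  finally show ?thesis .
qed

text \<open>A cell of size \<open>2G\<close> on or below the diagonal contains a cell of size \<open>G\<close> strictly below the
  diagonal; the remaining cells of size \<open>2G\<close> are mirror images of such cells.\<close>

lemma equidistributed_mirrored: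
  assumes G: "0 < G" and S: "equidistributed G \<delta> S"
  shows "equidistributed (2 * G) \<delta> (mirrored S)"
proof -
  obtain z :: "int ^ 'n \<Rightarrow> real ^ 'n" where
    z: "\<forall>c. ball (z c) \<delta> \<subseteq> {x. \<forall>k. G * of_int (c $ k) < x $ k \<and> x $ k < G * of_int (c $ k) + G}"
    and zU: "(\<Union>c. ball (z c) \<delta>) \<subseteq> S"
    and Sm: "S \<in> sets lebesgue"
    using S unfolding equidistributed_def by (elim conjE exE) (rule that, assumption+)
  have zS: "ball (z c) \<delta> \<subseteq> S" for c using zU by (simp add: UN_subset_iff)
  \<comment> \<open>The subcell in the upper half in coordinate i and in the lower half in all
    others. If c_j \<le> c_i, its coordinate j stays below G(2 c_j + 1), which is at most the lower
    bound G(2 c_i + 1) of its coordinate i.\<close>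
  define sub :: "int ^ 'n \<Rightarrow> int ^ 'n" where "sub c = (\<chi> k. 2 * c $ k + (if k = i then 1 else 0))" for c
  define y where "y c = z (sub c)" for c
  have cell: "2 * G * of_int (c $ k) < x $ k \<and> x $ k < 2 * G * of_int (c $ k) + 2 * G"
    if "x \<in> ball (y c) \<delta>" for c x k
  proof -
    have "G * of_int (sub c $ k) < x $ k" "x $ k < G * of_int (sub c $ k) + G"
      using subsetD[OF z[rule_format, of "sub c"], of x] that unfolding y_def by simp_all
    then show ?thesis using G by (cases "k = i") (auto simp: sub_def algebra_simps)
  qed
  have below: "x $ j < x $ i" if "x \<in> ball (y c) \<delta>" "c $ j \<le> c $ i" for c x
  proof -
    have "x $ j < G * of_int (sub c $ j) + G" "G * of_int (sub c $ i) < x $ i"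
      using subsetD[OF z[rule_format, of "sub c"], of x] that(1) unfolding y_def by simp_all
    moreover have "G * of_int (sub c $ j) + G \<le> G * of_int (sub c $ i)"
    proof -
      have "real_of_int (sub c $ j) + 1 \<le> of_int (sub c $ i)" using that(2) ij by (simp add: sub_def)
      then have "G * (real_of_int (sub c $ j) + 1) \<le> G * of_int (sub c $ i)" using G by (intro mult_left_mono) auto
      then show ?thesis by (simp add: distrib_left)
    qed
    ultimately show ?thesis by linarith
  qed
  define w where "w c = (if c $ j \<le> c $ i then y c else swap (y (swap c)))" for c
  have refl_ball: "swap x \<in> ball p \<delta>" if "x \<in> ball (swap p) \<delta>" for x p :: "real ^ 'n"
  proof -
    have "norm (\<sigma> (x - swap p)) = norm (x - swap p)"
      by (simp add: norm_eq_sqrt_inner inner_\<sigma>)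
    moreover have "\<sigma> (x - swap p) = swap x - p"
      unfolding \<sigma>_swap[of p, symmetric] linear_diff[OF linear_\<sigma>] \<sigma>_\<sigma> unfolding \<sigma>_swap ..
    ultimately show ?thesis using that by (simp add: dist_norm norm_minus_commute)
  qed
  have main: "(\<forall>k. 2 * G * of_int (c $ k) < x $ k \<and> x $ k < 2 * G * of_int (c $ k) + 2 * G) \<and> x \<in> mirrored S"
    if x: "x \<in> ball (w c) \<delta>" for c x
  proof (cases "c $ j \<le> c $ i")
    case True
    then have "x \<in> ball (y c) \<delta>" using x by (simp add: w_def)
    then show ?thesis
      using cell[of x c] below[of x c] True zS[of "sub c"] by (auto simp: mirrored_def y_def)
  next
    case False
    then have sx: "swap x \<in> ball (y (swap c)) \<delta>" using x refl_ball by (simp add: w_def)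
    have "swap c $ j \<le> swap c $ i" using False by (simp add: swap_nth)
    then have "swap x $ j < swap x $ i" by (rule below[OF sx])
    then have "x \<in> mirrored S" using sx zS[of "sub (swap c)"] by (auto simp: mirrored_def y_def swap_nth)
    moreover have "2 * G * of_int (c $ k) < x $ k \<and> x $ k < 2 * G * of_int (c $ k) + 2 * G" for k
      using cell[OF sx, of i] cell[OF sx, of j] cell[OF sx, of k] ij
      by (cases "k = i"; cases "k = j") (auto simp: swap_def)
    ultimately show ?thesis by blast
  qed
  show ?thesis
    unfolding equidistributed_def using main mirrored_measurable[OF Sm] by (intro conjI exI[of _ w]) auto
qed

theorem half_cube_control_cost:
  assumes D: "rectangle_cost_constant TYPE('n) D"
    and G: "0 < G" and \<delta>: "0 < \<delta>" "\<delta> < G / 2" and L: "2 * G \<le> L"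
    and V: "V \<in> Linf T" and S: "equidistributed G \<delta> S" and t: "0 < t"
  shows "null_controllable (L2_on T) (schroedinger_operator bc T V) (T \<inter> S) t"
    and "control_cost (L2_on T) (schroedinger_operator bc T V) (T \<inter> S) t \<le> ereal (cost_bound D (2 * G) \<delta> T V t)"
proof -
  have cube: "generalized_rectangle (\<chi> k. ereal 0) (\<chi> k. ereal L) = cube"
    by (auto simp: generalized_rectangle_def cube_def zero_ereal_def[symmetric])
  let ?\<omega> = "cube \<inter> mirrored S" and ?H = "schroedinger_operator bc cube (ext_fun V)"
  have Lpos: "0 < L" using G L by linarith
  \<comment> \<open>The bound on the cube is used at scale 2G, where the hypothesis
    \<open>2 * G \<le> L\<close> says that the cube contains the reference cell of side 2G.\<close>
  have nc: "null_controllable (L2_on cube) ?H ?\<omega> t \<and>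
      control_cost (L2_on cube) ?H ?\<omega> t \<le> ereal (cost_bound D (2 * G) \<delta> cube (ext_fun V) t)"
    using D[unfolded rectangle_cost_constant_def, THEN conjunct2, rule_format,
        of "2 * G" \<delta> "\<chi> k. ereal 0" "\<chi> k. ereal L" "ext_fun V" "mirrored S" t bc,
        unfolded cube Let_def]
      G \<delta> L Lpos ext_fun_Linf[OF V] equidistributed_mirrored[OF G S] t
    by (auto simp: cube_def subset_iff intro: less_le_trans)
  have cb: "cost_bound D (2 * G) \<delta> cube (ext_fun V) t = cost_bound D (2 * G) \<delta> T V t"
    by (simp add: cost_bound_def Linf_norm_ext_fun[OF V])
  have \<omega>: "?\<omega> \<in> sets lebesgue"
    using S by (auto simp: equidistributed_def intro!: mirrored_measurable)
  have inv: "\<sigma> x \<in> ?\<omega> \<longleftrightarrow> x \<in> ?\<omega>" for x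
    using swap_mirrored[of x S] \<sigma>_Q[of x] by (simp add: \<sigma>_swap)
  have T\<omega>: "T \<inter> ?\<omega> = T \<inter> S"
    unfolding T_alt mirrored_def unfolding cube_def by auto
  show "null_controllable (L2_on T) (schroedinger_operator bc T V) (T \<inter> S) t"
    using transfer_control_cost(1)[OF V \<omega> inv t conjunct1[OF nc]] unfolding T\<omega> .
  show "control_cost (L2_on T) (schroedinger_operator bc T V) (T \<inter> S) t \<le> ereal (cost_bound D (2 * G) \<delta> T V t)"
    using transfer_control_cost(2)[OF V \<omega> inv t conjunct1[OF nc]] conjunct2[OF nc]
    unfolding T\<omega> cb by (rule order_trans)
qed

end

text \<open>The base of the power is at most 1, so making its exponent more negative increases it;
  the other factors grow with the constant as well. This permits one constant for both
  dimensions.\<close>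

lemma cost_bound_mono:
  assumes "0 < D" "D \<le> R" "0 < \<delta>" "\<delta> \<le> G" "0 < t"
  shows "cost_bound D G \<delta> \<Omega> V t \<le> cost_bound R G \<delta> \<Omega> V t"
  unfolding cost_bound_def
proof (intro mult_mono mult_nonneg_nonneg divide_right_mono exp_le_cancel_iff[THEN iffD2] add_right_mono)
  let ?A = "1 + G powr (4 / 3) * Linf_norm \<Omega> V powr (2 / 3)"
  show "(\<delta> / G) powr (- D * ?A) \<le> (\<delta> / G) powr (- R * ?A)"
    using assms by (intro powr_mono') (auto intro!: mult_right_mono add_nonneg_nonneg)
qed (use assms in \<open>auto intro!: divide_right_mono mult_right_mono\<close>)

theorem proposition2p15:
  fixes D :: "nat \<Rightarrow> real" and G \<delta> L :: real
  assumes "rectangle_cost_constant TYPE(2) (D 2)"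
    and "rectangle_cost_constant TYPE(3) (D 3)"
    and "0 < G" and "0 < \<delta>" and "\<delta> < G / 2" and "2 * G \<le> L"
  shows "(\<forall>bc V S T. V \<in> Linf (right_triangle L) \<longrightarrow> equidistributed G \<delta> S \<longrightarrow> 0 < T \<longrightarrow>
      (let \<Omega> = right_triangle L; \<omega> = \<Omega> \<inter> S; H = schroedinger_operator bc \<Omega> V; R = max (D 2) (D 3)
       in null_controllable (L2_on \<Omega>) H \<omega> T \<and>
          control_cost (L2_on \<Omega>) H \<omega> T \<le> ereal (cost_bound R (2 * G) \<delta> \<Omega> V T))) \<and>
    (\<forall>bc V S T. V \<in> Linf (prism L) \<longrightarrow> equidistributed G \<delta> S \<longrightarrow> 0 < T \<longrightarrow>
      (let \<Omega> = prism L; \<omega> = \<Omega> \<inter> S; H = schroedinger_operator bc \<Omega> V; R = max (D 2) (D 3)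
       in null_controllable (L2_on \<Omega>) H \<omega> T \<and>
          control_cost (L2_on \<Omega>) H \<omega> T \<le> ereal (cost_bound R (2 * G) \<delta> \<Omega> V T)))"
proof -
  have pos: "0 < D 2" "0 < D 3" using assms(1,2) by (auto simp: rectangle_cost_constant_def)
  have \<delta>: "\<delta> \<le> 2 * G" using assms by linarith
  let ?R = "max (D 2) (D 3)"
  interpret triangle: half_cube "1 :: 2" 2 L by unfold_locales simp
  \<comment> \<open>Only the first two coordinates are exchanged; the third is a spectator, so the
    half of the cube is the triangle times an interval.\<close>
  interpret prism: half_cube "1 :: 3" 2 L by unfold_locales simp
  have triangle: "right_triangle L = triangle.T"
    unfolding triangle.T_alt by (auto simp: right_triangle_def forall_2)
  have prism: "prism L = prism.T"
    unfolding prism.T_alt by (auto simp: prism_def right_triangle_def forall_3)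
  have 2: "null_controllable (L2_on triangle.T) (schroedinger_operator bc triangle.T V) (triangle.T \<inter> S) T \<and>
      control_cost (L2_on triangle.T) (schroedinger_operator bc triangle.T V) (triangle.T \<inter> S) T
        \<le> ereal (cost_bound ?R (2 * G) \<delta> triangle.T V T)"
    if VST: "V \<in> Linf triangle.T" "equidistributed G \<delta> S" "0 < T" for bc V S T
  proof
    note cost = triangle.half_cube_control_cost[OF assms(1,3-6) VST, of bc]
    show "null_controllable (L2_on triangle.T) (schroedinger_operator bc triangle.T V) (triangle.T \<inter> S) T"
      by (rule cost(1))
    note cost(2)
    also have "ereal (cost_bound (D 2) (2 * G) \<delta> triangle.T V T) \<le> ereal (cost_bound ?R (2 * G) \<delta> triangle.T V T)"
      unfolding ereal_less_eq using pos by (intro cost_bound_mono assms(4) \<delta> VST(3)) auto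
    finally show "control_cost (L2_on triangle.T) (schroedinger_operator bc triangle.T V) (triangle.T \<inter> S) T
        \<le> ereal (cost_bound ?R (2 * G) \<delta> triangle.T V T)" .
  qed
  have 3: "null_controllable (L2_on prism.T) (schroedinger_operator bc prism.T V) (prism.T \<inter> S) T \<and>
      control_cost (L2_on prism.T) (schroedinger_operator bc prism.T V) (prism.T \<inter> S) T
        \<le> ereal (cost_bound ?R (2 * G) \<delta> prism.T V T)"
    if VST: "V \<in> Linf prism.T" "equidistributed G \<delta> S" "0 < T" for bc V S T
  proof
    note cost = prism.half_cube_control_cost[OF assms(2-6) VST, of bc]
    show "null_controllable (L2_on prism.T) (schroedinger_operator bc prism.T V) (prism.T \<inter> S) T"
      by (rule cost(1))
    note cost(2)
    also have "ereal (cost_bound (D 3) (2 * G) \<delta> prism.T V T) \<le> ereal (cost_bound ?R (2 * G) \<delta> prism.T V T)"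
      unfolding ereal_less_eq using pos by (intro cost_bound_mono assms(4) \<delta> VST(3)) auto
    finally show "control_cost (L2_on prism.T) (schroedinger_operator bc prism.T V) (prism.T \<inter> S) T
        \<le> ereal (cost_bound ?R (2 * G) \<delta> prism.T V T)" .
  qed
  show ?thesis
    unfolding triangle prism Let_def using 2 3 by simp
qed

end
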